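(* Let $k$ be a field of characteristic $0$ with algebraic closure $\bar k$, and let $F_2(k)$ be the free pro-unipotent algebraic group (its $k$-points) with two variables $x$ and $y$. Suppose that $f=f(x,y)\in F_2(k)$ satisfies the pentagon equation $$f(x_{12},x_{23}x_{24})\,f(x_{13}x_{23},x_{34})=f(x_{23},x_{34})\,f(x_{12}x_{13},x_{24}x_{34})\,f(x_{12},x_{23})$$ in $K_4(k)$. Then there exists an element $\lambda\in\bar k$, unique up to sign, such that the pair $(\lambda,f)$ satisfies the hexagon equations $$f(z,x)z^mf(y,z)y^mf(x,y)x^m=1\quad\text{with } xyz=1 \text{ and } m=\frac{\lambda-1}{2},$$ $$f(x,y)f(y,x)=1$$ (equations in $F_2(\bar k)$). Moreover, this $\lambda$ is equal to $\pm(24c_2(f)+1)^{1/2}$.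
   Context: $F_2(k)$ is the group of $k$-points of the pro-unipotent completion of the free group on $x,y$; via $x\mapsto e^X$, $y\mapsto e^Y$ it is identified with the group of group-like elements of $k\langle\langle X,Y\rangle\rangle$ (constant term $1$ and $\Delta(\varphi)=\varphi\otimes\varphi$, with $X,Y$ primitive). $c_2(f)$ is the coefficient of $XY$ in $f(e^X,e^Y)\in k\langle\langle X,Y\rangle\rangle$. For elements $a,b$ of a pro-unipotent group, $f(a,b)$ is the image of $f$ under the homomorphism of pro-unipotent groups with $x\mapsto a$, $y\mapsto b$; for $m\in\bar k$, $a^m=\exp(m\log a)$. $K_4=\ker(B_4\to\mathfrak S_4)$ is the pure braid group on $4$ strings ($B_4$ the Artin braid group with generators $\sigma_1,\sigma_2,\sigma_3$, $\mathfrak S_4$ the symmetric group), and $K_4(k)$ is the group of $k$-points of its unipotent completion. The standard generators are $x_{ij}=(\sigma_{j-1}\cdots\sigma_{i+1})\,\sigma_i^2\,(\sigma_{j-1}\cdots\sigma_{i+1})^{-1}$ for $1\le i<j\le4$. *)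

theory Defs
  imports
    "HOL-Algebra.Algebraic_Closure_Type"
    "HOL-Library.Poly_Mapping"
    "HOL-Combinatorics.Transposition"
    Complex_Main
begin

section \<open>Separated filtered rings and their topology\<close>

class filtered_ring = ring_1 + topological_space +
  fixes fil :: "nat \<Rightarrow> 'a set"
  assumes open_iff_fil: "open U \<longleftrightarrow> (\<forall>a\<in>U. \<exists>n. \<forall>b. b - a \<in> fil n \<longrightarrow> b \<in> U)"
    and fil_zero: "0 \<in> fil n"
    and fil_add: "a \<in> fil n \<Longrightarrow> b \<in> fil n \<Longrightarrow> a + b \<in> fil n"
    and fil_uminus: "a \<in> fil n \<Longrightarrow> - a \<in> fil n"
    and fil_mult_left: "a \<in> fil n \<Longrightarrow> b * a \<in> fil n"
    and fil_mult_right: "a \<in> fil n \<Longrightarrow> a * b \<in> fil n"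
    and fil_Suc: "fil (Suc n) \<subseteq> fil n"
    and fil_separated: "(\<And>n. a \<in> fil n) \<Longrightarrow> a = 0"
begin

lemma fil_diff: "a \<in> fil n \<Longrightarrow> b \<in> fil n \<Longrightarrow> a - b \<in> fil n"
  using fil_add[of a n "- b"] fil_uminus[of b n] by simp

lemma open_fil_coset: "open {c. c - a \<in> fil n}"
  unfolding open_iff_fil
proof (intro ballI exI allI impI)
  fix c b assume "c \<in> {c. c - a \<in> fil n}" "b - c \<in> fil n"
  then have "(b - c) + (c - a) \<in> fil n" by (intro fil_add) auto
  then show "b \<in> {c. c - a \<in> fil n}" by (simp add: algebra_simps)
qed

subclass t2_space
proof
  fix a b :: 'a assume "a \<noteq> b"
  then have "b - a \<noteq> 0" by simp
  then obtain n where n: "b - a \<notin> fil n" using fil_separated[of "b - a"] by auto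
  have "{c. c - a \<in> fil n} \<inter> {c. c - b \<in> fil n} = {}"
  proof -
    have False if "c - a \<in> fil n" "c - b \<in> fil n" for c
      using fil_diff[OF that] n by (simp add: algebra_simps)
    then show ?thesis by blast
  qed
  moreover have "a \<in> {c. c - a \<in> fil n}" "b \<in> {c. c - b \<in> fil n}"
    using fil_zero by simp_all
  ultimately show "\<exists>U V. open U \<and> open V \<and> a \<in> U \<and> b \<in> V \<and> U \<inter> V = {}"
    using open_fil_coset[of a n] open_fil_coset[of b n]
    by (intro exI[of _ "{c. c - a \<in> fil n}"] exI[of _ "{c. c - b \<in> fil n}"] conjI)
qed

end

text \<open>
  In the next three definitions \<open>\<iota>\<close> is the structure map of a complete filtered
  algebra over the field \<open>'k\<close>; the series converge for \<open>a \<in> fil 1\<close>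
  (respectively \<open>a - 1 \<in> fil 1\<close>).
\<close>

definition alg_exp :: "('k::field_char_0 \<Rightarrow> 'a) \<Rightarrow> 'a \<Rightarrow> 'a::filtered_ring" where
  "alg_exp \<iota> a = suminf (\<lambda>n. \<iota> (1 / fact n) * a ^ n)"

definition alg_log :: "('k::field_char_0 \<Rightarrow> 'a) \<Rightarrow> 'a \<Rightarrow> 'a::filtered_ring" where
  "alg_log \<iota> a = suminf (\<lambda>n. \<iota> ((- 1) ^ n / of_nat (Suc n)) * (a - 1) ^ Suc n)"

definition alg_pow :: "('k::field_char_0 \<Rightarrow> 'a) \<Rightarrow> 'a \<Rightarrow> 'k \<Rightarrow> 'a::filtered_ring" where
  "alg_pow \<iota> a m = alg_exp \<iota> (\<iota> m * alg_log \<iota> a)"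


section \<open>Power series in two noncommuting variables\<close>

datatype letter = LX | LY

lemma UNIV_letter: "(UNIV :: letter set) = {LX, LY}"
  using letter.exhaust by auto

instance letter :: finite
  by standard (simp add: UNIV_letter)

typedef 'k ncfps = "UNIV :: (letter list \<Rightarrow> 'k) set"
  morphisms nc_coeff Abs_ncfps ..

setup_lifting type_definition_ncfps

lemma ncfps_eqI: "(\<And>w. nc_coeff f w = nc_coeff g w) \<Longrightarrow> f = g"
  by transfer auto

instantiation ncfps :: (ring_1) ring_1
begin

lift_definition zero_ncfps :: "'a ncfps" is "\<lambda>w. 0" .
lift_definition one_ncfps :: "'a ncfps" is "\<lambda>w. if w = [] then 1 else 0" .
lift_definition plus_ncfps :: "'a ncfps \<Rightarrow> 'a ncfps \<Rightarrow> 'a ncfps" is "\<lambda>f g w. f w + g w" .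
lift_definition minus_ncfps :: "'a ncfps \<Rightarrow> 'a ncfps \<Rightarrow> 'a ncfps" is "\<lambda>f g w. f w - g w" .
lift_definition uminus_ncfps :: "'a ncfps \<Rightarrow> 'a ncfps" is "\<lambda>f w. - f w" .
lift_definition times_ncfps :: "'a ncfps \<Rightarrow> 'a ncfps \<Rightarrow> 'a ncfps" is
  "\<lambda>f g w. \<Sum>i=0..length w. f (take i w) * g (drop i w)" .

instance
proof
  fix a b c :: "'a ncfps"
  show "a * b * c = a * (b * c)"
  proof (transfer, rule ext)
    fix a b c :: "letter list \<Rightarrow> 'a" and w
    define F where "F = (\<lambda>i l (r::nat). a (take i w) * b (take l (drop i w)) * c (drop (i + l) w))"
    have "(\<Sum>i=0..length w. (\<Sum>j=0..length (take i w). a (take j (take i w)) * b (drop j (take i w))) * c (drop i w))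
        = (\<Sum>i=0..length w. \<Sum>j=0..i. F j (i - j) (length w - i))"
      by (intro sum.cong) (auto simp: sum_distrib_right F_def min_def drop_take)
    also have "\<dots> = (\<Sum>i=0..length w. \<Sum>j=0..length w - i. F i j (length w - i - j))"
      by (rule fps_mult_assoc_lemma)
    also have "\<dots> = (\<Sum>i=0..length w. a (take i w) * (\<Sum>j=0..length (drop i w). b (take j (drop i w)) * c (drop j (drop i w))))"
      by (intro sum.cong) (auto simp: sum_distrib_left F_def mult.assoc add.commute)
    finally show "(\<Sum>i=0..length w. (\<Sum>j=0..length (take i w). a (take j (take i w)) * b (drop j (take i w))) * c (drop i w))
      = (\<Sum>i=0..length w. a (take i w) * (\<Sum>j=0..length (drop i w). b (take j (drop i w)) * c (drop j (drop i w))))" .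
  qed
  show "1 * a = a"
  proof (transfer, rule ext)
    fix a :: "letter list \<Rightarrow> 'a" and w
    have "(\<Sum>i=0..length w. (if take i w = [] then 1 else 0) * a (drop i w))
      = (\<Sum>i\<in>{0}. (if take i w = [] then 1 else 0) * a (drop i w))"
      by (intro sum.mono_neutral_right) auto
    then show "(\<Sum>i=0..length w. (if take i w = [] then 1 else 0) * a (drop i w)) = a w" by simp
  qed
  show "a * 1 = a"
  proof (transfer, rule ext)
    fix a :: "letter list \<Rightarrow> 'a" and w
    have "(\<Sum>i=0..length w. a (take i w) * (if drop i w = [] then 1 else 0))
      = (\<Sum>i\<in>{length w}. a (take i w) * (if drop i w = [] then 1 else 0))"
      by (intro sum.mono_neutral_right) auto
    then show "(\<Sum>i=0..length w. a (take i w) * (if drop i w = [] then 1 else 0)) = a w" by simp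
  qed
  show "(a + b) * c = a * c + b * c"
    by transfer (simp add: algebra_simps sum.distrib)
  show "a * (b + c) = a * b + a * c"
    by transfer (simp add: algebra_simps sum.distrib)
  show "(0::'a ncfps) \<noteq> 1"
  proof
    assume "(0::'a ncfps) = 1"
    then have "nc_coeff (0::'a ncfps) [] = nc_coeff 1 []" by (rule arg_cong)
    then show False by (simp add: zero_ncfps.rep_eq one_ncfps.rep_eq)
  qed
  show "a + b + c = a + (b + c)" "a + b = b + a" "0 + a = a" "- a + a = 0" "a - b = a + - b"
    by (simp_all add: nc_coeff_inject[symmetric] fun_eq_iff plus_ncfps.rep_eq
        minus_ncfps.rep_eq uminus_ncfps.rep_eq zero_ncfps.rep_eq add.assoc add.commute)
qed

end

instantiation ncfps :: (ring_1) filtered_ring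
begin

definition fil_ncfps :: "nat \<Rightarrow> 'a ncfps set" where
  "fil_ncfps n = {f. \<forall>w. length w < n \<longrightarrow> nc_coeff f w = 0}"

definition open_ncfps :: "'a ncfps set \<Rightarrow> bool" where
  "open_ncfps U \<longleftrightarrow> (\<forall>a\<in>U. \<exists>n. \<forall>b. b - a \<in> fil n \<longrightarrow> b \<in> U)"

instance
proof
  show "open (UNIV :: 'a ncfps set)" by (simp add: open_ncfps_def)
next
  fix S T :: "'a ncfps set" assume *: "open S" "open T"
  show "open (S \<inter> T)" unfolding open_ncfps_def
  proof
    fix a assume "a \<in> S \<inter> T"
    then obtain m n where "\<And>b. b - a \<in> fil m \<Longrightarrow> b \<in> S" "\<And>b. b - a \<in> fil n \<Longrightarrow> b \<in> T"
      using * unfolding open_ncfps_def by blast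
    moreover have "c \<in> fil m \<and> c \<in> fil n" if "c \<in> fil (max m n)" for c :: "'a ncfps"
      using that by (auto simp: fil_ncfps_def)
    ultimately show "\<exists>n. \<forall>b. b - a \<in> fil n \<longrightarrow> b \<in> S \<inter> T" by blast
  qed
next
  fix K :: "'a ncfps set set" assume *: "\<forall>S\<in>K. open S"
  show "open (\<Union>K)" unfolding open_ncfps_def
  proof
    fix a assume "a \<in> \<Union>K"
    then obtain S where "S \<in> K" "a \<in> S" by blast
    with * obtain n where "\<forall>b. b - a \<in> fil n \<longrightarrow> b \<in> S" unfolding open_ncfps_def by blast
    with \<open>S \<in> K\<close> show "\<exists>n. \<forall>b. b - a \<in> fil n \<longrightarrow> b \<in> \<Union>K" by blast
  qed
next
  fix a b :: "'a ncfps" and n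
  show "a \<in> fil n \<Longrightarrow> b * a \<in> fil n" unfolding fil_ncfps_def
    by (auto simp: times_ncfps.rep_eq intro!: sum.neutral)
  show "a \<in> fil n \<Longrightarrow> a * b \<in> fil n" unfolding fil_ncfps_def
    by (auto simp: times_ncfps.rep_eq intro!: sum.neutral)
next
  fix a :: "'a ncfps" assume "\<And>n. a \<in> fil n"
  then have "nc_coeff a w = 0" for w
    using lessI[of "length w"] unfolding fil_ncfps_def by blast
  then show "a = 0" by (intro ncfps_eqI) (simp add: zero_ncfps.rep_eq)
next
  fix U :: "'a ncfps set"
  show "open U \<longleftrightarrow> (\<forall>a\<in>U. \<exists>n. \<forall>b. b - a \<in> fil n \<longrightarrow> b \<in> U)"
    by (rule open_ncfps_def)
qed (simp_all add: fil_ncfps_def zero_ncfps.rep_eq plus_ncfps.rep_eq uminus_ncfps.rep_eq subset_eq)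

end

lift_definition nc_const :: "'k::zero \<Rightarrow> 'k ncfps" is "\<lambda>c w. if w = [] then c else 0" .

lift_definition nc_X :: "'k::zero_neq_one ncfps" is "\<lambda>w. if w = [LX] then 1 else 0" .
lift_definition nc_Y :: "'k::zero_neq_one ncfps" is "\<lambda>w. if w = [LY] then 1 else 0" .

lift_definition map_ncfps :: "('k \<Rightarrow> 'l) \<Rightarrow> 'k ncfps \<Rightarrow> 'l ncfps" is "\<lambda>h f w. h (f w)" .

text \<open>
  The terms \<open>u \<otimes> v\<close>, with multiplicity, of \<open>\<Delta>(w) = (c\<^sub>1 \<otimes> 1 + 1 \<otimes> c\<^sub>1) \<cdots> (c\<^sub>n \<otimes> 1 + 1 \<otimes> c\<^sub>n)\<close>
  for a word \<open>w = c\<^sub>1 \<cdots> c\<^sub>n\<close>.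
\<close>

fun word_coproduct :: "letter list \<Rightarrow> (letter list \<times> letter list) list" where
  "word_coproduct [] = [([], [])]"
| "word_coproduct (c # w) =
     map (\<lambda>(u, v). (c # u, v)) (word_coproduct w) @ map (\<lambda>(u, v). (u, c # v)) (word_coproduct w)"

text \<open>The coefficient of \<open>u \<otimes> v\<close> in \<open>\<Delta>(f)\<close>; only words of length \<open>|u| + |v|\<close> contribute.\<close>

definition nc_coproduct :: "'k::field ncfps \<Rightarrow> letter list \<Rightarrow> letter list \<Rightarrow> 'k" where
  "nc_coproduct f u v =
     (\<Sum>w | length w = length u + length v.
        of_nat (count_list (word_coproduct w) (u, v)) * nc_coeff f w)"

text \<open>The group \<open>F\<^sub>2(k)\<close>, with \<open>x = e\<^sup>X\<close> and \<open>y = e\<^sup>Y\<close>.\<close>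

definition F2 :: "'k::field ncfps set" where
  "F2 = {f. nc_coeff f [] = 1 \<and> (\<forall>u v. nc_coproduct f u v = nc_coeff f u * nc_coeff f v)}"

definition c2 :: "'k ncfps \<Rightarrow> 'k" where
  "c2 f = nc_coeff f [LX, LY]"

text \<open>
  The value \<open>f(a, b)\<close>: the continuous algebra homomorphism with
  \<open>X \<mapsto> log a\<close>, \<open>Y \<mapsto> log b\<close>, that is \<open>e\<^sup>X \<mapsto> a\<close>, \<open>e\<^sup>Y \<mapsto> b\<close>, applied to \<open>f\<close>.
\<close>

definition nc_eval :: "('k::field_char_0 \<Rightarrow> 'a) \<Rightarrow> 'k ncfps \<Rightarrow> 'a \<Rightarrow> 'a \<Rightarrow> 'a::filtered_ring" where
  "nc_eval \<iota> f a b =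
     suminf (\<lambda>n. \<Sum>w | length w = n.
        \<iota> (nc_coeff f w) * prod_list (map (case_letter (alg_log \<iota> a) (alg_log \<iota> b)) w))"


section \<open>The completed group algebra\<close>

text \<open>
  The type \<^typ>\<open>'g \<Rightarrow>\<^sub>0 'k\<close> with its convolution product is the group algebra \<open>k[G]\<close>. Groups are
  written additively, because \<^class>\<open>group_add\<close> is the library class of not necessarily commutative groups.
\<close>

definition augmentation :: "('g \<Rightarrow>\<^sub>0 'k::field) \<Rightarrow> 'k" where
  "augmentation u = (\<Sum>g\<in>Poly_Mapping.keys u. Poly_Mapping.lookup u g)"

text \<open>Powers of the augmentation ideal.\<close>

inductive aug_power :: "nat \<Rightarrow> ('g::group_add \<Rightarrow>\<^sub>0 'k::field) \<Rightarrow> bool" where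
  aug_power_0: "aug_power 0 u"
| aug_power_mult: "augmentation a = 0 \<Longrightarrow> aug_power n b \<Longrightarrow> aug_power (Suc n) (a * b)"
| aug_power_zero: "aug_power n 0"
| aug_power_add: "aug_power n a \<Longrightarrow> aug_power n b \<Longrightarrow> aug_power n (a + b)"

lemma augmentation_superset:
  "finite A \<Longrightarrow> Poly_Mapping.keys u \<subseteq> A \<Longrightarrow> augmentation u = (\<Sum>g\<in>A. Poly_Mapping.lookup u g)"
  unfolding augmentation_def by (intro sum.mono_neutral_left) (auto simp: in_keys_iff)

lemma augmentation_add: "augmentation (u + v) = augmentation u + augmentation v"
proof -
  let ?A = "Poly_Mapping.keys u \<union> Poly_Mapping.keys v"
  have "augmentation (u + v) = (\<Sum>g\<in>?A. Poly_Mapping.lookup (u + v) g)"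
    using keys_add[of u v] by (intro augmentation_superset) auto
  moreover have "augmentation u = (\<Sum>g\<in>?A. Poly_Mapping.lookup u g)"
    by (intro augmentation_superset) auto
  moreover have "augmentation v = (\<Sum>g\<in>?A. Poly_Mapping.lookup v g)"
    by (intro augmentation_superset) auto
  ultimately show ?thesis by (simp add: lookup_add sum.distrib)
qed

lemma augmentation_zero [simp]: "augmentation 0 = 0"
  by (simp add: augmentation_def)

lemma augmentation_single [simp]: "augmentation (Poly_Mapping.single g c) = c"
  by (simp add: augmentation_def)

lemma augmentation_one [simp]: "augmentation (1 :: 'g::group_add \<Rightarrow>\<^sub>0 'k::field) = 1"
  using augmentation_single[of 0 "1::'k"] by simp

lemma augmentation_sum: "augmentation (\<Sum>i\<in>A. u i) = (\<Sum>i\<in>A. augmentation (u i))"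
  by (induction A rule: infinite_finite_induct) (simp_all add: augmentation_add)

lemma group_algebra_expand:
  "u = (\<Sum>g\<in>Poly_Mapping.keys u. Poly_Mapping.single g (Poly_Mapping.lookup u g))"
  by (rule poly_mapping_eqI)
    (auto simp: lookup_sum lookup_single when_def in_keys_iff sum.delta)

lemma augmentation_mult:
  fixes u v :: "'g::group_add \<Rightarrow>\<^sub>0 'k::field"
  shows "augmentation (u * v) = augmentation u * augmentation v"
proof -
  have "u * v = (\<Sum>g\<in>Poly_Mapping.keys u. \<Sum>h\<in>Poly_Mapping.keys v.
      Poly_Mapping.single (g + h) (Poly_Mapping.lookup u g * Poly_Mapping.lookup v h))"
    using arg_cong2[OF group_algebra_expand[of u] group_algebra_expand[of v], of "(*)"]
    by (simp only: sum_product mult_single)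
  then show ?thesis
    by (simp add: augmentation_sum sum_product augmentation_def[of u] augmentation_def[of v])
qed

lemma aug_power_mult_right: "aug_power n a \<Longrightarrow> aug_power n (a * b)"
  by (induction rule: aug_power.induct)
    (auto simp: mult.assoc distrib_right intro: aug_power.intros)

lemma aug_power_mult_left:
  assumes "aug_power n a" shows "aug_power n (b * a)"
  using assms
proof (induction arbitrary: b rule: aug_power.induct)
  case (aug_power_mult a n c)
  have "aug_power (Suc n) ((b * a) * c)"
    using aug_power_mult by (intro aug_power.aug_power_mult) (auto simp: augmentation_mult)
  then show ?case by (simp add: mult.assoc)
qed (auto simp: distrib_left intro: aug_power.intros)

lemma aug_power_uminus: "aug_power n a \<Longrightarrow> aug_power n (- a)"
  using aug_power_mult_left[of n a "- 1"] by simp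

lemma aug_power_diff: "aug_power n a \<Longrightarrow> aug_power n b \<Longrightarrow> aug_power n (a - b)"
  using aug_power_add[of n a "- b"] aug_power_uminus[of n b] by simp

lemma aug_power_Suc:
  assumes "aug_power m a" "m = Suc n" shows "aug_power n a"
  using assms
proof (induction arbitrary: n rule: aug_power.induct)
  case (aug_power_mult a k b)
  then show ?case by (simp add: aug_power_mult_left)
qed (auto intro: aug_power.intros)

lemma augmentation_aug_power: "aug_power m a \<Longrightarrow> m = Suc n \<Longrightarrow> augmentation a = 0"
  by (induction rule: aug_power.induct) (auto simp: augmentation_mult augmentation_add)

lemma aug_power_diff_mult:
  assumes "aug_power n (a - a')" "aug_power n (b - b')"
  shows "aug_power n (a * b - a' * b')"
proof -
  have "a * b - a' * b' = (a - a') * b + a' * (b - b')" by (simp add: algebra_simps)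
  then show ?thesis
    using assms by (simp add: aug_power_add aug_power_mult_left aug_power_mult_right)
qed

text \<open>
  The inverse limit of the algebras \<open>k[G]/I\<^sup>n\<close>, where \<open>I\<close> is the augmentation ideal: an element is
  given by a compatible family of representatives \<open>u n\<close> of classes modulo \<open>I\<^sup>n\<close>.
\<close>

definition compl_rel :: "(nat \<Rightarrow> 'g::group_add \<Rightarrow>\<^sub>0 'k::field) \<Rightarrow> (nat \<Rightarrow> 'g \<Rightarrow>\<^sub>0 'k) \<Rightarrow> bool" where
  "compl_rel u v \<longleftrightarrow>
     (\<forall>n. aug_power n (u (Suc n) - u n)) \<and> (\<forall>n. aug_power n (v (Suc n) - v n)) \<and>
     (\<forall>n. aug_power n (u n - v n))"

quotient_type (overloaded) ('g, 'k) compl_alg =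
  "nat \<Rightarrow> 'g::group_add \<Rightarrow>\<^sub>0 'k::field" / partial: compl_rel
proof (rule part_equivpI)
  show "\<exists>u :: nat \<Rightarrow> 'g \<Rightarrow>\<^sub>0 'k. compl_rel u u"
    by (rule exI[of _ "\<lambda>_. 0"]) (simp add: compl_rel_def aug_power_zero)
  show "symp (compl_rel :: (nat \<Rightarrow> 'g \<Rightarrow>\<^sub>0 'k) \<Rightarrow> _)"
    unfolding compl_rel_def by (rule sympI) (metis aug_power_uminus minus_diff_eq)
  show "transp (compl_rel :: (nat \<Rightarrow> 'g \<Rightarrow>\<^sub>0 'k) \<Rightarrow> _)"
  proof (rule transpI)
    fix u v w :: "nat \<Rightarrow> 'g \<Rightarrow>\<^sub>0 'k" assume *: "compl_rel u v" "compl_rel v w"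
    have "aug_power n (u n - w n)" for n
      using aug_power_add[of n "u n - v n" "v n - w n"] * by (simp add: compl_rel_def)
    with * show "compl_rel u w" by (simp add: compl_rel_def)
  qed
qed

lemma compl_rel_const: "compl_rel (\<lambda>_. a) (\<lambda>_. a)"
  by (simp add: compl_rel_def aug_power_zero)

instantiation compl_alg :: (group_add, field) ring_1
begin

lift_definition zero_compl_alg :: "('a, 'b) compl_alg" is "\<lambda>n. 0" by (rule compl_rel_const)
lift_definition one_compl_alg :: "('a, 'b) compl_alg" is "\<lambda>n. 1" by (rule compl_rel_const)
lift_definition plus_compl_alg ::
  "('a, 'b) compl_alg \<Rightarrow> ('a, 'b) compl_alg \<Rightarrow> ('a, 'b) compl_alg" is "\<lambda>u v n. u n + v n"
  unfolding compl_rel_def by (simp add: add_diff_add aug_power_add)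
lift_definition uminus_compl_alg ::
  "('a, 'b) compl_alg \<Rightarrow> ('a, 'b) compl_alg" is "\<lambda>u n. - u n"
  unfolding compl_rel_def by (metis aug_power_uminus minus_diff_minus)
lift_definition minus_compl_alg ::
  "('a, 'b) compl_alg \<Rightarrow> ('a, 'b) compl_alg \<Rightarrow> ('a, 'b) compl_alg" is "\<lambda>u v n. u n - v n"
  unfolding compl_rel_def
proof (intro conjI allI)
  fix u u' v v' :: "nat \<Rightarrow> 'a \<Rightarrow>\<^sub>0 'b" and n
  assume *: "(\<forall>n. aug_power n (u (Suc n) - u n)) \<and> (\<forall>n. aug_power n (u' (Suc n) - u' n)) \<and>
      (\<forall>n. aug_power n (u n - u' n))"
    "(\<forall>n. aug_power n (v (Suc n) - v n)) \<and> (\<forall>n. aug_power n (v' (Suc n) - v' n)) \<and>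
      (\<forall>n. aug_power n (v n - v' n))"
  have eq: "a - b - (c - d) = (a - c) - (b - d)" for a b c d :: "'a \<Rightarrow>\<^sub>0 'b"
    by (simp add: algebra_simps)
  show "aug_power n (u (Suc n) - v (Suc n) - (u n - v n))"
    "aug_power n (u' (Suc n) - v' (Suc n) - (u' n - v' n))"
    "aug_power n (u n - v n - (u' n - v' n))"
    unfolding eq using * by (auto intro: aug_power_diff)
qed
lift_definition times_compl_alg ::
  "('a, 'b) compl_alg \<Rightarrow> ('a, 'b) compl_alg \<Rightarrow> ('a, 'b) compl_alg" is "\<lambda>u v n. u n * v n"
  unfolding compl_rel_def by (simp add: aug_power_diff_mult)

lemma compl_alg_cases: obtains u where "compl_rel u u" "(a :: ('a, 'b) compl_alg) = abs_compl_alg u"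
  using Quotient3_abs_rep[OF Quotient3_compl_alg] Quotient3_rep_reflp[OF Quotient3_compl_alg] by metis

instance
proof
  fix a b c :: "('a, 'b) compl_alg"
  obtain u v w where uvw: "compl_rel u u" "compl_rel v v" "compl_rel w w"
    and a: "a = abs_compl_alg u" and b: "b = abs_compl_alg v" and c: "c = abs_compl_alg w"
    by (metis compl_alg_cases)
  note mult = times_compl_alg.abs_eq and add = plus_compl_alg.abs_eq
  have rel: "compl_rel (\<lambda>n. s n * t n) (\<lambda>n. s n * t n)" "compl_rel (\<lambda>n. s n + t n) (\<lambda>n. s n + t n)"
    "compl_rel (\<lambda>n. - s n) (\<lambda>n. - s n)"
    if "compl_rel s s" "compl_rel t t" for s t :: "nat \<Rightarrow> 'a \<Rightarrow>\<^sub>0 'b"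
    using that times_compl_alg.rsp plus_compl_alg.rsp uminus_compl_alg.rsp
    by (auto simp: rel_fun_def)
  note simps = a b c uvw rel mult add uminus_compl_alg.abs_eq minus_compl_alg.abs_eq
    zero_compl_alg.abs_eq one_compl_alg.abs_eq compl_rel_const
  show "a * b * c = a * (b * c)" "1 * a = a" "a * 1 = a"
    "(a + b) * c = a * c + b * c" "a * (b + c) = a * b + a * c"
    "a + b + c = a + (b + c)" "a + b = b + a" "0 + a = a" "- a + a = 0" "a - b = a + - b"
    by (simp_all add: simps add.assoc mult.assoc add.commute add.left_commute distrib_left distrib_right
        rel[of u u] rel[of v v])
next
  show "(0 :: ('a, 'b) compl_alg) \<noteq> 1"
  proof (transfer, rule notI)
    assume "compl_rel (\<lambda>n. 0 :: 'a \<Rightarrow>\<^sub>0 'b) (\<lambda>n. 1)"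
    then have "aug_power (Suc 0) (0 - 1 :: 'a \<Rightarrow>\<^sub>0 'b)" unfolding compl_rel_def by blast
    then have "aug_power (Suc 0) (1 :: 'a \<Rightarrow>\<^sub>0 'b)" using aug_power_uminus by fastforce
    then show False using augmentation_aug_power by fastforce
  qed
qed

end

instantiation compl_alg :: (group_add, field) filtered_ring
begin

lift_definition in_fil_compl :: "nat \<Rightarrow> ('a, 'b) compl_alg \<Rightarrow> bool" is "\<lambda>n u. aug_power n (u n)"
  unfolding compl_rel_def
  by (metis aug_power_add aug_power_diff diff_add_cancel diff_diff_eq2 add_diff_cancel_left')

definition fil_compl_alg :: "nat \<Rightarrow> ('a, 'b) compl_alg set" where
  "fil_compl_alg n = {u. in_fil_compl n u}"

definition open_compl_alg :: "('a, 'b) compl_alg set \<Rightarrow> bool" where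
  "open_compl_alg U \<longleftrightarrow> (\<forall>a\<in>U. \<exists>n. \<forall>b. b - a \<in> fil n \<longrightarrow> b \<in> U)"

lemma fil_compl_alg_Suc: "fil (Suc n) \<subseteq> (fil n :: ('a, 'b) compl_alg set)"
proof -
  have "in_fil_compl n a" if "in_fil_compl (Suc n) a" for a :: "('a, 'b) compl_alg"
    using that
  proof transfer
    fix n and u :: "nat \<Rightarrow> 'a \<Rightarrow>\<^sub>0 'b"
    assume *: "compl_rel u u" "aug_power (Suc n) (u (Suc n))"
    have "aug_power n (u (Suc n))" using *(2) refl by (rule aug_power_Suc)
    moreover have "aug_power n (u (Suc n) - u n)" using *(1) by (simp add: compl_rel_def)
    ultimately have "aug_power n (u (Suc n) - (u (Suc n) - u n))" by (rule aug_power_diff)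
    then show "aug_power n (u n)" by simp
  qed
  then show ?thesis by (auto simp: fil_compl_alg_def)
qed

lemma fil_compl_alg_antimono:
  "m \<le> n \<Longrightarrow> fil n \<subseteq> (fil m :: ('a, 'b) compl_alg set)"
  using lift_Suc_antimono_le[of "fil :: nat \<Rightarrow> ('a, 'b) compl_alg set", OF fil_compl_alg_Suc] by blast

instance
proof
  show "open (UNIV :: ('a, 'b) compl_alg set)" by (simp add: open_compl_alg_def)
next
  fix S T :: "('a, 'b) compl_alg set" assume *: "open S" "open T"
  show "open (S \<inter> T)" unfolding open_compl_alg_def
  proof
    fix a assume "a \<in> S \<inter> T"
    then obtain m n where "\<And>b. b - a \<in> fil m \<Longrightarrow> b \<in> S" "\<And>b. b - a \<in> fil n \<Longrightarrow> b \<in> T"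
      using * unfolding open_compl_alg_def by blast
    moreover have "c \<in> fil m \<and> c \<in> fil n" if "c \<in> fil (max m n)" for c :: "('a, 'b) compl_alg"
      using that fil_compl_alg_antimono[of m "max m n"] fil_compl_alg_antimono[of n "max m n"] by auto
    ultimately show "\<exists>n. \<forall>b. b - a \<in> fil n \<longrightarrow> b \<in> S \<inter> T" by blast
  qed
next
  fix K :: "('a, 'b) compl_alg set set" assume *: "\<forall>S\<in>K. open S"
  show "open (\<Union>K)" unfolding open_compl_alg_def
  proof
    fix a assume "a \<in> \<Union>K"
    then obtain S where "S \<in> K" "a \<in> S" by blast
    with * obtain n where "\<forall>b. b - a \<in> fil n \<longrightarrow> b \<in> S" unfolding open_compl_alg_def by blast
    with \<open>S \<in> K\<close> show "\<exists>n. \<forall>b. b - a \<in> fil n \<longrightarrow> b \<in> \<Union>K" by blast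
  qed
next
  fix U :: "('a, 'b) compl_alg set"
  show "open U \<longleftrightarrow> (\<forall>a\<in>U. \<exists>n. \<forall>b. b - a \<in> fil n \<longrightarrow> b \<in> U)"
    by (rule open_compl_alg_def)
next
  fix a b :: "('a, 'b) compl_alg" and n
  show "0 \<in> (fil n :: ('a, 'b) compl_alg set)"
    unfolding fil_compl_alg_def mem_Collect_eq by transfer (rule aug_power_zero)
  show "a \<in> fil n \<Longrightarrow> b \<in> fil n \<Longrightarrow> a + b \<in> fil n"
    unfolding fil_compl_alg_def mem_Collect_eq by transfer (rule aug_power_add)
  show "a \<in> fil n \<Longrightarrow> - a \<in> fil n"
    unfolding fil_compl_alg_def mem_Collect_eq by transfer (rule aug_power_uminus)
  show "a \<in> fil n \<Longrightarrow> b * a \<in> fil n"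
    unfolding fil_compl_alg_def mem_Collect_eq by transfer (rule aug_power_mult_left)
  show "a \<in> fil n \<Longrightarrow> a * b \<in> fil n"
    unfolding fil_compl_alg_def mem_Collect_eq by transfer (rule aug_power_mult_right)
  show "fil (Suc n) \<subseteq> (fil n :: ('a, 'b) compl_alg set)" by (rule fil_compl_alg_Suc)
next
  fix a :: "('a, 'b) compl_alg" assume "\<And>n. a \<in> fil n"
  then have "\<forall>n. in_fil_compl n a" by (simp add: fil_compl_alg_def)
  then show "a = 0"
    by transfer (auto simp: compl_rel_def aug_power_zero)
qed

end

lift_definition compl_const :: "'k::field \<Rightarrow> ('g::group_add, 'k) compl_alg" is
  "\<lambda>c n. Poly_Mapping.single 0 c" by (rule compl_rel_const)

lift_definition compl_of_group :: "'g::group_add \<Rightarrow> ('g, 'k::field) compl_alg" is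
  "\<lambda>g n. Poly_Mapping.single g 1" by (rule compl_rel_const)


section \<open>The braid group and the pure braid group on four strings\<close>

datatype artin_gen = S1 | S2 | S3

text \<open>Words in the letters \<open>(s, True)\<close>, standing for \<open>s\<close>, and \<open>(s, False)\<close>, standing for the inverse of \<open>s\<close>.\<close>

type_synonym artin_word = "(artin_gen \<times> bool) list"

inductive braid_rel :: "artin_word \<Rightarrow> artin_word \<Rightarrow> bool" where
  refl: "braid_rel u u"
| sym: "braid_rel u v \<Longrightarrow> braid_rel v u"
| trans: "braid_rel u v \<Longrightarrow> braid_rel v w \<Longrightarrow> braid_rel u w"
| cong: "braid_rel u v \<Longrightarrow> braid_rel (a @ u @ b) (a @ v @ b)"
| cancel: "braid_rel [(s, e), (s, \<not> e)] []"
| comm13: "braid_rel [(S1, True), (S3, True)] [(S3, True), (S1, True)]"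
| braid12: "braid_rel [(S1, True), (S2, True), (S1, True)] [(S2, True), (S1, True), (S2, True)]"
| braid23: "braid_rel [(S2, True), (S3, True), (S2, True)] [(S3, True), (S2, True), (S3, True)]"

quotient_type braid4 = artin_word / braid_rel
  by (intro equivpI reflpI sympI transpI) (blast intro: braid_rel.refl braid_rel.sym braid_rel.trans)+

lemma braid_rel_append:
  assumes "braid_rel u u'" "braid_rel v v'" shows "braid_rel (u @ v) (u' @ v')"
  using braid_rel.cong[OF assms(1), of "[]" v] braid_rel.cong[OF assms(2), of u' "[]"]
  by (auto intro: braid_rel.trans)

definition word_inv :: "artin_word \<Rightarrow> artin_word" where
  "word_inv w = rev (map (\<lambda>(s, e). (s, \<not> e)) w)"

lemma word_inv_append: "word_inv (u @ v) = word_inv v @ word_inv u"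
  by (simp add: word_inv_def)

lemma word_inv_word_inv [simp]: "word_inv (word_inv w) = w"
  by (induction w) (auto simp: word_inv_def)

lemma word_inv_cancel_right: "braid_rel (w @ word_inv w) []"
proof (induction w)
  case Nil
  show ?case by (simp add: word_inv_def braid_rel.refl)
next
  case (Cons c w)
  obtain s e where c: "c = (s, e)" by (cases c)
  have "braid_rel ([c] @ (w @ word_inv w) @ [(s, \<not> e)]) ([c] @ [] @ [(s, \<not> e)])"
    by (rule braid_rel.cong[OF Cons])
  then show ?case
    using braid_rel.cancel[of s e] by (auto simp: c word_inv_def intro: braid_rel.trans)
qed

lemma word_inv_cancel_left: "braid_rel (word_inv w @ w) []"
  using word_inv_cancel_right[of "word_inv w"] by simp

lemma braid_rel_word_inv:
  assumes "braid_rel u v" shows "braid_rel (word_inv u) (word_inv v)"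
proof -
  have "braid_rel (word_inv u @ (v @ word_inv v)) (word_inv u @ [])"
    by (intro braid_rel_append braid_rel.refl word_inv_cancel_right)
  moreover have "braid_rel ((word_inv u @ u) @ word_inv v) ((word_inv u @ v) @ word_inv v)"
    by (intro braid_rel_append braid_rel.refl assms)
  moreover have "braid_rel ((word_inv u @ u) @ word_inv v) ([] @ word_inv v)"
    by (intro braid_rel_append braid_rel.refl word_inv_cancel_left)
  ultimately show ?thesis by (metis append.assoc append_Nil append_Nil2 braid_rel.sym braid_rel.trans)
qed

instantiation braid4 :: group_add
begin

lift_definition zero_braid4 :: braid4 is "[]" .
lift_definition plus_braid4 :: "braid4 \<Rightarrow> braid4 \<Rightarrow> braid4" is "(@)" by (rule braid_rel_append)
lift_definition uminus_braid4 :: "braid4 \<Rightarrow> braid4" is word_inv by (rule braid_rel_word_inv)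
definition minus_braid4 :: "braid4 \<Rightarrow> braid4 \<Rightarrow> braid4" where "minus_braid4 a b = a + - b"

instance
proof
  fix a b c :: braid4
  show "a + b + c = a + (b + c)" by transfer (simp add: braid_rel.refl)
  show "0 + a = a" by transfer (simp add: braid_rel.refl)
  show "a + 0 = a" by transfer (simp add: braid_rel.refl)
  show "- a + a = 0" by transfer (rule word_inv_cancel_left)
  show "a + - b = a - b" by (simp add: minus_braid4_def)
qed

end

fun gen_perm :: "artin_gen \<Rightarrow> nat \<Rightarrow> nat" where
  "gen_perm S1 = transpose 1 2"
| "gen_perm S2 = transpose 2 3"
| "gen_perm S3 = transpose 3 4"

definition word_perm :: "artin_word \<Rightarrow> nat \<Rightarrow> nat" where
  "word_perm w = foldr (\<lambda>(s, e) p. gen_perm s \<circ> p) w id"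

lemma word_perm_Nil [simp]: "word_perm [] = id"
  by (simp add: word_perm_def)

lemma word_perm_Cons [simp]: "word_perm ((s, e) # w) = gen_perm s \<circ> word_perm w"
  by (simp add: word_perm_def)

lemma word_perm_append [simp]: "word_perm (u @ v) = word_perm u \<circ> word_perm v"
  by (induction u) (auto simp: o_assoc)

lemma gen_perm_involutory [simp]: "gen_perm s \<circ> gen_perm s = id"
  by (cases s) simp_all

lemma gen_perm_relations:
  "gen_perm S1 \<circ> gen_perm S3 = gen_perm S3 \<circ> gen_perm S1"
  "gen_perm S1 \<circ> (gen_perm S2 \<circ> gen_perm S1) = gen_perm S2 \<circ> (gen_perm S1 \<circ> gen_perm S2)"
  "gen_perm S2 \<circ> (gen_perm S3 \<circ> gen_perm S2) = gen_perm S3 \<circ> (gen_perm S2 \<circ> gen_perm S3)"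
proof -
  have eqI: "p = q" if "\<And>x. x \<notin> {1, 2, 3, 4} \<Longrightarrow> p x = q x" "p 1 = q 1" "p 2 = q 2" "p 3 = q 3" "p 4 = q 4"
    for p q :: "nat \<Rightarrow> nat"
    using that by (metis ext insertE singletonD)
  show "gen_perm S1 \<circ> gen_perm S3 = gen_perm S3 \<circ> gen_perm S1"
    "gen_perm S1 \<circ> (gen_perm S2 \<circ> gen_perm S1) = gen_perm S2 \<circ> (gen_perm S1 \<circ> gen_perm S2)"
    "gen_perm S2 \<circ> (gen_perm S3 \<circ> gen_perm S2) = gen_perm S3 \<circ> (gen_perm S2 \<circ> gen_perm S3)"
    by (rule eqI; simp add: transpose_def)+
qed

lemma word_perm_braid_rel: "braid_rel u v \<Longrightarrow> word_perm u = word_perm v"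
  by (induction rule: braid_rel.induct)
    (simp_all del: gen_perm.simps add: gen_perm_relations)

text \<open>The homomorphism \<open>B\<^sub>4 \<rightarrow> \<SS>\<^sub>4\<close>, with \<open>\<SS>\<^sub>4\<close> acting on \<open>{1, 2, 3, 4}\<close>.\<close>

lift_definition braid_perm :: "braid4 \<Rightarrow> nat \<Rightarrow> nat" is word_perm
  by (rule word_perm_braid_rel)

lemma braid_perm_zero [simp]: "braid_perm 0 = id"
  by transfer simp

lemma braid_perm_add [simp]: "braid_perm (a + b) = braid_perm a \<circ> braid_perm b"
  by transfer simp

lemma braid_perm_uminus: "braid_perm a = id \<Longrightarrow> braid_perm (- a) = id"
  using braid_perm_add[of "- a" a] by simp

typedef pure_braid4 = "{b. braid_perm b = id}"
  by (rule exI[of _ 0]) simp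

setup_lifting type_definition_pure_braid4

instantiation pure_braid4 :: group_add
begin

lift_definition zero_pure_braid4 :: pure_braid4 is 0 by simp
lift_definition plus_pure_braid4 :: "pure_braid4 \<Rightarrow> pure_braid4 \<Rightarrow> pure_braid4" is "(+)" by simp
lift_definition uminus_pure_braid4 :: "pure_braid4 \<Rightarrow> pure_braid4" is uminus
  by (simp add: braid_perm_uminus)
definition minus_pure_braid4 :: "pure_braid4 \<Rightarrow> pure_braid4 \<Rightarrow> pure_braid4" where
  "minus_pure_braid4 a b = a + - b"

instance
proof
  fix a b c :: pure_braid4
  show "a + b + c = a + (b + c)" by transfer (rule add.assoc)
  show "0 + a = a" by transfer simp
  show "a + 0 = a" by transfer simp
  show "- a + a = 0" by transfer simp
  show "a + - b = a - b" by (simp add: minus_pure_braid4_def)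
qed

end

lift_definition sigma :: "artin_gen \<Rightarrow> braid4" is "\<lambda>s. [(s, True)]" .

lemma braid_perm_sigma [simp]: "braid_perm (sigma s) = gen_perm s"
  by transfer simp

lemma braid_perm_square [simp]: "braid_perm (sigma s + sigma s) = id"
  by simp

lemma braid_perm_conj: "braid_perm b = id \<Longrightarrow> braid_perm (c + b + - c) = id"
  using braid_perm_add[of c "- c"] by (simp del: add_uminus_conv_diff)

lift_definition x12 :: pure_braid4 is "sigma S1 + sigma S1" by (rule braid_perm_square)
lift_definition x23 :: pure_braid4 is "sigma S2 + sigma S2" by (rule braid_perm_square)
lift_definition x34 :: pure_braid4 is "sigma S3 + sigma S3" by (rule braid_perm_square)
lift_definition x13 :: pure_braid4 is "sigma S2 + (sigma S1 + sigma S1) + - sigma S2"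
  by (intro braid_perm_conj braid_perm_square)
lift_definition x24 :: pure_braid4 is "sigma S3 + (sigma S2 + sigma S2) + - sigma S3"
  by (intro braid_perm_conj braid_perm_square)


section \<open>Pentagon and hexagon equations\<close>

text \<open>
  The group \<open>K\<^sub>4(k)\<close> is the group of group-like elements of the completed group algebra of \<open>K\<^sub>4\<close>
  over \<open>k\<close>. It contains the image of \<open>K\<^sub>4\<close> and the values of elements of \<open>F\<^sub>2(k)\<close> at pairs of its
  elements, and an equation in it is an equation in the completed group algebra.
\<close>

definition pentagon :: "'k::field_char_0 ncfps \<Rightarrow> bool" where
  "pentagon f \<longleftrightarrow>
    (let F = nc_eval compl_const f :: (pure_braid4, 'k) compl_alg \<Rightarrow> _;
         a12 = compl_of_group x12; a13 = compl_of_group x13; a23 = compl_of_group x23;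
         a24 = compl_of_group x24; a34 = compl_of_group x34
     in F a12 (a23 * a24) * F (a13 * a23) a34
        = F a23 a34 * F (a12 * a13) (a24 * a34) * F a12 a23)"

text \<open>As \<open>xy\<close> is invertible, there is exactly one \<open>z\<close> with \<open>xyz = 1\<close>.\<close>

definition hexagons :: "'k::field_char_0 \<Rightarrow> 'k ncfps \<Rightarrow> bool" where
  "hexagons l f \<longleftrightarrow>
    (let F = nc_eval nc_const f :: 'k ncfps \<Rightarrow> _; pow = alg_pow nc_const;
         x = alg_exp nc_const nc_X; y = alg_exp nc_const nc_Y; m = (l - 1) / 2
     in (\<exists>z. x * y * z = 1 \<and>
             F z x * pow z m * F y z * pow y m * F x y * pow x m = 1) \<and>
        F x y * F y x = 1)"

end

theory Submission
  imports Defs "HOL-Computational_Algebra.Formal_Power_Series"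
begin

text \<open>
  The pentagon can be evaluated in every complete filtered algebra that contains \<open>\<sigma>\<^sub>1, \<sigma>\<^sub>2, \<sigma>\<^sub>3\<close>
  satisfying the braid relations, with unipotent squares. For \<open>\<sigma>\<^sub>3 = \<sigma>\<^sub>1\<close> it collapses to
  \<open>f(y, x) f(x, y) = 1\<close>. Let \<open>H(x, y)\<close> be the left-hand side of the hexagon equation. Moving one
  string past three others in all bracketings, as in the coherence theorem for braided categories,
  shows that if \<open>H - 1\<close> begins in degree \<open>n\<close> with the polynomial \<open>\<psi>\<close>, then
  \<open>\<psi>(A, B) + \<psi>(A + B, C) = \<psi>(A, B + C) + \<psi>(B, C)\<close>, where \<open>1 + A, 1 + B, 1 + C\<close> are \<open>x\<^sub>1\<^sub>2, x\<^sub>1\<^sub>3, x\<^sub>1\<^sub>4\<close>.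
  These generate a free group, which acts by left multiplication in a suitable representation, so
  this is an identity of noncommutative polynomials. The coefficients of the words containing
  \<open>A\<close>, \<open>B\<close> and \<open>C\<close> show for \<open>n \<ge> 3\<close> that all words in both letters have the same coefficient in \<open>\<psi>\<close>; it
  is \<open>0\<close> because \<open>H(x, x) = 1\<close>. Hence the hexagon equation holds as soon as it holds in degrees at
  most \<open>2\<close>, where it says \<open>\<lambda>\<^sup>2 = 24 c\<^sub>2(f) + 1\<close>.
\<close>

section \<open>Complete filtered algebras\<close>

text \<open>The hexagon concerns half-braidings, which do not lie in K_4(k): the edges of the
  coherence polytope are sigma_i times the m-th power of sigma_i^2, formally sigma_i^lambda since 1
  + 2m = lambda. Hence the argument lives in algebras where the sigma_i themselves act and only
  their squares, and then all pure braids, are unipotent. No structure theory of K_4(k) is used; the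
  freeness of x12, x13, x14 is read off from an explicit completed module. Two facts precede the
  study of the defect. The linear terms of f vanish, as the pentagon abelianised in two ways shows;
  only then does f(a, b) ignore central factors. And f(x, y) f(y, x) = 1 is needed to reverse
  associators. The collapse gives it only for the squares of sigma_1 and sigma_2; but the second
  square is the inverse of x12 x13 up to a central factor, and x12, x13 are free. In degree 2 the
  three associators contribute 3 c_2 and the powers -m(m + 1)/2; with (2m + 1)^2 = 4m(m + 1) + 1
  this is the origin of the number 24.\<close>

lemma fil_antimono:
  "m \<le> n \<Longrightarrow> fil n \<subseteq> (fil m :: 'a::filtered_ring set)"
  using lift_Suc_antimono_le[of "fil :: nat \<Rightarrow> 'a set", OF fil_Suc] by blast

lemma fil_sum:
  "(\<And>i. i \<in> A \<Longrightarrow> u i \<in> fil n) \<Longrightarrow> sum u A \<in> (fil n :: 'a::filtered_ring set)"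
  by (induction A rule: infinite_finite_induct) (auto simp: fil_zero fil_add)

lemma tendsto_iff_fil:
  fixes L :: "'a::filtered_ring"
  shows "S \<longlonglongrightarrow> L \<longleftrightarrow> (\<forall>N. \<forall>\<^sub>F n in sequentially. S n - L \<in> fil N)"
proof
  assume "S \<longlonglongrightarrow> L"
  then show "\<forall>N. \<forall>\<^sub>F n in sequentially. S n - L \<in> fil N"
    using topological_tendstoD[of S L sequentially "{c. c - L \<in> fil N}" for N] open_fil_coset fil_zero
    by fastforce
next
  assume *: "\<forall>N. \<forall>\<^sub>F n in sequentially. S n - L \<in> fil N"
  show "S \<longlonglongrightarrow> L"
  proof (rule topological_tendstoI)
    fix U :: "'a set" assume "open U" "L \<in> U"
    then obtain N where "\<forall>b. b - L \<in> fil N \<longrightarrow> b \<in> U" using open_iff_fil by blast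
    with * show "\<forall>\<^sub>F n in sequentially. S n \<in> U" by (auto elim!: eventually_mono allE[of _ N])
  qed
qed

lemma sums_filI:
  fixes L :: "'a::filtered_ring"
  assumes "\<And>N. L - sum u {..<N} \<in> fil N"
  shows "u sums L"
  unfolding sums_def tendsto_iff_fil
proof
  fix N show "\<forall>\<^sub>F n in sequentially. sum u {..<n} - L \<in> fil N"
    using eventually_ge_at_top[of N]
  proof eventually_elim
    case (elim n)
    then show ?case using fil_uminus[OF assms[of n]] fil_antimono[OF elim] by auto
  qed
qed

text \<open>The number of summands doubles as the degree of the error, which fits series whose n-th
  term has degree n.\<close>

lemma suminf_filI:
  fixes L :: "'a::filtered_ring"
  shows "(\<And>N. L - sum u {..<N} \<in> fil N) \<Longrightarrow> suminf u = L"
  by (intro sums_unique[symmetric] sums_filI)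

lemma fil_eqI:
  fixes a b :: "'a::filtered_ring"
  assumes "\<And>n. a - b \<in> fil n" shows "a = b"
  using fil_separated[of "a - b"] assms by simp

lemma fil_trans: "a - b \<in> fil n \<Longrightarrow> b - c \<in> fil n \<Longrightarrow> a - c \<in> (fil n :: 'a::filtered_ring set)"
  using fil_add[of "a - b" n "b - c"] by simp

lemma fil_sym: "a - b \<in> fil n \<Longrightarrow> b - a \<in> (fil n :: 'a::filtered_ring set)"
  using fil_uminus[of "a - b" n] by simp

lemma fil_cong_add: "a - b \<in> fil n \<Longrightarrow> c - d \<in> fil n \<Longrightarrow> (a + c) - (b + d) \<in> (fil n :: 'a::filtered_ring set)"
  using fil_add[of "a - b" n "c - d"] by (simp add: algebra_simps)

lemma fil_cong_mult:
  fixes a b c d :: "'a::filtered_ring"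
  assumes "a - b \<in> fil n" "c - d \<in> fil n"
  shows "a * c - b * d \<in> fil n"
proof -
  have "a * c - b * d = (a - b) * c + b * (c - d)" by (simp add: algebra_simps)
  then show ?thesis using assms by (simp add: fil_add fil_mult_left fil_mult_right)
qed

lemma fil_cong_iff: "a - b \<in> fil n \<Longrightarrow> a \<in> fil n \<longleftrightarrow> b \<in> (fil n :: 'a::filtered_ring set)"
  using fil_diff[of a n "a - b"] fil_add[of "a - b" n b] by auto

text \<open>Adds to \<open>filtered_ring\<close> that degrees add under products and that Cauchy
  sequences converge, as exp, log and substitution require. Scalars act through a map
  \<open>\<iota>\<close>, so that restriction of scalars is composition of maps.\<close>

locale complete_filtered_algebra =
  fixes \<iota> :: "'k::field_char_0 \<Rightarrow> 'a::filtered_ring"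
  assumes scalar_one [simp]: "\<iota> 1 = 1"
    and scalar_add: "\<iota> (c + d) = \<iota> c + \<iota> d"
    and scalar_mult: "\<iota> (c * d) = \<iota> c * \<iota> d"
    and scalar_comm: "\<iota> c * a = a * \<iota> c"
    and fil_0 [simp]: "(a :: 'a) \<in> fil 0"
    and fil_mult: "(a :: 'a) \<in> fil m \<Longrightarrow> b \<in> fil n \<Longrightarrow> a * b \<in> fil (m + n)"
    and complete: "(\<And>n. (S :: nat \<Rightarrow> 'a) (Suc n) - S n \<in> fil n) \<Longrightarrow> \<exists>L. S \<longlonglongrightarrow> L"
begin

lemma scalar_zero [simp]: "\<iota> 0 = 0"
  using scalar_add[of 0 0] by simp

lemma scalar_uminus: "\<iota> (- c) = - \<iota> c"
  using scalar_add[of c "- c"] by (simp add: eq_neg_iff_add_eq_0 add.commute)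

lemma scalar_sum: "\<iota> (sum u A) = (\<Sum>i\<in>A. \<iota> (u i))"
  by (induction A rule: infinite_finite_induct) (auto simp: scalar_add)

lemma scalar_of_nat: "\<iota> (of_nat n) = of_nat n"
  by (induction n) (auto simp: scalar_add)

lemma scalar_lcomm: "a * (\<iota> c * b) = \<iota> c * (a * b)"
  by (metis mult.assoc scalar_comm)

lemma fil_power:
  assumes "(a :: 'a) \<in> fil 1" shows "a ^ n \<in> fil n"
proof (induction n)
  case (Suc n) then show ?case using fil_mult[OF assms Suc] by simp
qed simp

text \<open>Completeness enters the theory of series through this estimate; afterwards infinite sums
  are compared with their truncations modulo \<open>fil N\<close>.\<close>

lemma suminf_fil:
  fixes u :: "nat \<Rightarrow> 'a"
  assumes u: "\<And>n. u n \<in> fil n"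
  shows "suminf u - sum u {..<N} \<in> fil N"
proof -
  have "sum u {..<Suc n} - sum u {..<n} \<in> fil n" for n using u by simp
  then obtain L where L: "(\<lambda>n. sum u {..<n}) \<longlonglongrightarrow> L"
    using complete[of "\<lambda>n. sum u {..<n}"] by blast
  then have eq: "suminf u = L" by (intro sums_unique[symmetric]) (simp add: sums_def)
  from L obtain n where n: "sum u {..<n} - L \<in> fil N" "N \<le> n"
    unfolding tendsto_iff_fil eventually_sequentially by (meson nle_le)
  have "sum u {..<n} - sum u {..<N} = sum u {N..<n}"
    using sum_diff_nat_ivl[of 0 N n u] n(2) by (simp add: atLeast0LessThan)
  moreover have "sum u {N..<n} \<in> fil N"
    using u fil_antimono by (intro fil_sum) fastforce
  ultimately have "sum u {..<n} - sum u {..<N} \<in> fil N" by simp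
  then show ?thesis using fil_trans[OF fil_sym[OF n(1)]] eq by simp
qed

lemma suminf_in_fil:
  fixes u :: "nat \<Rightarrow> 'a"
  assumes u: "\<And>n. u n \<in> fil n" and "\<And>n. n < N \<Longrightarrow> u n = 0"
  shows "suminf u \<in> fil N"
  using suminf_fil[OF u, of N] assms(2) by simp

lemma suminf_cauchy:
  fixes u :: "nat \<Rightarrow> 'a"
  assumes u: "\<And>n. u n \<in> fil n" and v: "\<And>n. v n \<in> fil n"
  shows "suminf (\<lambda>n. \<Sum>i\<le>n. u i * v (n - i)) = suminf u * suminf v"
proof (rule suminf_filI)
  fix N
  define w where "w n = (\<Sum>i\<le>n. u i * v (n - i))" for n
  have "suminf u * suminf v - sum u {..<N} * sum v {..<N} \<in> fil N"
    by (intro fil_cong_mult suminf_fil u v)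
  \<comment> \<open>Square minus triangle: the surplus terms have i + j at least N, hence degree at
    least N.\<close>
  moreover have "sum u {..<N} * sum v {..<N} - sum w {..<N} \<in> fil N"
  proof -
    have "sum w {..<N} = (\<Sum>(i,j)\<in>{(i,j). i + j < N}. u i * v j)"
    proof -
      have "sum w {..<N} = (\<Sum>n<N. \<Sum>i\<le>n. u i * v (n - i))" by (simp add: w_def)
      also have "\<dots> = (\<Sum>(i,j)\<in>{(i,j). i + j < N}. u i * v j)"
        by (rule sum.triangle_reindex[symmetric])
      finally show ?thesis .
    qed
    moreover have "sum u {..<N} * sum v {..<N} = (\<Sum>(i,j)\<in>{..<N}\<times>{..<N}. u i * v j)"
      by (simp add: sum_product sum.cartesian_product)
    moreover have "(\<Sum>(i,j)\<in>{..<N}\<times>{..<N}. u i * v j) = (\<Sum>(i,j)\<in>{(i,j). i + j < N}. u i * v j)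
       + (\<Sum>(i,j)\<in>{..<N}\<times>{..<N} - {(i,j). i + j < N}. u i * v j)"
      by (subst sum.subset_diff[of "{(i,j). i + j < N}"]) (auto simp: add.commute)
    moreover have "(\<Sum>(i,j)\<in>{..<N}\<times>{..<N} - {(i,j). i + j < N}. u i * v j) \<in> fil N"
    proof (rule fil_sum)
      fix p assume "p \<in> {..<N}\<times>{..<N} - {(i,j). i + j < N}"
      then have "N \<le> fst p + snd p" by auto
      then show "(case p of (i,j) \<Rightarrow> u i * v j) \<in> fil N"
        using fil_mult[OF u v, of "fst p" "snd p"] fil_antimono[of N "fst p + snd p"] by (auto simp: case_prod_beta)
    qed
    ultimately show ?thesis by simp
  qed
  ultimately show "suminf u * suminf v - (\<Sum>n<N. \<Sum>i\<le>n. u i * v (n - i)) \<in> fil N"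
    unfolding w_def[symmetric] by (rule fil_trans)
qed

lemma suminf_mult_left:
  fixes u :: "nat \<Rightarrow> 'a"
  assumes u: "\<And>n. u n \<in> fil n"
  shows "suminf (\<lambda>n. g * u n) = g * suminf u"
proof (rule suminf_filI)
  fix N
  show "g * suminf u - (\<Sum>n<N. g * u n) \<in> fil N"
    using fil_mult_left[OF suminf_fil[OF u, of N], of g] by (simp add: algebra_simps sum_distrib_left)
qed

lemma suminf_mult_right:
  fixes u :: "nat \<Rightarrow> 'a"
  assumes u: "\<And>n. u n \<in> fil n"
  shows "suminf (\<lambda>n. u n * g) = suminf u * g"
proof (rule suminf_filI)
  fix N
  show "suminf u * g - (\<Sum>n<N. u n * g) \<in> fil N"
    using fil_mult_right[OF suminf_fil[OF u, of N], of g] by (simp add: algebra_simps sum_distrib_right)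
qed

lemma suminf_plus:
  fixes u :: "nat \<Rightarrow> 'a"
  assumes u: "\<And>n. u n \<in> fil n" and v: "\<And>n. v n \<in> fil n"
  shows "suminf (\<lambda>n. u n + v n) = suminf u + suminf v"
proof (rule suminf_filI)
  fix N
  show "suminf u + suminf v - (\<Sum>n<N. u n + v n) \<in> fil N"
    using fil_cong_add[OF suminf_fil[OF u, of N] suminf_fil[OF v, of N]] by (simp add: sum.distrib)
qed

text \<open>Conjugation is expressed as \<open>g * a = a' * g\<close>: this form passes to products
  and limits and needs no inverse of \<open>g\<close>, which is typically a braid generator and not
  unipotent.\<close>

lemma suminf_intertwine:
  fixes u :: "nat \<Rightarrow> 'a"
  assumes u: "\<And>n. u n \<in> fil n" and v: "\<And>n. v n \<in> fil n" and "\<And>n. g * u n = v n * g"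
  shows "g * suminf u = suminf v * g"
  using suminf_mult_left[of u g] suminf_mult_right[of v g] assms by simp

text \<open>Functional calculus in one variable: that exp and log are inverse to each other is taken
  over from formal power series through \<open>fps_eval_compose\<close>.\<close>

definition fps_eval :: "'k fps \<Rightarrow> 'a \<Rightarrow> 'a" where
  "fps_eval F a = suminf (\<lambda>n. \<iota> (fps_nth F n) * a ^ n)"

lemma fps_eval_term: "a \<in> fil 1 \<Longrightarrow> \<iota> (fps_nth F n) * a ^ n \<in> fil n"
  by (intro fil_mult_left fil_power)

lemma fps_eval_add:
  "a \<in> fil 1 \<Longrightarrow> fps_eval (F + G) a = fps_eval F a + fps_eval G a"
  unfolding fps_eval_def by (subst suminf_plus[symmetric]) (auto simp: fps_eval_term scalar_add distrib_right)

lemma fps_eval_mult: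
  assumes a: "a \<in> fil 1" shows "fps_eval (F * G) a = fps_eval F a * fps_eval G a"
proof -
  have "\<iota> (fps_nth (F * G) n) * a ^ n
      = (\<Sum>i\<le>n. (\<iota> (fps_nth F i) * a ^ i) * (\<iota> (fps_nth G (n - i)) * a ^ (n - i)))" for n
  proof -
    have "(\<iota> (fps_nth F i) * a ^ i) * (\<iota> (fps_nth G (n - i)) * a ^ (n - i))
        = \<iota> (fps_nth F i * fps_nth G (n - i)) * a ^ n" if "i \<le> n" for i
    proof -
      have "(\<iota> (fps_nth F i) * a ^ i) * (\<iota> (fps_nth G (n - i)) * a ^ (n - i))
        = \<iota> (fps_nth F i) * \<iota> (fps_nth G (n - i)) * (a ^ i * a ^ (n - i))"
        by (simp only: mult.assoc scalar_lcomm[of "a ^ i"])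
      then show ?thesis using that by (simp add: scalar_mult flip: power_add)
    qed
    then show ?thesis
      by (auto simp: fps_mult_nth scalar_sum sum_distrib_right atLeast0AtMost intro!: sum.cong)
  qed
  then show ?thesis
    unfolding fps_eval_def using suminf_cauchy[OF fps_eval_term[OF a, of F] fps_eval_term[OF a, of G]] by simp
qed

lemma fps_eval_in_fil:
  "a \<in> fil 1 \<Longrightarrow> (\<And>n. n < N \<Longrightarrow> fps_nth F n = 0) \<Longrightarrow> fps_eval F a \<in> fil N"
  unfolding fps_eval_def by (rule suminf_in_fil) (auto simp: fps_eval_term)

lemma fps_eval_const [simp]: "fps_eval (fps_const c) a = \<iota> c"
  unfolding fps_eval_def
proof (rule suminf_filI)
  fix N
  have "(\<Sum>n<N. \<iota> (fps_nth (fps_const c) n) * a ^ n) = (if N = 0 then 0 else \<iota> c)"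
    by (induction N) auto
  then show "\<iota> c - (\<Sum>n<N. \<iota> (fps_nth (fps_const c) n) * a ^ n) \<in> fil N"
    by (auto simp: fil_zero)
qed

lemma fps_eval_one [simp]: "fps_eval 1 a = 1"
  using fps_eval_const[of 1 a] by simp

lemma fps_eval_X [simp]: "a \<in> fil 1 \<Longrightarrow> fps_eval fps_X a = a"
  unfolding fps_eval_def
proof (rule suminf_filI)
  fix N assume a: "a \<in> fil 1"
  have "(\<Sum>n<N. \<iota> (fps_nth fps_X n) * a ^ n) = (if N \<le> 1 then 0 else a)"
    by (induction N) (auto simp: fps_X_def le_Suc_eq)
  then show "a - (\<Sum>n<N. \<iota> (fps_nth fps_X n) * a ^ n) \<in> fil N"
    using a fil_antimono[of N 1] by (auto simp: fil_zero split: if_splits)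
qed

lemma fps_eval_uminus: "a \<in> fil 1 \<Longrightarrow> fps_eval (- F) a = - fps_eval F a"
  using fps_eval_add[of a F "- F"] fps_eval_const[of 0 a]
  by (simp add: eq_neg_iff_add_eq_0 add.commute)

lemma fps_eval_diff: "a \<in> fil 1 \<Longrightarrow> fps_eval (F - G) a = fps_eval F a - fps_eval G a"
  using fps_eval_add[of a F "- G"] by (simp add: fps_eval_uminus)

lemma fps_eval_power: "a \<in> fil 1 \<Longrightarrow> fps_eval (F ^ n) a = fps_eval F a ^ n"
  by (induction n) (auto simp: fps_eval_mult)

lemma fps_eval_sum: "a \<in> fil 1 \<Longrightarrow> fps_eval (sum F A) a = (\<Sum>i\<in>A. fps_eval (F i) a)"
  using fps_eval_const[of 0 a]
  by (induction A rule: infinite_finite_induct) (auto simp: fps_eval_add)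

lemma fps_eval_compose:
  assumes a: "a \<in> fil 1" and G: "fps_nth G 0 = 0"
  shows "fps_eval (fps_compose F G) a = fps_eval F (fps_eval G a)"
proof (rule fil_eqI)
  fix N
  \<comment> \<open>Cutting off the outer series at N changes the composite only from degree N on,
    because the i-th power of \<open>G\<close> has no terms below degree i.\<close>
  define P where "P = (\<Sum>i<N. fps_const (fps_nth F i) * G ^ i)"
  have b: "fps_eval G a \<in> fil 1" using G by (intro fps_eval_in_fil[OF a]) auto
  have "fps_eval (fps_compose F G - P) a \<in> fil N"
  proof (rule fps_eval_in_fil[OF a])
    fix n assume "n < N"
    have "(\<Sum>i=0..n. fps_nth F i * fps_nth (G ^ i) n) = (\<Sum>i<N. fps_nth F i * fps_nth (G ^ i) n)"
      using \<open>n < N\<close> startsby_zero_power_prefix[OF G]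
      by (intro sum.mono_neutral_left) auto
    then show "fps_nth (fps_compose F G - P) n = 0"
      by (simp add: fps_compose_nth P_def fps_sum_nth)
  qed
  moreover have "fps_eval P a = (\<Sum>i<N. \<iota> (fps_nth F i) * fps_eval G a ^ i)"
    by (simp add: P_def fps_eval_sum[OF a] fps_eval_mult[OF a] fps_eval_power[OF a])
  moreover have "fps_eval F (fps_eval G a) - (\<Sum>i<N. \<iota> (fps_nth F i) * fps_eval G a ^ i) \<in> fil N"
    unfolding fps_eval_def[of F] by (rule suminf_fil) (rule fps_eval_term[OF b])
  ultimately show "fps_eval (fps_compose F G) a - fps_eval F (fps_eval G a) \<in> fil N"
    using fil_trans[OF _ fil_sym] by (simp add: fps_eval_diff[OF a])
qed

lemma alg_exp_eq: "alg_exp \<iota> a = fps_eval (fps_exp 1) a"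
  by (simp add: alg_exp_def fps_eval_def)

lemma alg_log_eq:
  assumes a: "a - 1 \<in> fil 1" shows "alg_log \<iota> a = fps_eval (fps_ln 1) (a - 1)"
  unfolding alg_log_def
proof (rule suminf_filI)
  fix N
  let ?u = "\<lambda>n. \<iota> ((- 1) ^ n / of_nat (Suc n)) * (a - 1) ^ Suc n"
  let ?v = "\<lambda>n. \<iota> (fps_nth (fps_ln 1) n) * (a - 1) ^ n"
  \<comment> \<open>The series of \<open>alg_log\<close> starts at the linear term, so N of its
    terms are N + 1 terms of \<open>fps_ln\<close>, whose constant term vanishes.\<close>
  have "sum ?u {..<N} = sum ?v {..<Suc N}"
    by (subst sum.lessThan_Suc_shift) (simp add: fps_ln_def)
  moreover have "fps_eval (fps_ln 1) (a - 1) - sum ?v {..<Suc N} \<in> fil (Suc N)"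
    unfolding fps_eval_def by (rule suminf_fil) (rule fps_eval_term[OF a])
  ultimately show "fps_eval (fps_ln 1) (a - 1) - sum ?u {..<N} \<in> fil N"
    using fil_Suc[of N] by auto
qed

lemma alg_log_fil: "a - 1 \<in> fil 1 \<Longrightarrow> alg_log \<iota> a \<in> fil 1"
  by (subst alg_log_eq) (auto simp: fps_ln_def intro!: fps_eval_in_fil)

lemma alg_exp_fil: "a \<in> fil 1 \<Longrightarrow> alg_exp \<iota> a - 1 \<in> fil 1"
  using fps_eval_in_fil[of a 1 "fps_exp 1 - 1"] by (simp add: alg_exp_eq fps_eval_diff)

lemma fps_exp_ln_compose: "(fps_exp 1 :: 'k fps) oo fps_ln 1 = 1 + fps_X"
  using fps_inv_fps_exp_compose(2)[of "1::'k"] fps_ln_fps_exp_inv[of "1::'k"]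
  by (simp add: fps_compose_sub_distrib algebra_simps)

lemma fps_ln_exp_compose: "(fps_ln 1 :: 'k fps) oo (fps_exp 1 - 1) = fps_X"
  using fps_inv_fps_exp_compose(1)[of "1::'k"] fps_ln_fps_exp_inv[of "1::'k"] by simp

lemma alg_exp_log [simp]:
  assumes a: "a - 1 \<in> fil 1" shows "alg_exp \<iota> (alg_log \<iota> a) = a"
proof -
  have "fps_eval (fps_exp 1 oo fps_ln 1) (a - 1) = a"
    by (simp only: fps_exp_ln_compose fps_eval_add[OF a] fps_eval_one fps_eval_X[OF a]) simp
  then show ?thesis by (subst (asm) fps_eval_compose[OF a]) (simp_all add: alg_exp_eq alg_log_eq[OF a] fps_ln_nth)
qed

lemma alg_log_exp [simp]:
  assumes a: "a \<in> fil 1" shows "alg_log \<iota> (alg_exp \<iota> a) = a"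
proof -
  have "fps_eval (fps_exp 1 - 1) a = alg_exp \<iota> a - 1"
    by (simp add: fps_eval_diff[OF a] alg_exp_eq)
  then have "alg_log \<iota> (alg_exp \<iota> a) = fps_eval (fps_ln 1 oo (fps_exp 1 - 1)) a"
    by (simp add: alg_log_eq[OF alg_exp_fil[OF a]] fps_eval_compose[OF a])
  then show ?thesis by (simp only: fps_ln_exp_compose fps_eval_X[OF a])
qed

lemma alg_exp_zero [simp]: "alg_exp \<iota> 0 = 1"
  unfolding alg_exp_def
proof (rule suminf_filI)
  fix N
  have "(\<Sum>n<N. \<iota> (1 / fact n) * 0 ^ n) = (if N = 0 then 0 else 1)"
    by (induction N) (auto simp: zero_power)
  then show "1 - (\<Sum>n<N. \<iota> (1 / fact n) * 0 ^ n) \<in> fil N" by (auto simp: fil_zero)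
qed

lemma alg_log_one [simp]: "alg_log \<iota> 1 = 0"
  using alg_log_exp[of 0] by (simp add: fil_zero)

section \<open>Functional equations of exponential, logarithm and powers\<close>

lemma of_nat_lcomm: "a * (of_nat n * b) = of_nat n * (a * (b :: 'a))"
  by (metis mult.assoc mult_of_nat_commute)

text \<open>Divided by n!, the binomial theorem for commuting elements becomes a Cauchy product, the
  form that \<open>suminf_cauchy\<close> accepts.\<close>

lemma divided_power_add:
  assumes "a * b = b * a"
  shows "\<iota> (1 / fact n) * (a + b) ^ n
    = (\<Sum>i\<le>n. (\<iota> (1 / fact i) * a ^ i) * (\<iota> (1 / fact (n - i)) * b ^ (n - i)))"
proof -
  have "(a + b) ^ n = (\<Sum>i\<le>n. of_nat (n choose i) * a ^ i * b ^ (n - i))"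
  proof (induction n)
    case (Suc n)
    have comm: "b * a ^ i = a ^ i * b" for i
      using power_commuting_commutes[of a b i] assms by simp
    have "(a + b) ^ Suc n = a * (a + b) ^ n + b * (a + b) ^ n" by (simp add: distrib_right)
    also have "a * (a + b) ^ n = (\<Sum>i\<le>n. of_nat (n choose i) * a ^ Suc i * b ^ (n - i))"
      by (simp only: Suc sum_distrib_left power_Suc mult.assoc of_nat_lcomm)
    also have "b * (a + b) ^ n = (\<Sum>i\<le>n. of_nat (n choose i) * a ^ i * b ^ (Suc n - i))"
      unfolding Suc sum_distrib_left
    proof (rule sum.cong[OF HOL.refl])
      fix i assume "i \<in> {..n}"
      have "b * (of_nat (n choose i) * a ^ i * b ^ (n - i)) = of_nat (n choose i) * (b * a ^ i) * b ^ (n - i)"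
        by (simp only: mult.assoc of_nat_lcomm)
      also have "\<dots> = of_nat (n choose i) * a ^ i * (b * b ^ (n - i))" by (simp add: comm mult.assoc)
      finally show "b * (of_nat (n choose i) * a ^ i * b ^ (n - i)) = of_nat (n choose i) * a ^ i * b ^ (Suc n - i)"
        using \<open>i \<in> {..n}\<close> by (simp add: Suc_diff_le)
    qed
    \<comment> \<open>Both sums are brought to the range up to \<open>Suc n\<close>, where Pascal's
      rule applies term by term. The guard at i = 0 is necessary because i - 1 is truncated
      subtraction.\<close>
    also have "(\<Sum>i\<le>n. of_nat (n choose i) * a ^ Suc i * b ^ (n - i))
        = (\<Sum>i\<le>Suc n. (if i = 0 then 0 else of_nat (n choose (i - 1)) * a ^ i * b ^ (Suc n - i)))"
      by (subst sum.atMost_Suc_shift) simp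
    also have "(\<Sum>i\<le>n. of_nat (n choose i) * a ^ i * b ^ (Suc n - i))
        = (\<Sum>i\<le>Suc n. of_nat (n choose i) * a ^ i * b ^ (Suc n - i))"
      by (simp add: binomial_eq_0)
    also have "(\<Sum>i\<le>Suc n. (if i = 0 then 0 else of_nat (n choose (i - 1)) * a ^ i * b ^ (Suc n - i)))
       + (\<Sum>i\<le>Suc n. of_nat (n choose i) * a ^ i * b ^ (Suc n - i))
       = (\<Sum>i\<le>Suc n. of_nat (Suc n choose i) * a ^ i * b ^ (Suc n - i))"
      unfolding sum.distrib[symmetric]
    proof (rule sum.cong[OF HOL.refl])
      fix i assume "i \<in> {..Suc n}"
      show "(if i = 0 then 0 else of_nat (n choose (i - 1)) * a ^ i * b ^ (Suc n - i))
         + of_nat (n choose i) * a ^ i * b ^ (Suc n - i) = of_nat (Suc n choose i) * a ^ i * b ^ (Suc n - i)"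
        by (cases i) (auto simp: distrib_right)
    qed
    finally show ?case .
  qed simp
  moreover have "\<iota> (1 / fact n) * (of_nat (n choose i) * a ^ i * b ^ (n - i))
     = (\<iota> (1 / fact i) * a ^ i) * (\<iota> (1 / fact (n - i)) * b ^ (n - i))" if "i \<le> n" for i
  proof -
    have "1 / fact n * of_nat (n choose i) = 1 / fact i * (1 / fact (n - i) :: 'k)"
      using binomial_fact[OF that, where 'a='k] by (simp add: field_simps)
    then have eq: "\<iota> (1 / fact n) * of_nat (n choose i) = \<iota> (1 / fact i) * \<iota> (1 / fact (n - i))"
      by (simp only: scalar_mult[symmetric] scalar_of_nat[symmetric])
    have "(\<iota> (1 / fact i) * a ^ i) * (\<iota> (1 / fact (n - i)) * b ^ (n - i))
        = \<iota> (1 / fact i) * \<iota> (1 / fact (n - i)) * a ^ i * b ^ (n - i)"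
      by (simp only: mult.assoc scalar_lcomm[of "a ^ i"])
    then show ?thesis unfolding eq[symmetric] by (simp only: mult.assoc)
  qed
  ultimately show ?thesis by (auto simp: sum_distrib_left intro!: sum.cong)
qed

lemma exp_term_fil: "a \<in> fil 1 \<Longrightarrow> \<iota> (1 / fact n) * a ^ n \<in> fil n"
  by (intro fil_mult_left fil_power)

lemma alg_exp_add:
  assumes "a \<in> fil 1" "b \<in> fil 1" "a * b = b * a"
  shows "alg_exp \<iota> (a + b) = alg_exp \<iota> a * alg_exp \<iota> b"
  unfolding alg_exp_def divided_power_add[OF assms(3)]
  by (rule suminf_cauchy) (auto intro: exp_term_fil assms)

lemma intertwine_power: "g * a = a' * g \<Longrightarrow> g * a ^ n = a' ^ n * (g :: 'a)"
  by (induction n) (simp_all, metis mult.assoc)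

lemma intertwine_log:
  assumes a: "a - 1 \<in> fil 1" and a': "a' - 1 \<in> fil 1" and g: "g * a = a' * g"
  shows "g * alg_log \<iota> a = alg_log \<iota> a' * g"
proof -
  have fil: "\<iota> ((- 1) ^ n / of_nat (Suc n)) * (a - 1) ^ Suc n \<in> fil n" if "a - 1 \<in> fil 1" for a n
    using fil_power[OF that, of "Suc n"] fil_Suc[of n] by (intro fil_mult_left) auto
  have "g * (a - 1) ^ n = (a' - 1) ^ n * g" for n
    using g by (intro intertwine_power) (simp add: algebra_simps)
  then have "g * (\<iota> c * (a - 1) ^ n) = \<iota> c * (a' - 1) ^ n * g" for c n
    by (metis mult.assoc scalar_lcomm)
  then show ?thesis
    unfolding alg_log_def by (intro suminf_intertwine fil a a')
qed

lemma intertwine_exp: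
  assumes a: "a \<in> fil 1" and a': "a' \<in> fil 1" and g: "g * a = a' * g"
  shows "g * alg_exp \<iota> a = alg_exp \<iota> a' * g"
proof -
  have "g * (\<iota> c * a ^ n) = \<iota> c * a' ^ n * g" for c n
    using intertwine_power[OF g] by (metis mult.assoc scalar_lcomm)
  then show ?thesis
    unfolding alg_exp_def by (intro suminf_intertwine exp_term_fil a a')
qed

lemma alg_pow_fil [intro]: "a - 1 \<in> fil 1 \<Longrightarrow> alg_pow \<iota> a m - 1 \<in> fil 1"
  unfolding alg_pow_def by (intro alg_exp_fil fil_mult_left alg_log_fil)

lemma intertwine_pow:
  assumes "a - 1 \<in> fil 1" "a' - 1 \<in> fil 1" "g * a = a' * g"
  shows "g * alg_pow \<iota> a m = alg_pow \<iota> a' m * g"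
  unfolding alg_pow_def using intertwine_log[OF assms]
  by (intro intertwine_exp fil_mult_left alg_log_fil assms(1,2)) (metis mult.assoc scalar_lcomm)

text \<open>Commutation passes to the logarithms by \<open>intertwine_log\<close>, one argument at a
  time; then both sides have the exponential a * b, and \<open>alg_log_exp\<close> makes exp
  injective.\<close>

lemma alg_log_mult:
  assumes a: "a - 1 \<in> fil 1" and b: "b - 1 \<in> fil 1" and ab: "a * b = b * a"
  shows "alg_log \<iota> (a * b) = alg_log \<iota> a + alg_log \<iota> b"
proof -
  have "a * alg_log \<iota> b = alg_log \<iota> b * a" by (intro intertwine_log assms)
  then have "alg_log \<iota> b * alg_log \<iota> a = alg_log \<iota> a * alg_log \<iota> b" by (intro intertwine_log assms) simp
  then have "alg_exp \<iota> (alg_log \<iota> a + alg_log \<iota> b) = a * b"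
    by (subst alg_exp_add) (simp_all add: alg_log_fil a b del: One_nat_def)
  then show ?thesis using alg_log_exp[of "alg_log \<iota> a + alg_log \<iota> b"] alg_log_fil a b fil_add by metis
qed

lemma alg_log_pow: "a - 1 \<in> fil 1 \<Longrightarrow> alg_log \<iota> (alg_pow \<iota> a m) = \<iota> m * alg_log \<iota> a"
  unfolding alg_pow_def by (intro alg_log_exp fil_mult_left alg_log_fil)

lemma alg_pow_pow: "a - 1 \<in> fil 1 \<Longrightarrow> alg_pow \<iota> (alg_pow \<iota> a m) n = alg_pow \<iota> a (m * n)"
  unfolding alg_pow_def[of _ "alg_pow \<iota> a m"] alg_log_pow
  unfolding alg_pow_def by (simp only: mult.assoc[symmetric] scalar_mult[symmetric] mult.commute[of n m])

lemma alg_pow_add: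
  assumes "a - 1 \<in> fil 1" shows "alg_pow \<iota> a (m + n) = alg_pow \<iota> a m * alg_pow \<iota> a n"
  unfolding alg_pow_def scalar_add distrib_right
  by (intro alg_exp_add fil_mult_left alg_log_fil assms) (metis mult.assoc scalar_lcomm scalar_comm)

lemma alg_pow_0 [simp]: "alg_pow \<iota> a 0 = 1"
  by (simp add: alg_pow_def)

lemma alg_pow_1 [simp]: "a - 1 \<in> fil 1 \<Longrightarrow> alg_pow \<iota> a 1 = a"
  by (simp add: alg_pow_def)

lemma alg_pow_neg:
  assumes "a - 1 \<in> fil 1"
  shows "alg_pow \<iota> a m * alg_pow \<iota> a (- m) = 1" "alg_pow \<iota> a (- m) * alg_pow \<iota> a m = 1"
  using alg_pow_add[OF assms, of m "- m"] alg_pow_add[OF assms, of "- m" m] by simp_all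

text \<open>Inverses of unipotent elements are powers with exponent -1, so homomorphisms and
  intertwiners treat them like any other power.\<close>

lemma unipotent_inverse:
  assumes "a - 1 \<in> fil 1"
  shows "a * alg_pow \<iota> a (-1) = 1" "alg_pow \<iota> a (-1) * a = 1"
  using alg_pow_neg[OF assms, of 1] assms by simp_all

lemma unipotent_mult: "(a :: 'a) - 1 \<in> fil 1 \<Longrightarrow> b - 1 \<in> fil 1 \<Longrightarrow> a * b - 1 \<in> fil 1"
  using fil_cong_mult[of a 1 1 b 1] by simp

lemma alg_pow_mult:
  assumes a: "a - 1 \<in> fil 1" and b: "b - 1 \<in> fil 1" and ab: "a * b = b * a"
  shows "alg_pow \<iota> (a * b) m = alg_pow \<iota> a m * alg_pow \<iota> b m"
proof -
  have "alg_log \<iota> b * alg_log \<iota> a = alg_log \<iota> a * alg_log \<iota> b"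
    using assms by (intro intertwine_log) (simp_all add: intertwine_log)
  then have "\<iota> m * alg_log \<iota> a * (\<iota> m * alg_log \<iota> b) = \<iota> m * alg_log \<iota> b * (\<iota> m * alg_log \<iota> a)"
    by (metis mult.assoc scalar_lcomm)
  then show ?thesis unfolding alg_pow_def alg_log_mult[OF assms] distrib_left
    by (intro alg_exp_add fil_mult_left alg_log_fil a b)
qed

end

section \<open>Evaluation of noncommutative power series\<close>

lemma finite_words [simp]: "finite {w :: letter list. length w = n}"
  using finite_lists_length_eq[of "UNIV :: letter set" n] by simp

lemma sum_words_append:
  fixes g :: "letter list \<Rightarrow> letter list \<Rightarrow> 'b::comm_monoid_add"
  assumes "i \<le> n"
  shows "(\<Sum>w | length w = n. g (take i w) (drop i w))
    = (\<Sum>u | length u = i. \<Sum>v | length v = n - i. g u v)"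
proof -
  have "(\<Sum>u | length u = i. \<Sum>v | length v = n - i. g u v)
      = (\<Sum>(u, v)\<in>{u. length u = i} \<times> {v. length v = n - i}. g u v)"
    by (simp add: sum.cartesian_product)
  also have "\<dots> = (\<Sum>w | length w = n. g (take i w) (drop i w))"
    by (rule sum.reindex_bij_witness[where i = "\<lambda>w. (take i w, drop i w)" and j = "\<lambda>(u, v). u @ v"])
      (use assms in auto)
  finally show ?thesis by simp
qed

lemma words_length_1: "{w :: letter list. length w = Suc 0} = {[LX], [LY]}"
  using letter.exhaust by (auto simp: length_Suc_conv)

lemma nc_coeff_simps [simp]:
  "nc_coeff 0 w = 0" "nc_coeff (F + G) w = nc_coeff F w + nc_coeff G w"
  "nc_coeff (F - G) w = nc_coeff F w - nc_coeff G w" "nc_coeff (- F) w = - nc_coeff F w"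
  "nc_coeff 1 w = (if w = [] then 1 else 0)" "nc_coeff (nc_const c) w = (if w = [] then c else 0)"
  "nc_coeff nc_X w = (if w = [LX] then 1 else 0)" "nc_coeff nc_Y w = (if w = [LY] then 1 else 0)"
  by (transfer, simp)+

lemma nc_coeff_mult: "nc_coeff (F * G) w = (\<Sum>i\<le>length w. nc_coeff F (take i w) * nc_coeff G (drop i w))"
  by transfer (simp add: atLeast0AtMost)

lemma fil_ncfps_iff: "F \<in> fil n \<longleftrightarrow> (\<forall>w. length w < n \<longrightarrow> nc_coeff F w = 0)"
  by (simp add: fil_ncfps_def)

lemma nc_coeff_const_mult [simp]: "nc_coeff (nc_const c * F) w = c * nc_coeff F w"
proof -
  have "nc_coeff (nc_const c * F) w = (\<Sum>i\<in>{0}. nc_coeff (nc_const c) (take i w) * nc_coeff F (drop i w))"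
    unfolding nc_coeff_mult by (rule sum.mono_neutral_right) auto
  then show ?thesis by simp
qed

lemma nc_coeff_mult_const [simp]: "nc_coeff (F * nc_const c) w = nc_coeff F w * c"
proof -
  have "nc_coeff (F * nc_const c) w = (\<Sum>i\<in>{length w}. nc_coeff F (take i w) * nc_coeff (nc_const c) (drop i w))"
    unfolding nc_coeff_mult by (rule sum.mono_neutral_right) auto
  then show ?thesis by simp
qed

interpretation ncfps: complete_filtered_algebra "nc_const :: 'k::field_char_0 \<Rightarrow> 'k ncfps"
proof
  fix c d :: 'k and F G :: "'k ncfps" and m n
  show "nc_const (1 :: 'k) = 1" "nc_const (c + d) = nc_const c + nc_const d"
    "nc_const (c * d) = nc_const c * nc_const d" "nc_const c * F = F * nc_const c"
    by (auto intro!: ncfps_eqI simp: mult.commute)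
  show "F \<in> fil 0" by (simp add: fil_ncfps_iff)
  assume F: "F \<in> fil m" and G: "G \<in> fil n"
  show "F * G \<in> fil (m + n)"
    unfolding fil_ncfps_iff nc_coeff_mult
  proof (intro allI impI sum.neutral ballI)
    fix w :: "letter list" and i assume w: "length w < m + n" and "i \<in> {..length w}"
    then have "length (take i w) < m \<or> length (drop i w) < n" by auto
    then show "nc_coeff F (take i w) * nc_coeff G (drop i w) = 0"
      using F G unfolding fil_ncfps_iff by (elim disjE) simp_all
  qed
next
  fix S :: "nat \<Rightarrow> 'k ncfps" assume S: "S (Suc n) - S n \<in> fil n" for n
  \<comment> \<open>From index \<open>Suc (length w)\<close> on, the coefficient of w no longer
    changes.\<close>
  define L where "L = Abs_ncfps (\<lambda>w. nc_coeff (S (Suc (length w))) w)"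
  have step: "S (n + k) - S n \<in> fil n" for n k
  proof (induction k)
    case (Suc k)
    have "S (Suc (n + k)) - S (n + k) \<in> fil n" using S[of "n + k"] fil_antimono[of n "n + k"] by auto
    from fil_trans[OF this Suc] show ?case by simp
  qed (simp add: fil_zero)
  have "S n - L \<in> fil N" if "N \<le> n" for n N
    unfolding fil_ncfps_iff
  proof (intro allI impI)
    fix w :: "letter list" assume "length w < N"
    then show "nc_coeff (S n - L) w = 0"
      using step[of "Suc (length w)" "n - Suc (length w)"] that
      by (simp add: L_def Abs_ncfps_inverse fil_ncfps_iff)
  qed
  then have "S \<longlonglongrightarrow> L" unfolding tendsto_iff_fil by (auto simp: eventually_sequentially)
  then show "\<exists>L. S \<longlonglongrightarrow> L" ..
qed

definition word_eval :: "'a::monoid_mult \<Rightarrow> 'a \<Rightarrow> letter list \<Rightarrow> 'a" where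
  "word_eval a b w = prod_list (map (case_letter a b) w)"

lemma word_eval_Nil [simp]: "word_eval a b [] = 1"
  and word_eval_Cons: "word_eval a b (l # w) = case_letter a b l * word_eval a b w"
  by (simp_all add: word_eval_def)

lemma word_eval_append: "word_eval a b (u @ v) = word_eval a b u * word_eval a b v"
  by (simp add: word_eval_def)

context complete_filtered_algebra
begin

lemma word_eval_fil:
  assumes "(a :: 'a) \<in> fil 1" "b \<in> fil 1" shows "word_eval a b w \<in> fil (length w)"
proof (induction w)
  case (Cons l w)
  have "case_letter a b l \<in> fil 1" using assms by (cases l) auto
  from fil_mult[OF this Cons] show ?case by (simp add: word_eval_Cons)
qed simp

definition nc_term :: "'k ncfps \<Rightarrow> 'a \<Rightarrow> 'a \<Rightarrow> nat \<Rightarrow> 'a" where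
  "nc_term F a b n = (\<Sum>w | length w = n. \<iota> (nc_coeff F w) * word_eval a b w)"

text \<open>Substitutes for X and Y themselves, whereas \<open>nc_eval\<close> substitutes for their
  exponentials; the two differ by taking logarithms of the arguments.\<close>

definition nc_subst :: "'k ncfps \<Rightarrow> 'a \<Rightarrow> 'a \<Rightarrow> 'a" where
  "nc_subst F a b = suminf (nc_term F a b)"

lemma nc_eval_eq: "nc_eval \<iota> F a b = nc_subst F (alg_log \<iota> a) (alg_log \<iota> b)"
  by (simp add: nc_eval_def nc_subst_def nc_term_def[abs_def] word_eval_def)

lemma nc_term_fil: "a \<in> fil 1 \<Longrightarrow> b \<in> fil 1 \<Longrightarrow> nc_term F a b n \<in> fil n"
  unfolding nc_term_def using word_eval_fil by (intro fil_sum fil_mult_left) fastforce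

lemma nc_subst_approx:
  "a \<in> fil 1 \<Longrightarrow> b \<in> fil 1 \<Longrightarrow> nc_subst F a b - (\<Sum>n<N. nc_term F a b n) \<in> fil N"
  unfolding nc_subst_def by (rule suminf_fil) (rule nc_term_fil)

lemma nc_subst_fil:
  assumes "a \<in> fil 1" "b \<in> fil 1" "F \<in> fil N" shows "nc_subst F a b \<in> fil N"
  unfolding nc_subst_def
proof (rule suminf_in_fil)
  fix n assume "n < N"
  then show "nc_term F a b n = 0"
    using assms(3) by (auto simp: nc_term_def fil_ncfps_iff intro!: sum.neutral)
qed (intro nc_term_fil assms)

lemma nc_subst_add:
  assumes "a \<in> fil 1" "b \<in> fil 1"
  shows "nc_subst (F + G) a b = nc_subst F a b + nc_subst G a b"
proof -
  have "nc_term (F + G) a b n = nc_term F a b n + nc_term G a b n" for n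
    by (simp add: nc_term_def scalar_add distrib_right sum.distrib)
  then show ?thesis using suminf_plus[OF nc_term_fil[OF assms, of F] nc_term_fil[OF assms, of G]]
    by (simp add: nc_subst_def cong: suminf_cong)
qed

lemma nc_term_mult: "nc_term (F * G) a b n = (\<Sum>i\<le>n. nc_term F a b i * nc_term G a b (n - i))"
proof -
  have "nc_term (F * G) a b n = (\<Sum>w | length w = n. \<Sum>i\<le>n.
      \<iota> (nc_coeff F (take i w)) * \<iota> (nc_coeff G (drop i w)) * (word_eval a b (take i w) * word_eval a b (drop i w)))"
    unfolding nc_term_def
    by (rule sum.cong[OF HOL.refl])
      (simp add: nc_coeff_mult scalar_sum scalar_mult sum_distrib_right flip: word_eval_append)
  also have "\<dots> = (\<Sum>i\<le>n. \<Sum>w | length w = n.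
      \<iota> (nc_coeff F (take i w)) * \<iota> (nc_coeff G (drop i w)) * (word_eval a b (take i w) * word_eval a b (drop i w)))"
    by (rule sum.swap)
  also have "\<dots> = (\<Sum>i\<le>n. \<Sum>u | length u = i. \<Sum>v | length v = n - i.
      \<iota> (nc_coeff F u) * \<iota> (nc_coeff G v) * (word_eval a b u * word_eval a b v))"
    by (rule sum.cong[OF HOL.refl], rule sum_words_append) simp
  also have "\<dots> = (\<Sum>i\<le>n. nc_term F a b i * nc_term G a b (n - i))"
    unfolding nc_term_def sum_product
    by (intro sum.cong HOL.refl) (simp only: mult.assoc scalar_lcomm[of "word_eval a b _"])
  finally show ?thesis .
qed

lemma nc_subst_mult:
  assumes "a \<in> fil 1" "b \<in> fil 1"
  shows "nc_subst (F * G) a b = nc_subst F a b * nc_subst G a b"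
  unfolding nc_subst_def nc_term_mult[abs_def]
  by (rule suminf_cauchy) (intro nc_term_fil assms)+

lemma nc_subst_single_degree:
  assumes "a \<in> fil 1" "b \<in> fil 1" "\<And>w. length w \<noteq> n \<Longrightarrow> nc_coeff F w = 0"
  shows "nc_subst F a b = nc_term F a b n"
  unfolding nc_subst_def
proof (rule suminf_filI)
  fix N
  have "nc_term F a b k = (if k = n then nc_term F a b n else 0)" for k
    using assms(3) by (auto simp: nc_term_def intro!: sum.neutral)
  then have "(\<Sum>k<N. nc_term F a b k) = (if n < N then nc_term F a b n else 0)"
    by (simp add: sum.delta)
  then show "nc_term F a b n - (\<Sum>k<N. nc_term F a b k) \<in> fil N"
    using nc_term_fil[OF assms(1,2), of F n] fil_antimono[of N n] by (auto simp: fil_zero)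
qed

lemma nc_subst_const [simp]: "a \<in> fil 1 \<Longrightarrow> b \<in> fil 1 \<Longrightarrow> nc_subst (nc_const c) a b = \<iota> c"
  by (subst nc_subst_single_degree[where n = 0]) (auto simp: nc_term_def)

lemma nc_subst_one [simp]: "a \<in> fil 1 \<Longrightarrow> b \<in> fil 1 \<Longrightarrow> nc_subst 1 a b = 1"
  using nc_subst_const[of a b 1] by simp

lemma nc_subst_X [simp]: "a \<in> fil 1 \<Longrightarrow> b \<in> fil 1 \<Longrightarrow> nc_subst nc_X a b = a"
  and nc_subst_Y [simp]: "a \<in> fil 1 \<Longrightarrow> b \<in> fil 1 \<Longrightarrow> nc_subst nc_Y a b = b"
  by (subst nc_subst_single_degree[where n = 1],
      auto simp: nc_term_def words_length_1 word_eval_Cons)+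

lemma nc_subst_unipotent:
  assumes "a \<in> fil 1" "b \<in> fil 1" "nc_coeff F [] = 1"
  shows "nc_subst F a b - 1 \<in> fil 1"
  using nc_subst_fil[of a b "F - 1" 1] nc_subst_add[of a b "F - 1" 1] assms
  by (simp add: fil_ncfps_iff)

lemma nc_eval_unipotent:
  "a - 1 \<in> fil 1 \<Longrightarrow> b - 1 \<in> fil 1 \<Longrightarrow> nc_coeff F [] = 1 \<Longrightarrow> nc_eval \<iota> F a b - 1 \<in> fil 1"
  unfolding nc_eval_eq by (intro nc_subst_unipotent alg_log_fil)

lemma intertwine_word_eval:
  "g * a = a' * g \<Longrightarrow> g * b = b' * g \<Longrightarrow> g * word_eval a b w = word_eval a' b' w * (g :: 'a)"
proof (induction w)
  case (Cons l w)
  have "g * case_letter a b l = case_letter a' b' l * g" using Cons.prems by (cases l) auto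
  then show ?case using Cons.IH[OF Cons.prems] unfolding word_eval_Cons by (metis mult.assoc)
qed simp

lemma intertwine_nc_term:
  assumes "g * a = a' * g" "g * b = b' * g"
  shows "g * nc_term F a b n = nc_term F a' b' n * g"
  unfolding nc_term_def sum_distrib_left sum_distrib_right
  by (rule sum.cong[OF HOL.refl])
    (simp only: scalar_lcomm intertwine_word_eval[OF assms] mult.assoc)

lemma intertwine_nc_eval:
  assumes a: "a - 1 \<in> fil 1" "a' - 1 \<in> fil 1" and b: "b - 1 \<in> fil 1" "b' - 1 \<in> fil 1"
    and g: "g * a = a' * g" "g * b = b' * g"
  shows "g * nc_eval \<iota> F a b = nc_eval \<iota> F a' b' * g"
  unfolding nc_eval_eq nc_subst_def
  by (intro suminf_intertwine nc_term_fil alg_log_fil a b intertwine_nc_term intertwine_log g)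

end

text \<open>Continuity is required in the strong form \<open>hom_fil\<close>, which carries
  truncation errors to truncation errors of the same degree.\<close>

locale continuous_hom = A: complete_filtered_algebra \<iota> + B: complete_filtered_algebra \<iota>'
  for \<iota> :: "'k::field_char_0 \<Rightarrow> 'a::filtered_ring" and \<iota>' :: "'k \<Rightarrow> 'b::filtered_ring" +
  fixes h :: "'a \<Rightarrow> 'b"
  assumes hom_add: "h (a + b) = h a + h b"
    and hom_mult: "h (a * b) = h a * h b"
    and hom_scalar: "h (\<iota> c) = \<iota>' c"
    and hom_fil: "a \<in> fil n \<Longrightarrow> h a \<in> fil n"
begin

lemma hom_one [simp]: "h 1 = 1"
  using hom_scalar[of 1] by simp

lemma hom_zero [simp]: "h 0 = 0"
  using hom_add[of 0 0] by simp

lemma hom_uminus: "h (- a) = - h a"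
  using hom_add[of a "- a"] by (simp add: eq_neg_iff_add_eq_0 add.commute)

lemma hom_diff: "h (a - b) = h a - h b"
  using hom_add[of a "- b"] by (simp add: hom_uminus)

lemma hom_sum: "h (sum u S) = (\<Sum>i\<in>S. h (u i))"
  by (induction S rule: infinite_finite_induct) (auto simp: hom_add)

lemma hom_power: "h (a ^ n) = h a ^ n"
  by (induction n) (auto simp: hom_mult)

lemma hom_suminf:
  assumes "\<And>n. u n \<in> fil n" shows "h (suminf u) = suminf (\<lambda>n. h (u n))"
proof (rule suminf_filI[symmetric])
  fix N show "h (suminf u) - (\<Sum>n<N. h (u n)) \<in> fil N"
    using hom_fil[OF A.suminf_fil[OF assms, of N]] by (simp add: hom_diff hom_sum)
qed

lemma hom_exp: "a \<in> fil 1 \<Longrightarrow> h (alg_exp \<iota> a) = alg_exp \<iota>' (h a)"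
  unfolding alg_exp_def by (subst hom_suminf) (auto simp: hom_mult hom_scalar hom_power A.exp_term_fil simp del: One_nat_def)

lemma hom_log:
  assumes "a - 1 \<in> fil 1" shows "h (alg_log \<iota> a) = alg_log \<iota>' (h a)"
proof -
  have "alg_exp \<iota>' (h (alg_log \<iota> a)) = h a"
    using hom_exp[OF A.alg_log_fil[OF assms]] assms by simp
  moreover have "h (alg_log \<iota> a) \<in> fil 1" by (intro hom_fil A.alg_log_fil assms)
  ultimately show ?thesis using B.alg_log_exp by metis
qed

lemma hom_pow: "a - 1 \<in> fil 1 \<Longrightarrow> h (alg_pow \<iota> a m) = alg_pow \<iota>' (h a) m"
  unfolding alg_pow_def
  by (subst hom_exp) (auto simp: hom_mult hom_scalar hom_log simp del: One_nat_def intro!: fil_mult_left A.alg_log_fil)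

lemma hom_word_eval: "h (word_eval a b w) = word_eval (h a) (h b) w"
  by (induction w) (auto simp: word_eval_Cons hom_mult split: letter.splits)

lemma hom_nc_subst: "a \<in> fil 1 \<Longrightarrow> b \<in> fil 1 \<Longrightarrow> h (A.nc_subst F a b) = B.nc_subst F (h a) (h b)"
  unfolding A.nc_subst_def B.nc_subst_def
  by (subst hom_suminf, rule A.nc_term_fil)
    (simp_all add: hom_sum hom_mult hom_scalar hom_word_eval A.nc_term_def B.nc_term_def[abs_def])

lemma hom_nc_eval:
  "a - 1 \<in> fil 1 \<Longrightarrow> b - 1 \<in> fil 1 \<Longrightarrow> h (nc_eval \<iota> F a b) = nc_eval \<iota>' F (h a) (h b)"
  unfolding A.nc_eval_eq B.nc_eval_eq by (simp only: hom_nc_subst A.alg_log_fil hom_log)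

end

context complete_filtered_algebra
begin

lemma nc_subst_hom:
  assumes "a \<in> fil 1" "b \<in> fil 1"
  shows "continuous_hom nc_const \<iota> (\<lambda>F. nc_subst F a b)"
  by standard (simp_all only: nc_subst_add[OF assms] nc_subst_mult[OF assms] nc_subst_const[OF assms] nc_subst_fil[OF assms])

text \<open>Universal property of the series algebra: an identity between series in
  \<open>nc_x\<close> and \<open>nc_y\<close> can be specialised to every pair of unipotent
  elements.\<close>

lemma nc_eval_hom:
  assumes "a - 1 \<in> fil 1" "b - 1 \<in> fil 1"
  shows "continuous_hom nc_const \<iota> (\<lambda>F. nc_eval \<iota> F a b)"
  unfolding nc_eval_eq by (intro nc_subst_hom alg_log_fil assms)

end

abbreviation nc_x :: "'k::field_char_0 ncfps" where "nc_x \<equiv> alg_exp nc_const nc_X"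
abbreviation nc_y :: "'k::field_char_0 ncfps" where "nc_y \<equiv> alg_exp nc_const nc_Y"

lemma nc_X_fil: "nc_X \<in> fil 1" and nc_Y_fil: "nc_Y \<in> fil 1"
  by (auto simp: fil_ncfps_iff)

lemma nc_x_unipotent: "nc_x - 1 \<in> fil 1" and nc_y_unipotent: "nc_y - 1 \<in> fil 1"
  by (intro ncfps.alg_exp_fil nc_X_fil nc_Y_fil)+

lemma (in complete_filtered_algebra) nc_eval_gens:
  assumes "a - 1 \<in> fil 1" "b - 1 \<in> fil 1"
  shows "nc_eval \<iota> nc_x a b = a" "nc_eval \<iota> nc_y a b = b"
proof -
  interpret h: continuous_hom nc_const \<iota> "\<lambda>F. nc_eval \<iota> F a b" by (rule nc_eval_hom[OF assms])
  show "nc_eval \<iota> nc_x a b = a" "nc_eval \<iota> nc_y a b = b"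
    using h.hom_exp[OF nc_X_fil] h.hom_exp[OF nc_Y_fil] assms
    by (simp_all add: nc_eval_eq alg_log_fil del: One_nat_def)
qed

section \<open>Group-like series\<close>

lemma word_coproduct_length:
  "(u, v) \<in> set (word_coproduct w) \<Longrightarrow> length u + length v = length w"
  by (induction w arbitrary: u v) fastforce+

lemma count_list_map_inj: "inj g \<Longrightarrow> count_list (map g xs) (g x) = count_list xs x"
  by (induction xs) (auto simp: inj_eq)

lemma sum_list_count_superset:
  fixes g :: "'b \<Rightarrow> 'a::semiring_1"
  assumes "finite T" "set xs \<subseteq> T"
  shows "(\<Sum>x\<leftarrow>xs. g x) = (\<Sum>x\<in>T. of_nat (count_list xs x) * g x)"
  using assms(2)
proof (induction xs)
  case (Cons y xs)
  have "(\<Sum>x\<in>T. of_nat (count_list (y # xs) x) * g x)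
      = (\<Sum>x\<in>T. (if y = x then g x else 0) + of_nat (count_list xs x) * g x)"
    by (intro sum.cong) (auto simp: distrib_right)
  also have "\<dots> = g y + (\<Sum>x\<in>T. of_nat (count_list xs x) * g x)"
    using Cons.prems assms(1) by (simp add: sum.distrib sum.delta)
  finally show ?case using Cons by simp
qed simp

text \<open>Expanding the product chooses one of two summands for each letter; commutation sorts the
  two subsequences apart, and \<open>word_coproduct\<close> lists exactly these choices.\<close>

lemma word_eval_sum:
  fixes a b c d :: "'a::ring_1"
  assumes "a * c = c * a" "a * d = d * a" "b * c = c * b" "b * d = d * b"
  shows "word_eval (a + c) (b + d) w = (\<Sum>(u, v)\<leftarrow>word_coproduct w. word_eval a b u * word_eval c d v)"
proof (induction w)
  case (Cons l w)
  define A C where "A = case_letter a b l" and "C = case_letter c d l"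
  have comm: "C * word_eval a b u = word_eval a b u * C" for u
  proof (induction u)
    case (Cons l' u)
    have "C * case_letter a b l' = case_letter a b l' * C"
      unfolding C_def using assms by (cases l; cases l') auto
    then show ?case using Cons unfolding word_eval_Cons by (metis mult.assoc)
  qed simp
  have "word_eval (a + c) (b + d) (l # w) = (A + C) * word_eval (a + c) (b + d) w"
    by (cases l) (auto simp: word_eval_Cons A_def C_def)
  also have "\<dots> = (\<Sum>(u, v)\<leftarrow>word_coproduct w. A * (word_eval a b u * word_eval c d v))
      + (\<Sum>(u, v)\<leftarrow>word_coproduct w. C * (word_eval a b u * word_eval c d v))"
    unfolding Cons by (simp add: distrib_right sum_list_const_mult split_def)
  also have "\<dots> = (\<Sum>(u, v)\<leftarrow>word_coproduct (l # w). word_eval a b u * word_eval c d v)"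
  proof -
    have "C * (word_eval a b u * word_eval c d v) = word_eval a b u * word_eval c d (l # v)" for u v
      by (metis C_def comm mult.assoc word_eval_Cons)
    then show ?thesis by (simp add: comp_def split_def word_eval_Cons A_def mult.assoc)
  qed
  finally show ?case .
qed simp

context complete_filtered_algebra
begin

text \<open>This is the meaning of group-like: the left side pairs the coproduct of \<open>F\<close>
  with words u and v, and the coproduct coefficient is the product of the coefficients of u and
  v.\<close>

lemma nc_term_group_like:
  assumes F: "F \<in> F2" and comm: "a * c = c * a" "a * d = d * a" "b * c = c * b" "b * d = d * b"
  shows "nc_term F (a + c) (b + d) n = (\<Sum>i\<le>n. nc_term F a b i * nc_term F c d (n - i))"
proof -
  define T where "T = Sigma {..n} (\<lambda>i. {u :: letter list. length u = i} \<times> {v :: letter list. length v = n - i})"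
  define P where "P = (\<lambda>(i :: nat, p). case p of (u, v) \<Rightarrow> word_eval a b u * word_eval c d v)"
  have fin: "finite T" unfolding T_def by auto
  have word: "word_eval (a + c) (b + d) w
      = (\<Sum>t\<in>T. of_nat (count_list (word_coproduct w) (snd t)) * P t)" if w: "length w = n" for w
  proof -
    \<comment> \<open>Recording the length of the first word turns the entries of the coproduct into
      members of the dependent sum \<open>T\<close>, which later splits by i.\<close>
    define tag where "tag = (\<lambda>p :: letter list \<times> letter list. (length (fst p), p))"
    have tag: "inj tag" by (auto simp: tag_def inj_def)
    have "word_eval (a + c) (b + d) w = (\<Sum>t\<leftarrow>map tag (word_coproduct w). P t)"
      by (simp add: word_eval_sum[OF comm] P_def split_def tag_def comp_def)
    also have "\<dots> = (\<Sum>t\<in>T. of_nat (count_list (map tag (word_coproduct w)) t) * P t)"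
    proof (rule sum_list_count_superset[OF fin])
      show "set (map tag (word_coproduct w)) \<subseteq> T"
        using word_coproduct_length[of _ _ w] w by (fastforce simp: T_def tag_def)
    qed
    also have "\<dots> = (\<Sum>t\<in>T. of_nat (count_list (word_coproduct w) (snd t)) * P t)"
    proof (rule sum.cong[OF HOL.refl])
      fix t assume "t \<in> T"
      then have "t = tag (snd t)" by (auto simp: T_def tag_def)
      then show "of_nat (count_list (map tag (word_coproduct w)) t) * P t = of_nat (count_list (word_coproduct w) (snd t)) * P t"
        by (metis count_list_map_inj[OF tag])
    qed
    finally show ?thesis .
  qed
  have "nc_term F (a + c) (b + d) n = (\<Sum>w | length w = n. \<Sum>t\<in>T.
      \<iota> (of_nat (count_list (word_coproduct w) (snd t)) * nc_coeff F w) * P t)"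
    unfolding nc_term_def
    by (intro sum.cong HOL.refl)
      (simp add: word sum_distrib_left scalar_mult scalar_of_nat mult.assoc of_nat_lcomm)
  also have "\<dots> = (\<Sum>t\<in>T. \<Sum>w | length w = n.
      \<iota> (of_nat (count_list (word_coproduct w) (snd t)) * nc_coeff F w) * P t)"
    by (rule sum.swap)
  also have "\<dots> = (\<Sum>t\<in>T. \<iota> (nc_coproduct F (fst (snd t)) (snd (snd t))) * P t)"
    by (rule sum.cong[OF HOL.refl])
      (auto simp: T_def nc_coproduct_def scalar_sum sum_distrib_right)
  also have "\<dots> = (\<Sum>t\<in>T. (\<iota> (nc_coeff F (fst (snd t))) * word_eval a b (fst (snd t)))
      * (\<iota> (nc_coeff F (snd (snd t))) * word_eval c d (snd (snd t))))"
    using F unfolding F2_def P_def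
    by (intro sum.cong HOL.refl)
      (simp add: split_def scalar_mult mult.assoc scalar_lcomm[of "word_eval a b _"])
  also have "\<dots> = (\<Sum>i\<le>n. nc_term F a b i * nc_term F c d (n - i))"
    unfolding T_def nc_term_def sum_product
    by (simp add: sum.Sigma sum.cartesian_product split_def)
  finally show ?thesis .
qed

lemma nc_subst_group_like:
  assumes "F \<in> F2" "a * c = c * a" "a * d = d * a" "b * c = c * b" "b * d = d * b"
    and "a \<in> fil 1" "b \<in> fil 1" "c \<in> fil 1" "d \<in> fil 1"
  shows "nc_subst F (a + c) (b + d) = nc_subst F a b * nc_subst F c d"
  unfolding nc_subst_def nc_term_group_like[OF assms(1-5), abs_def]
  by (rule suminf_cauchy) (intro nc_term_fil assms)+

lemma commute_log:
  assumes "a - 1 \<in> fil 1" "b - 1 \<in> fil 1" "a * b = b * a"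
  shows "alg_log \<iota> a * alg_log \<iota> b = alg_log \<iota> b * alg_log \<iota> a"
  by (metis assms intertwine_log)

lemma nc_eval_group_like:
  assumes F: "F \<in> F2" and comm: "a * c = c * a" "a * d = d * a" "b * c = c * b" "b * d = d * b"
    and uni: "a - 1 \<in> fil 1" "b - 1 \<in> fil 1" "c - 1 \<in> fil 1" "d - 1 \<in> fil 1"
  shows "nc_eval \<iota> F (a * c) (b * d) = nc_eval \<iota> F a b * nc_eval \<iota> F c d"
  unfolding nc_eval_eq alg_log_mult[OF uni(1,3) comm(1)] alg_log_mult[OF uni(2,4) comm(4)]
  by (intro nc_subst_group_like F commute_log alg_log_fil uni comm)

end

lemma count_word_coproduct_replicate:
  "count_list (word_coproduct (replicate n l)) ([], replicate n l) = 1"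
  "count_list (word_coproduct (replicate (Suc n) l)) ([l], replicate n l) = Suc n"
proof -
  have inj: "inj (\<lambda>(u, v). (c # u, v :: letter list))" "inj (\<lambda>(u :: letter list, v). (u, c # v))" for c
    by (auto simp: inj_def)
  have zero: "count_list (map (\<lambda>(u, v). (c # u, v)) xs) ([], v :: letter list) = 0"
    "count_list (map (\<lambda>(u, v). (u, c # v)) xs) (u :: letter list, []) = 0" for c v u xs
    by (auto simp: count_list_0_iff)
  note count = count_list_map_inj[OF inj(1), of _ _ "(u, v)" for u v, simplified]
    count_list_map_inj[OF inj(2), of _ _ "(u, v)" for u v, simplified]
  show *: "count_list (word_coproduct (replicate n l)) ([], replicate n l) = 1" for n
    by (induction n) (simp_all add: zero count)
  show "count_list (word_coproduct (replicate (Suc n) l)) ([l], replicate n l) = Suc n"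
  proof (induction n)
    case (Suc n)
    let ?w = "word_coproduct (replicate (Suc n) l)"
    have "count_list (word_coproduct (replicate (Suc (Suc n)) l)) ([l], replicate (Suc n) l)
        = count_list (map (\<lambda>(u, v). (l # u, v)) ?w) (l # [], replicate (Suc n) l)
          + count_list (map (\<lambda>(u, v). (u, l # v)) ?w) ([l], l # replicate n l)"
      by (simp only: word_coproduct.simps(2) replicate_Suc count_list_append)
    then show ?case using Suc *[of "Suc n"] by (simp only: count)
  qed (simp add: zero count *)
qed

lemma word_coproduct_set:
  "(u, v) \<in> set (word_coproduct w) \<Longrightarrow> set w = set u \<union> set v"
  by (induction w arbitrary: u v) fastforce+

text \<open>In the coproduct the coefficient of l tensor l^n comes only from l^(n+1), with
  multiplicity n + 1; comparing with the product of coefficients and dividing by n + 1 uses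
  characteristic 0.\<close>

lemma F2_coeff_replicate:
  fixes F :: "'k::field_char_0 ncfps"
  assumes F: "F \<in> F2" and "nc_coeff F [l] = 0"
  shows "nc_coeff F (replicate (Suc n) l) = 0"
proof -
  have "nc_coproduct F [l] (replicate n l)
      = (\<Sum>w\<in>{replicate (Suc n) l}. of_nat (count_list (word_coproduct w) ([l], replicate n l)) * nc_coeff F w)"
    unfolding nc_coproduct_def
  proof (rule sum.mono_neutral_right)
    show "\<forall>w\<in>{w. length w = length [l] + length (replicate n l)} - {replicate (Suc n) l}.
        of_nat (count_list (word_coproduct w) ([l], replicate n l)) * nc_coeff F w = 0"
    proof
      fix w assume w: "w \<in> {w. length w = length [l] + length (replicate n l)} - {replicate (Suc n) l}"
      have "([l], replicate n l) \<notin> set (word_coproduct w)"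
      proof
        assume "([l], replicate n l) \<in> set (word_coproduct w)"
        then have "set w \<subseteq> {l}" using word_coproduct_set by fastforce
        then have "w = replicate (length w) l" by (metis replicate_eqI singletonD subsetD)
        then show False using w by auto
      qed
      then show "of_nat (count_list (word_coproduct w) ([l], replicate n l)) * nc_coeff F w = 0"
        by (simp add: count_list_0_iff)
    qed
  qed auto
  also have "\<dots> = of_nat (Suc n) * nc_coeff F (replicate (Suc n) l)"
    using count_word_coproduct_replicate(2)[of n l] by simp
  finally have "of_nat (Suc n) * nc_coeff F (replicate (Suc n) l) = nc_coeff F [l] * nc_coeff F (replicate n l)"
    using F by (simp add: F2_def)
  then have "of_nat (Suc n) * nc_coeff F (replicate (Suc n) l) = 0" using assms(2) by simp
  then show ?thesis using of_nat_neq_0[of n, where 'a = 'k] by (metis mult_eq_0_iff)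
qed

definition F2' :: "'k::field ncfps set" where
  "F2' = {F \<in> F2. nc_coeff F [LX] = 0 \<and> nc_coeff F [LY] = 0}"

context complete_filtered_algebra
begin

lemma word_eval_zero:
  "word_eval a 0 w = (if LY \<in> set w then 0 else (a :: 'a) ^ length w)"
  "word_eval 0 b w = (if LX \<in> set w then 0 else (b :: 'a) ^ length w)"
  by (induction w) (auto simp: word_eval_Cons split: letter.splits)

text \<open>Only powers of a single letter survive the substitution, and
  \<open>F2_coeff_replicate\<close> kills their coefficients.\<close>

lemma nc_subst_zero:
  assumes F: "F \<in> F2'" and "a \<in> fil 1" "b \<in> fil 1"
  shows "nc_subst F a 0 = 1" "nc_subst F 0 b = 1"
proof -
  have rep: "nc_coeff F (replicate (Suc n) l) = 0" for n l
    using F F2_coeff_replicate[of F l n] by (cases l) (auto simp: F2'_def)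
  have all: "w = replicate (length w) LX" if "LY \<notin> set w" for w
    using that letter.exhaust by (intro replicate_eqI) blast+
  have all': "w = replicate (length w) LY" if "LX \<notin> set w" for w
    using that letter.exhaust by (intro replicate_eqI) blast+
  have F0: "nc_coeff F [] = 1" using F by (simp add: F2'_def F2_def)
  have "nc_term F a 0 n = (if n = 0 then 1 else 0)" for n
  proof (cases n)
    case (Suc m)
    have "\<iota> (nc_coeff F w) * word_eval a 0 w = 0" if "length w = n" for w
      using rep[of m LX] all[of w] that Suc by (cases "LY \<in> set w") (auto simp: word_eval_zero)
    then show ?thesis by (simp add: nc_term_def Suc)
  qed (simp add: nc_term_def F0)
  then show "nc_subst F a 0 = 1" unfolding nc_subst_def
    by (intro suminf_filI) (auto simp: sum.delta fil_zero)
  have "nc_term F 0 b n = (if n = 0 then 1 else 0)" for n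
  proof (cases n)
    case (Suc m)
    have "\<iota> (nc_coeff F w) * word_eval 0 b w = 0" if "length w = n" for w
      using rep[of m LY] all'[of w] that Suc by (cases "LX \<in> set w") (auto simp: word_eval_zero)
    then show ?thesis by (simp add: nc_term_def Suc)
  qed (simp add: nc_term_def F0)
  then show "nc_subst F 0 b = 1" unfolding nc_subst_def
    by (intro suminf_filI) (auto simp: sum.delta fil_zero)
qed

lemma nc_eval_1:
  assumes "F \<in> F2'"
  shows "a - 1 \<in> fil 1 \<Longrightarrow> nc_eval \<iota> F a 1 = 1" "b - 1 \<in> fil 1 \<Longrightarrow> nc_eval \<iota> F 1 b = 1"
  unfolding nc_eval_eq alg_log_one by (intro nc_subst_zero[OF assms] alg_log_fil fil_zero; assumption)+

lemma unipotent_one [simp]: "(1 :: 'a) - 1 \<in> fil n"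
  by (simp add: fil_zero)

text \<open>The pair (a, b) is the product of the commuting pairs (a, 1) and (1, b). The next two
  lemmas split off (c, 1) and (1, c) in the same way.\<close>

lemma nc_eval_commuting:
  assumes F: "F \<in> F2'" and "a - 1 \<in> fil 1" "b - 1 \<in> fil 1" "a * b = b * a"
  shows "nc_eval \<iota> F a b = 1"
  using nc_eval_group_like[of F a 1 b 1] nc_eval_1[OF F] assms by (simp add: F2'_def fil_zero del: One_nat_def)

lemma nc_eval_central_left:
  assumes F: "F \<in> F2'" and "a - 1 \<in> fil 1" "b - 1 \<in> fil 1" "c - 1 \<in> fil 1" "a * c = c * a" "b * c = c * b"
  shows "nc_eval \<iota> F (a * c) b = nc_eval \<iota> F a b"
  using nc_eval_group_like[of F a c 1 b] nc_eval_1[OF F] assms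
  by (simp add: F2'_def fil_zero del: One_nat_def)

lemma nc_eval_central_right:
  assumes F: "F \<in> F2'" and "a - 1 \<in> fil 1" "b - 1 \<in> fil 1" "c - 1 \<in> fil 1" "a * c = c * a" "b * c = c * b"
  shows "nc_eval \<iota> F a (b * c) = nc_eval \<iota> F a b"
  using nc_eval_group_like[of F a 1 c b] nc_eval_1[OF F] assms
  by (simp add: F2'_def fil_zero del: One_nat_def)

end

section \<open>A representation of the braid group on four strings\<close>

datatype pos = P1 | P2 | P3 | P4
datatype letter3 = LA | LB | LC

lemma UNIV_letter3: "(UNIV :: letter3 set) = {LA, LB, LC}"
  using letter3.exhaust by auto

text \<open>A vector consists of four power series in three noncommuting letters, one for each
  position of the first string. Matrices over these series would not suffice, since braids of the
  other strings act by substitution.\<close>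

typedef 'k bvec = "UNIV :: (pos \<Rightarrow> letter3 list \<Rightarrow> 'k) set"
  morphisms vcoeff Abs_bvec ..

setup_lifting type_definition_bvec

lemma bvec_eqI: "(\<And>p w. vcoeff g p w = vcoeff h p w) \<Longrightarrow> g = h"
  by transfer auto

instantiation bvec :: (ab_group_add) ab_group_add
begin

lift_definition zero_bvec :: "'a bvec" is "\<lambda>p w. 0" .
lift_definition plus_bvec :: "'a bvec \<Rightarrow> 'a bvec \<Rightarrow> 'a bvec" is "\<lambda>g h p w. g p w + h p w" .
lift_definition minus_bvec :: "'a bvec \<Rightarrow> 'a bvec \<Rightarrow> 'a bvec" is "\<lambda>g h p w. g p w - h p w" .
lift_definition uminus_bvec :: "'a bvec \<Rightarrow> 'a bvec" is "\<lambda>g p w. - g p w" .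

instance
  by standard (transfer, simp add: fun_eq_iff algebra_simps)+

end

lift_definition vscale :: "'k \<Rightarrow> 'k bvec \<Rightarrow> 'k::field bvec" is "\<lambda>c g p w. c * g p w" .

lemma vcoeff_simps [simp]:
  "vcoeff 0 p w = 0" "vcoeff (g + h) p w = vcoeff g p w + vcoeff h p w"
  "vcoeff (g - h) p w = vcoeff g p w - vcoeff h p w" "vcoeff (- g) p w = - vcoeff g p w"
  "vcoeff (vscale c v) p w = c * vcoeff v p w"
  by (transfer, simp)+

lemma vcoeff_Abs [simp]: "vcoeff (Abs_bvec g) = g"
  by (simp add: Abs_bvec_inverse)

definition vfil :: "nat \<Rightarrow> 'k::field bvec set" where
  "vfil n = {g. \<forall>p w. length w < n \<longrightarrow> vcoeff g p w = 0}"

lemma vfil_0 [simp]: "g \<in> vfil 0" and vfil_zero [simp]: "0 \<in> vfil n"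
  and vfil_add: "g \<in> vfil n \<Longrightarrow> h \<in> vfil n \<Longrightarrow> g + h \<in> vfil n"
  and vfil_diff: "g \<in> vfil n \<Longrightarrow> h \<in> vfil n \<Longrightarrow> g - h \<in> vfil n"
  and vfil_uminus: "g \<in> vfil n \<Longrightarrow> - g \<in> vfil n"
  and vfil_scale: "g \<in> vfil n \<Longrightarrow> vscale c g \<in> vfil n"
  by (simp_all add: vfil_def)

lemma vfil_trans: "g - h \<in> vfil n \<Longrightarrow> h - k \<in> vfil n \<Longrightarrow> g - k \<in> vfil n"
  using vfil_add[of "g - h" n "h - k"] by simp

lemma vfil_antimono: "g \<in> vfil n \<Longrightarrow> m \<le> n \<Longrightarrow> g \<in> vfil m"
  by (simp add: vfil_def)

lemma vfil_separated: "(\<And>n. g \<in> vfil n) \<Longrightarrow> g = 0"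
  unfolding vfil_def by (intro bvec_eqI) (auto dest: meta_spec[of _ "Suc (length _)"])

lemma vscale_simps [simp]:
  "vscale c (g + h) = vscale c g + vscale c h" "vscale c 0 = 0" "vscale c (- g) = - vscale c g"
  "vscale c (g - h) = vscale c g - vscale c h" "vscale (c + d) g = vscale c g + vscale d g"
  "vscale (c * d) g = vscale c (vscale d g)" "vscale 1 g = g"
  by (auto intro!: bvec_eqI simp: algebra_simps)

lemma vscale_commute: "vscale c (vscale d g) = vscale d (vscale c g)"
  by (auto intro!: bvec_eqI)

section \<open>The algebra of filtered operators on the module\<close>

definition filtered_linear :: "('k::field bvec \<Rightarrow> 'k bvec) \<Rightarrow> bool" where
  "filtered_linear \<phi> \<longleftrightarrow> (\<forall>g h. \<phi> (g + h) = \<phi> g + \<phi> h) \<and> (\<forall>c g. \<phi> (vscale c g) = vscale c (\<phi> g))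
     \<and> (\<forall>m. \<forall>g\<in>vfil m. \<phi> g \<in> vfil m)"

typedef (overloaded) 'k bop = "{\<phi> :: 'k::field bvec \<Rightarrow> 'k bvec. filtered_linear \<phi>}"
  morphisms app Abs_bop
  by (rule exI[of _ "\<lambda>g. g"]) (simp add: filtered_linear_def)

setup_lifting type_definition_bop

lemma bop_eqI: "(\<And>g. app S g = app T g) \<Longrightarrow> S = T"
  by transfer auto

lemma app_add: "app T (g + h) = app T g + app T h"
  and app_scale: "app T (vscale c g) = vscale c (app T g)"
  and app_vfil: "g \<in> vfil m \<Longrightarrow> app T g \<in> vfil m"
  by (transfer, simp add: filtered_linear_def)+

lemma app_0 [simp]: "app T 0 = 0"
  using app_add[of T 0 0] by simp

lemma app_uminus: "app T (- g) = - app T g"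
  using app_add[of T g "- g"] by (simp add: eq_neg_iff_add_eq_0 add.commute)

lemma app_diff: "app T (g - h) = app T g - app T h"
  using app_add[of T g "- h"] by (simp add: app_uminus)

lemma app_sum: "app T (sum g A) = (\<Sum>i\<in>A. app T (g i))"
  by (induction A rule: infinite_finite_induct) (auto simp: app_add)

instantiation bop :: (field) ring_1
begin

lift_definition zero_bop :: "'a bop" is "\<lambda>g. 0"
  by (simp add: filtered_linear_def)
lift_definition one_bop :: "'a bop" is "\<lambda>g. g"
  by (simp add: filtered_linear_def)
lift_definition plus_bop :: "'a bop \<Rightarrow> 'a bop \<Rightarrow> 'a bop" is "\<lambda>S T g. S g + T g"
  by (auto simp: filtered_linear_def vfil_add)
lift_definition minus_bop :: "'a bop \<Rightarrow> 'a bop \<Rightarrow> 'a bop" is "\<lambda>S T g. S g - T g"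
  by (auto simp: filtered_linear_def vfil_diff)
lift_definition uminus_bop :: "'a bop \<Rightarrow> 'a bop" is "\<lambda>S g. - S g"
  by (auto simp: filtered_linear_def vfil_uminus)
lift_definition times_bop :: "'a bop \<Rightarrow> 'a bop \<Rightarrow> 'a bop" is "\<lambda>S T g. S (T g)"
  by (auto simp: filtered_linear_def)

lemma app_simps [simp]:
  "app 0 g = 0" "app 1 g = g" "app (S + T) g = app S g + app T g" "app (S - T) g = app S g - app T g"
  "app (- S) g = - app S g" "app (S * T) g = app S (app T g)"
  by (simp_all add: zero_bop.rep_eq one_bop.rep_eq plus_bop.rep_eq minus_bop.rep_eq uminus_bop.rep_eq times_bop.rep_eq)

instance
proof
  have "vcoeff (app (0 :: 'a bop) (Abs_bvec (\<lambda>p w. 1))) P1 [] \<noteq> vcoeff (app 1 (Abs_bvec (\<lambda>p w. 1))) P1 []"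
    by (simp only: app_simps) simp
  then show "(0 :: 'a bop) \<noteq> 1" by metis
qed (auto intro!: bop_eqI simp: app_add)

end

instantiation bop :: (field) filtered_ring
begin

text \<open>The degree of an operator is the amount by which it raises degrees of vectors; as all
  operators preserve degrees, these sets are two-sided ideals.\<close>

definition fil_bop :: "nat \<Rightarrow> 'a bop set" where
  "fil_bop n = {T. \<forall>m. \<forall>g\<in>vfil m. app T g \<in> vfil (m + n)}"

definition open_bop :: "'a bop set \<Rightarrow> bool" where
  "open_bop U \<longleftrightarrow> (\<forall>a\<in>U. \<exists>n. \<forall>b. b - a \<in> fil n \<longrightarrow> b \<in> U)"

lemma fil_bop_antimono: "m \<le> n \<Longrightarrow> T \<in> fil n \<Longrightarrow> (T :: 'a bop) \<in> fil m"
  unfolding fil_bop_def using vfil_antimono by fastforce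

instance
proof
  show "open (UNIV :: 'a bop set)" by (simp add: open_bop_def)
next
  fix S T :: "'a bop set" assume *: "open S" "open T"
  show "open (S \<inter> T)" unfolding open_bop_def
  proof
    fix a assume "a \<in> S \<inter> T"
    then obtain m n where "\<And>b. b - a \<in> fil m \<Longrightarrow> b \<in> S" "\<And>b. b - a \<in> fil n \<Longrightarrow> b \<in> T"
      using * unfolding open_bop_def by blast
    moreover have "c \<in> fil m \<and> c \<in> fil n" if "c \<in> fil (max m n)" for c :: "'a bop"
      using that fil_bop_antimono[of m "max m n"] fil_bop_antimono[of n "max m n"] by auto
    ultimately show "\<exists>n. \<forall>b. b - a \<in> fil n \<longrightarrow> b \<in> S \<inter> T" by blast
  qed
next
  fix K :: "'a bop set set" assume *: "\<forall>S\<in>K. open S"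
  show "open (\<Union>K)" unfolding open_bop_def
  proof
    fix a assume "a \<in> \<Union>K"
    then obtain S where "S \<in> K" "a \<in> S" by blast
    with * obtain n where "\<forall>b. b - a \<in> fil n \<longrightarrow> b \<in> S" unfolding open_bop_def by blast
    with \<open>S \<in> K\<close> show "\<exists>n. \<forall>b. b - a \<in> fil n \<longrightarrow> b \<in> \<Union>K" by blast
  qed
next
  fix a :: "'a bop" assume *: "\<And>n. a \<in> fil n"
  have "app a g \<in> vfil n" for g n
    using *[of n] unfolding fil_bop_def by (force dest: spec[of _ 0])
  then show "a = 0" by (intro bop_eqI) (simp add: vfil_separated)
next
  fix U :: "'a bop set"
  show "open U \<longleftrightarrow> (\<forall>a\<in>U. \<exists>n. \<forall>b. b - a \<in> fil n \<longrightarrow> b \<in> U)" by (rule open_bop_def)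
next
  fix a b :: "'a bop" and n
  show "a \<in> fil n \<Longrightarrow> b * a \<in> fil n" by (auto simp: fil_bop_def app_vfil)
  show "a \<in> fil n \<Longrightarrow> a * b \<in> fil n" by (auto simp: fil_bop_def app_vfil)
  show "fil (Suc n) \<subseteq> (fil n :: 'a bop set)" using fil_bop_antimono[of n "Suc n"] by auto
qed (auto simp: fil_bop_def vfil_add vfil_uminus)

end

lift_definition bop_scalar :: "'k::field \<Rightarrow> 'k bop" is vscale
  by (auto simp: filtered_linear_def vfil_scale vscale_commute)

lemma app_scalar [simp]: "app (bop_scalar c) g = vscale c g"
  by transfer simp

lemma fil_bopD: "T \<in> fil n \<Longrightarrow> g \<in> vfil m \<Longrightarrow> app T g \<in> vfil (m + n)"
  by (simp add: fil_bop_def)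

interpretation bop: complete_filtered_algebra "bop_scalar :: 'k::field_char_0 \<Rightarrow> 'k bop"
proof
  fix c d :: 'k and a b :: "'k bop" and m n
  show "bop_scalar (1::'k) = 1" "bop_scalar (c + d) = bop_scalar c + bop_scalar d"
    "bop_scalar (c * d) = bop_scalar c * bop_scalar d" "bop_scalar c * a = a * bop_scalar c"
    by (auto intro!: bop_eqI simp: app_scale vscale_commute)
  show "a \<in> fil 0" by (simp add: fil_bop_def app_vfil)
  assume "a \<in> fil m" "b \<in> fil n"
  then show "a * b \<in> fil (m + n)"
    unfolding fil_bop_def by (auto simp: add.commute add.left_commute)
      (metis add.assoc add.commute)
next
  fix S :: "nat \<Rightarrow> 'k bop" assume S: "S (Suc n) - S n \<in> fil n" for n
  have step: "S (n + k) - S n \<in> fil n" for n k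
  proof (induction k)
    case (Suc k)
    have "S (Suc (n + k)) - S (n + k) \<in> fil n" using S[of "n + k"] fil_antimono[of n "n + k"] by auto
    from fil_trans[OF this Suc] show ?case by simp
  qed (simp add: fil_zero)
  define L where "L g = Abs_bvec (\<lambda>p w. vcoeff (app (S (Suc (length w))) g) p w)" for g
  \<comment> \<open>The bound improves by the degree m of the argument; this makes the convergence
    one of operators and not merely pointwise.\<close>
  have eq: "vcoeff (L g) p w = vcoeff (app (S n) g) p w" if "length w < n + m" "g \<in> vfil m" for g p w n m
  proof -
    have "vcoeff (app (S n) g) p w = vcoeff (app (S (max n (Suc (length w)))) g) p w"
      using fil_bopD[OF step[of n "max n (Suc (length w)) - n"] that(2)] that(1)
      by (simp add: vfil_def add.commute)
    moreover have "vcoeff (L g) p w = vcoeff (app (S (max n (Suc (length w)))) g) p w"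
      using fil_bopD[OF step[of "Suc (length w)" "max n (Suc (length w)) - Suc (length w)"], of g 0]
      by (simp add: vfil_def L_def)
    ultimately show ?thesis by simp
  qed
  have lin: "filtered_linear L"
    unfolding filtered_linear_def
  proof (intro conjI allI ballI)
    show "L (g + h) = L g + L h" for g h by (rule bvec_eqI) (simp add: L_def app_add)
    show "L (vscale c g) = vscale c (L g)" for c g by (rule bvec_eqI) (simp add: L_def app_scale)
    show "L g \<in> vfil m" if "g \<in> vfil m" for g m
      using app_vfil[OF that] by (simp add: vfil_def L_def)
  qed
  then have app_L: "app (Abs_bop L) = L" by (simp add: Abs_bop_inverse)
  have "S n - Abs_bop L \<in> fil N" if "N \<le> n" for n N
    unfolding fil_bop_def
  proof (intro CollectI allI ballI)
    fix m and g :: "'k bvec" assume "g \<in> vfil m"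
    then show "app (S n - Abs_bop L) g \<in> vfil (m + N)"
      using eq[of _ n m g] that by (simp add: app_L vfil_def)
  qed
  then have "S \<longlonglongrightarrow> Abs_bop L" unfolding tendsto_iff_fil by (auto simp: eventually_sequentially)
  then show "\<exists>L. S \<longlonglongrightarrow> L" ..
qed

text \<open>Left multiplication by a letter. Below, \<open>proj0\<close> projects to constant terms,
  \<open>unit p q\<close> is a matrix unit on positions, and \<open>tail l\<close> is a left inverse
  of \<open>prep l\<close>.\<close>

lift_definition prep :: "letter3 \<Rightarrow> 'k::field bop" is
  "\<lambda>l g. Abs_bvec (\<lambda>p w. case w of [] \<Rightarrow> 0 | b # v \<Rightarrow> if b = l then vcoeff g p v else 0)"
  by (auto simp: filtered_linear_def vfil_def intro!: bvec_eqI split: list.splits)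

lift_definition proj0 :: "'k::field bop" is "\<lambda>g. Abs_bvec (\<lambda>p w. if w = [] then vcoeff g p w else 0)"
  by (auto simp: filtered_linear_def vfil_def intro!: bvec_eqI)

lift_definition unit :: "pos \<Rightarrow> pos \<Rightarrow> 'k::field bop" is "\<lambda>p q g. Abs_bvec (\<lambda>r w. if r = p then vcoeff g q w else 0)"
  by (auto simp: filtered_linear_def vfil_def intro!: bvec_eqI)

lemma app_prep: "vcoeff (app (prep l) g) p w = (case w of [] \<Rightarrow> 0 | b # v \<Rightarrow> if b = l then vcoeff g p v else 0)"
  and app_proj0: "vcoeff (app proj0 g) p w = (if w = [] then vcoeff g p w else 0)"
  and app_unit: "vcoeff (app (unit p q) g) r w = (if r = p then vcoeff g q w else 0)"
  by (simp_all add: prep.rep_eq proj0.rep_eq unit.rep_eq)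

lift_definition tail :: "letter3 \<Rightarrow> 'k bvec \<Rightarrow> 'k::field bvec" is "\<lambda>l g p w. g p (l # w)" .

lemma vcoeff_tail [simp]: "vcoeff (tail l g) p w = vcoeff g p (l # w)"
  by transfer simp

lemma tail_simps: "tail l (g + h) = tail l g + tail l h" "tail l (vscale c g) = vscale c (tail l g)"
  "tail l (app (prep m) g) = (if l = m then g else 0)" "tail l (app proj0 g) = 0"
  by (auto intro!: bvec_eqI simp: app_prep app_proj0)

lemma proj0_prep: "app proj0 (app (prep l) g) = 0" and proj0_proj0: "app proj0 (app proj0 g) = app proj0 g"
  by (auto intro!: bvec_eqI simp: app_prep app_proj0)

lemma tail_vfil: "g \<in> vfil (Suc n) \<Longrightarrow> tail l g \<in> vfil n"
  by (auto simp: vfil_def)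

lemma bvec_decompose: "g = app proj0 g + (\<Sum>l\<in>UNIV. app (prep l) (tail l g))"
proof (rule bvec_eqI)
  fix p w
  show "vcoeff g p w = vcoeff (app proj0 g + (\<Sum>l\<in>UNIV. app (prep l) (tail l g))) p w"
  proof (cases w)
    case (Cons l v)
    then show ?thesis by (cases l) (simp_all add: UNIV_letter3 app_prep app_proj0)
  qed (simp add: UNIV_letter3 app_prep app_proj0)
qed

section \<open>Substitution operators on noncommutative series\<close>

lemma prep_fil: "prep l \<in> fil 1"
  by (auto simp: fil_bop_def vfil_def app_prep split: list.splits)

lemma vfil_sum: "(\<And>i. i \<in> A \<Longrightarrow> g i \<in> vfil n) \<Longrightarrow> sum g A \<in> vfil n"
  by (induction A rule: infinite_finite_induct) (auto simp: vfil_add)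

text \<open>Replaces every letter l of a word by the operator \<open>\<theta> l\<close>, with words
  of length n or more cut off.\<close>

fun subst_iter :: "(letter3 \<Rightarrow> 'k::field bop) \<Rightarrow> nat \<Rightarrow> 'k bvec \<Rightarrow> 'k bvec" where
  "subst_iter \<theta> 0 g = 0"
| "subst_iter \<theta> (Suc n) g = app proj0 g + (\<Sum>l\<in>UNIV. app (\<theta> l) (subst_iter \<theta> n (tail l g)))"

lemma subst_iter_linear:
  "subst_iter \<theta> n (g + h) = subst_iter \<theta> n g + subst_iter \<theta> n h"
  "subst_iter \<theta> n (vscale c g) = vscale c (subst_iter \<theta> n g)"
  by (induction n arbitrary: g h)
    (auto simp: tail_simps app_add app_scale sum.distrib UNIV_letter3 algebra_simps)

text \<open>Each \<open>\<theta> l\<close> raises degrees, so the truncated substitutions stabilise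
  in every degree. The images may be arbitrary operators, not only left multiplications.\<close>

lemma exists_substitution:
  fixes \<theta> :: "letter3 \<Rightarrow> 'k::field_char_0 bop"
  assumes \<theta>: "\<And>l. \<theta> l \<in> fil 1"
  shows "\<exists>T. T * proj0 = proj0 \<and> (\<forall>l. T * prep l = \<theta> l * T)"
proof -
  have fil: "subst_iter \<theta> n g \<in> vfil m" if "g \<in> vfil m" for n m g
    using that
  proof (induction n arbitrary: m g)
    case (Suc n)
    have "app (\<theta> l) (subst_iter \<theta> n (tail l g)) \<in> vfil m" for l
    proof (cases m)
      case (Suc k)
      then show ?thesis using fil_bopD[OF \<theta>[of l] Suc.IH[of "tail l g" k]] tail_vfil[of g k l] Suc.prems by simp
    qed simp
    then show ?case using Suc.prems by (simp add: vfil_add vfil_sum app_vfil)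
  qed simp
  have step: "subst_iter \<theta> (Suc n) g - subst_iter \<theta> n g \<in> vfil n" for n g
  proof (induction n arbitrary: g)
    case (Suc n)
    have "subst_iter \<theta> (Suc (Suc n)) g - subst_iter \<theta> (Suc n) g
      = (\<Sum>l\<in>UNIV. app (\<theta> l) (subst_iter \<theta> (Suc n) (tail l g) - subst_iter \<theta> n (tail l g)))"
      by (subst (1 2) subst_iter.simps(2)) (simp only: app_diff sum_subtractf add_diff_cancel_left)
    moreover have "app (\<theta> l) (subst_iter \<theta> (Suc n) (tail l g) - subst_iter \<theta> n (tail l g)) \<in> vfil (Suc n)" for l
      using fil_bopD[OF \<theta>[of l] Suc[of "tail l g"]] by simp
    ultimately show ?case by (simp only: vfil_sum)
  qed simp
  have steps: "subst_iter \<theta> (n + k) g - subst_iter \<theta> n g \<in> vfil n" for n k g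
  proof (induction k)
    case (Suc k)
    have "subst_iter \<theta> (Suc (n + k)) g - subst_iter \<theta> (n + k) g \<in> vfil n"
      using vfil_antimono[OF step[of "n + k"]] by simp
    from vfil_add[OF this Suc] show ?case by simp
  qed simp
  define T where "T g = Abs_bvec (\<lambda>p w. vcoeff (subst_iter \<theta> (Suc (length w)) g) p w)" for g
  have T: "T g - subst_iter \<theta> n g \<in> vfil n" for g n
  proof -
    have "vcoeff (T g) p w = vcoeff (subst_iter \<theta> n g) p w" if "length w < n" for p w
      using steps[of "Suc (length w)" "n - Suc (length w)" g] that by (simp add: vfil_def T_def)
    then show ?thesis by (simp add: vfil_def)
  qed
  have "filtered_linear T"
    unfolding filtered_linear_def
  proof (intro conjI allI ballI)
    show "T (g + h) = T g + T h" for g h by (rule bvec_eqI) (simp add: T_def subst_iter_linear del: subst_iter.simps)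
    show "T (vscale c g) = vscale c (T g)" for c g
      by (rule bvec_eqI) (simp add: T_def subst_iter_linear del: subst_iter.simps)
    show "T g \<in> vfil m" if "g \<in> vfil m" for g m
      using fil[OF that] by (simp add: vfil_def T_def del: subst_iter.simps)
  qed
  then have app_T: "app (Abs_bop T) = T" by (simp add: Abs_bop_inverse)
  \<comment> \<open>The recursion of \<open>subst_iter\<close> survives in the limit and contains
    both required identities.\<close>
  have rec: "T g = app proj0 g + (\<Sum>l\<in>UNIV. app (\<theta> l) (T (tail l g)))" for g
  proof -
    have "T g - (app proj0 g + (\<Sum>l\<in>UNIV. app (\<theta> l) (T (tail l g)))) \<in> vfil n" for n
    proof -
      have "subst_iter \<theta> (Suc n) g - (app proj0 g + (\<Sum>l\<in>UNIV. app (\<theta> l) (T (tail l g))))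
        = - (\<Sum>l\<in>UNIV. app (\<theta> l) (T (tail l g) - subst_iter \<theta> n (tail l g)))"
        by (simp add: app_diff sum_subtractf)
      moreover have "\<dots> \<in> vfil n"
        using T by (intro vfil_uminus vfil_sum app_vfil)
      ultimately have *: "subst_iter \<theta> (Suc n) g - (app proj0 g + (\<Sum>l\<in>UNIV. app (\<theta> l) (T (tail l g)))) \<in> vfil n"
        by simp
      have "T g - subst_iter \<theta> (Suc n) g \<in> vfil n" using vfil_antimono[OF T[of g "Suc n"]] by simp
      from vfil_trans[OF this *] show ?thesis .
    qed
    then show ?thesis using vfil_separated by (metis eq_iff_diff_eq_0)
  qed
  have T0: "T 0 = 0" using app_0[of "Abs_bop T"] by (simp add: app_T)
  show ?thesis
  proof (intro exI[of _ "Abs_bop T"] conjI allI bop_eqI)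
    show "app (Abs_bop T * proj0) g = app proj0 g" for g
      by (simp add: app_T rec[of "app proj0 g"] tail_simps T0 proj0_proj0)
    show "app (Abs_bop T * prep l) g = app (\<theta> l * Abs_bop T) g" for l g
      by (cases l) (simp_all add: app_T rec[of "app (prep _) g"] tail_simps T0 proj0_prep UNIV_letter3)
  qed
qed

definition subst_op :: "(letter3 \<Rightarrow> 'k bop) \<Rightarrow> 'k::field_char_0 bop" where
  "subst_op \<theta> = (SOME T. T * proj0 = proj0 \<and> (\<forall>l. T * prep l = \<theta> l * T))"

lemma subst_op:
  assumes "\<And>l. \<theta> l \<in> fil 1"
  shows "subst_op \<theta> * proj0 = proj0" "subst_op \<theta> * prep l = \<theta> l * subst_op \<theta>"
  using someI_ex[OF exists_substitution[OF assms]] by (auto simp: subst_op_def)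

text \<open>The difference kills constants and is moved past each leading letter by an operator of
  positive degree, so its values lie in every \<open>vfil n\<close>. This reduces relations between
  substitutions to their effect on letters.\<close>

lemma intertwiner_unique:
  fixes \<theta> :: "letter3 \<Rightarrow> 'k::field_char_0 bop"
  assumes \<theta>: "\<And>l. \<theta> l \<in> fil 1" and S: "\<And>l. S * prep l = \<theta> l * S"
    and T: "\<And>l. T * prep l = \<theta> l * T" and eq: "S * proj0 = T * proj0"
  shows "S = T"
proof -
  define D where "D = S - T"
  have D: "app D (app (prep l) g) = app (\<theta> l) (app D g)" "app D (app proj0 g) = 0" for l g
    using arg_cong[OF S[of l], of "\<lambda>U. app U g"] arg_cong[OF T[of l], of "\<lambda>U. app U g"]
      arg_cong[OF eq, of "\<lambda>U. app U g"] by (simp_all add: D_def app_diff)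
  have "app D g \<in> vfil n" for g n
  proof (induction n arbitrary: g)
    case (Suc n)
    have "app D g = app D (app proj0 g + (\<Sum>l\<in>UNIV. app (prep l) (tail l g)))"
      using bvec_decompose[of g] by simp
    also have "\<dots> = (\<Sum>l\<in>UNIV. app (\<theta> l) (app D (tail l g)))" by (simp add: app_add app_sum D)
    also have "\<dots> \<in> vfil (Suc n)" using fil_bopD[OF \<theta> Suc] by (intro vfil_sum) simp
    finally show ?case .
  qed simp
  then have "D = 0" by (intro bop_eqI) (simp add: vfil_separated)
  then show ?thesis by (simp add: D_def)
qed

text \<open>From (S - 1) l = (theta_l - l) S + l (S - 1) the gain of one degree propagates by
  stripping off leading letters.\<close>

lemma intertwiner_unipotent:
  fixes \<theta> :: "letter3 \<Rightarrow> 'k::field_char_0 bop"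
  assumes \<theta>: "\<And>l. \<theta> l - prep l \<in> fil 2" and S: "\<And>l. S * prep l = \<theta> l * S" and S0: "S * proj0 = proj0"
  shows "S - 1 \<in> fil 1"
proof -
  have D: "app (S - 1) (app (prep l) g) = app (\<theta> l - prep l) (app S g) + app (prep l) (app (S - 1) g)"
    "app (S - 1) (app proj0 g) = 0" for l g
    using arg_cong[OF S[of l], of "\<lambda>U. app U g"] arg_cong[OF S0, of "\<lambda>U. app U g"]
    by (simp_all add: app_diff)
  have "app (S - 1) g \<in> vfil (Suc m)" if "g \<in> vfil m" for g m
    using that
  proof (induction m arbitrary: g)
    case 0
    have "app (S - 1) g = app (S - 1) (app proj0 g + (\<Sum>l\<in>UNIV. app (prep l) (tail l g)))"
      using bvec_decompose[of g] by simp
    also have "\<dots> = (\<Sum>l\<in>UNIV. app (\<theta> l - prep l) (app S (tail l g)) + app (prep l) (app (S - 1) (tail l g)))"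
      by (simp only: app_add app_sum D add_0)
    also have "\<dots> \<in> vfil (Suc 0)"
      using fil_bopD[OF \<theta>, of _ 0] fil_bopD[OF prep_fil, of _ 0]
      by (intro vfil_sum vfil_add) (auto intro: vfil_antimono simp: vfil_0)
    finally show ?case .
  next
    case (Suc m)
    have "app (S - 1) g = app (S - 1) (app proj0 g + (\<Sum>l\<in>UNIV. app (prep l) (tail l g)))"
      using bvec_decompose[of g] by simp
    also have "\<dots> = (\<Sum>l\<in>UNIV. app (\<theta> l - prep l) (app S (tail l g)) + app (prep l) (app (S - 1) (tail l g)))"
      by (simp only: app_add app_sum D add_0)
    also have "\<dots> \<in> vfil (Suc (Suc m))"
    proof (intro vfil_sum vfil_add)
      fix l
      have "tail l g \<in> vfil m" using Suc.prems by (rule tail_vfil)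
      then show "app (\<theta> l - prep l) (app S (tail l g)) \<in> vfil (Suc (Suc m))"
        "app (prep l) (app (S - 1) (tail l g)) \<in> vfil (Suc (Suc m))"
        using fil_bopD[OF \<theta>[of l] app_vfil[of "tail l g" m S]] fil_bopD[OF prep_fil[of l] Suc.IH[of "tail l g"]]
        by simp_all
    qed
    finally show ?case .
  qed
  then show ?thesis by (simp add: fil_bop_def)
qed

lemma unit_mult: "unit p q * unit r s = (if q = r then unit p s else 0)"
  and unit_prep: "prep l * unit p q = unit p q * prep l"
  and unit_proj0: "proj0 * unit p q = unit p q * proj0"
  by (auto intro!: bop_eqI bvec_eqI simp: app_unit app_prep app_proj0 split: list.splits)

lemma sum_unit: "unit P1 P1 + unit P2 P2 + unit P3 P3 + unit P4 P4 = 1"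
proof (intro bop_eqI bvec_eqI)
  fix g :: "'a bvec" and p w
  show "vcoeff (app (unit P1 P1 + unit P2 P2 + unit P3 P3 + unit P4 P4) g) p w = vcoeff (app 1 g) p w"
    by (cases p) (simp_all add: app_unit)
qed

lemma unit_subst_op:
  assumes \<theta>: "\<And>l. \<theta> l \<in> fil 1" and comm: "\<And>l. \<theta> l * unit p q = unit p q * \<theta> l"
  shows "subst_op \<theta> * unit p q = unit p q * subst_op \<theta>"
proof (rule intertwiner_unique[OF \<theta>])
  fix l
  show "subst_op \<theta> * unit p q * prep l = \<theta> l * (subst_op \<theta> * unit p q)"
    using subst_op(2)[of \<theta> l, OF \<theta>] by (simp only: mult.assoc unit_prep[symmetric]) (simp only: mult.assoc[symmetric])
  show "unit p q * subst_op \<theta> * prep l = \<theta> l * (unit p q * subst_op \<theta>)"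
    using subst_op(2)[of \<theta> l, OF \<theta>] by (simp only: mult.assoc) (simp only: mult.assoc[symmetric] comm)
  show "subst_op \<theta> * unit p q * proj0 = unit p q * subst_op \<theta> * proj0"
    using subst_op(1)[of \<theta>, OF \<theta>] by (simp only: mult.assoc unit_proj0[symmetric]) (simp only: mult.assoc[symmetric])
qed

text \<open>
  The module is induced from the trivial representation of the group of braids on the last three
  strings: \<open>P\<^sub>i\<close> records the position of the first string, and \<open>1 + prep l\<close> for \<open>l = LA, LB, LC\<close> are
  the generators \<open>x\<^sub>1\<^sub>2, x\<^sub>1\<^sub>3, x\<^sub>1\<^sub>4\<close> of the free group formed by the braids in which only the first
  string moves. The operators \<open>twist1\<close>, \<open>twist2\<close> are the Artin action on that free group.
\<close>

definition gen :: "letter3 \<Rightarrow> 'k::field_char_0 bop" where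
  "gen l = 1 + prep l"

definition gen_inv :: "letter3 \<Rightarrow> 'k::field_char_0 bop" where
  "gen_inv l = alg_pow bop_scalar (gen l) (- 1)"

lemma gen_unipotent: "gen l - 1 \<in> fil 1"
  by (simp add: gen_def prep_fil del: One_nat_def)

lemma gen_inverse [simp]: "gen l * gen_inv l = 1" "gen_inv l * gen l = 1"
  unfolding gen_inv_def by (intro bop.unipotent_inverse gen_unipotent)+

lemma gen_inverse_assoc [simp]: "gen l * (gen_inv l * z) = z" "gen_inv l * (gen l * z) = z"
  by (simp_all flip: mult.assoc)

lemma prep_conv_gen: "prep l = gen l - 1"
  by (simp add: gen_def)

text \<open>The conjugated generator may be written with \<open>prep LA\<close>: conjugating
  \<open>1 + prep LA\<close> conjugates \<open>prep LA\<close>. With the first string in position 1,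
  sigma_2 acts by \<open>twist1\<close> and sigma_3 by \<open>twist2\<close>.\<close>

definition twist1 :: "'k::field_char_0 bop" where
  "twist1 = subst_op (case_letter3 (prep LB) (gen_inv LB * prep LA * gen LB) (prep LC))"

definition twist2 :: "'k::field_char_0 bop" where
  "twist2 = subst_op (case_letter3 (prep LA) (prep LC) (gen_inv LC * prep LB * gen LC))"

lemma fil_case_letter3:
  "a \<in> fil n \<Longrightarrow> b \<in> fil n \<Longrightarrow> c \<in> fil n \<Longrightarrow> case_letter3 a b c l \<in> fil n"
  by (cases l) auto

lemma twist_fil:
  "case_letter3 (prep LB) (gen_inv LB * prep LA * gen LB) (prep LC) l \<in> fil 1"
  "case_letter3 (prep LA) (prep LC) (gen_inv LC * prep LB * gen LC) l \<in> fil 1"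
  by (intro fil_case_letter3 fil_mult_left fil_mult_right prep_fil)+

lemma twist_proj0: "twist1 * proj0 = proj0" "twist2 * proj0 = proj0"
  unfolding twist1_def twist2_def by (intro subst_op twist_fil)+

lemma twist_prep:
  "twist1 * prep LA = prep LB * twist1" "twist1 * prep LB = gen_inv LB * prep LA * gen LB * twist1" "twist1 * prep LC = prep LC * twist1"
  "twist2 * prep LA = prep LA * twist2" "twist2 * prep LB = prep LC * twist2" "twist2 * prep LC = gen_inv LC * prep LB * gen LC * twist2"
  unfolding twist1_def twist2_def
  by (subst subst_op(2), rule twist_fil, simp)+

lemma twist_gen:
  "twist1 * gen LA = gen LB * twist1" "twist1 * gen LB = gen_inv LB * gen LA * gen LB * twist1" "twist1 * gen LC = gen LC * twist1"
  "twist2 * gen LA = gen LA * twist2" "twist2 * gen LB = gen LC * twist2" "twist2 * gen LC = gen_inv LC * gen LB * gen LC * twist2"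
  using twist_prep by (simp_all add: prep_conv_gen algebra_simps)

lemma intertwine_inverse:
  fixes a a' b b' g :: "'a::ring_1"
  assumes "g * a = b * g" "a * a' = 1" "b' * b = 1"
  shows "g * a' = b' * g"
proof -
  have "b' * (g * a) * a' = b' * (b * g) * a'" using assms(1) by simp
  moreover have "b' * (g * a) * a' = b' * g * (a * a')" "b' * (b * g) * a' = (b' * b) * g * a'"
    by (simp_all only: mult.assoc)
  ultimately show ?thesis using assms(2,3) by simp
qed

lemma twist_gen_inv:
  "twist1 * gen_inv LA = gen_inv LB * twist1" "twist1 * gen_inv LB = gen_inv LB * gen_inv LA * gen LB * twist1" "twist1 * gen_inv LC = gen_inv LC * twist1"
  "twist2 * gen_inv LA = gen_inv LA * twist2" "twist2 * gen_inv LB = gen_inv LC * twist2" "twist2 * gen_inv LC = gen_inv LC * gen_inv LB * gen LC * twist2"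
proof -
  show "twist1 * gen_inv LA = gen_inv LB * twist1"
    by (rule intertwine_inverse[OF twist_gen(1)]) (simp_all add: mult.assoc)
  show "twist1 * gen_inv LB = gen_inv LB * gen_inv LA * gen LB * twist1"
    by (rule intertwine_inverse[OF twist_gen(2)]) (simp_all add: mult.assoc)
  show "twist1 * gen_inv LC = gen_inv LC * twist1"
    by (rule intertwine_inverse[OF twist_gen(3)]) (simp_all add: mult.assoc)
  show "twist2 * gen_inv LA = gen_inv LA * twist2"
    by (rule intertwine_inverse[OF twist_gen(4)]) (simp_all add: mult.assoc)
  show "twist2 * gen_inv LB = gen_inv LC * twist2"
    by (rule intertwine_inverse[OF twist_gen(5)]) (simp_all add: mult.assoc)
  show "twist2 * gen_inv LC = gen_inv LC * gen_inv LB * gen LC * twist2"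
    by (rule intertwine_inverse[OF twist_gen(6)]) (simp_all add: mult.assoc)
qed

lemma assoc_rule: "a * b = c \<Longrightarrow> a * (b * z) = c * (z :: 'a::semigroup_mult)"
  by (simp flip: mult.assoc)

lemmas twist_rules = twist_gen twist_gen_inv twist_gen[THEN assoc_rule] twist_gen_inv[THEN assoc_rule]

lemma gen_intertwiner_unique:
  fixes S T :: "'k::field_char_0 bop"
  assumes "\<And>l. S * gen l = u l * S" "\<And>l. T * gen l = u l * T" "\<And>l. u l - 1 \<in> fil 1"
    and "S * proj0 = proj0" "T * proj0 = proj0"
  shows "S = T"
proof (rule intertwiner_unique[where \<theta> = "\<lambda>l. u l - 1"])
  show "S * prep l = (u l - 1) * S" "T * prep l = (u l - 1) * T" for l
    using assms(1,2)[of l] by (simp_all add: prep_conv_gen algebra_simps)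
qed (use assms in auto)

lemma conj_gen_unipotent: "gen_inv m * gen l * gen m - 1 \<in> fil 1"
proof -
  have eq: "gen_inv m * gen l * gen m - 1 = gen_inv m * (gen l - 1) * gen m" by (simp add: algebra_simps)
  show ?thesis unfolding eq by (intro fil_mult_left fil_mult_right gen_unipotent)
qed

text \<open>Both sides are substitutions with the same images of the three generators;
  \<open>u\<close> lists these common images.\<close>

lemma twist_braid: "twist1 * (twist2 * twist1) = twist2 * (twist1 * twist2)"
proof (rule gen_intertwiner_unique[where u = "case_letter3 (gen LC) (gen_inv LC * gen LB * gen LC)
      (gen_inv LC * (gen_inv LB * gen LA * gen LB) * gen LC)"])
  fix l
  show "twist1 * (twist2 * twist1) * gen l = case_letter3 (gen LC) (gen_inv LC * gen LB * gen LC)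
      (gen_inv LC * (gen_inv LB * gen LA * gen LB) * gen LC) l * (twist1 * (twist2 * twist1))"
    by (cases l) (simp_all add: mult.assoc twist_rules)
  show "twist2 * (twist1 * twist2) * gen l = case_letter3 (gen LC) (gen_inv LC * gen LB * gen LC)
      (gen_inv LC * (gen_inv LB * gen LA * gen LB) * gen LC) l * (twist2 * (twist1 * twist2))"
    by (cases l) (simp_all add: mult.assoc twist_rules)
  have "gen_inv LC * (gen_inv LB * gen LA * gen LB) * gen LC - 1
     = gen_inv LC * (gen_inv LB * gen LA * gen LB - 1) * gen LC"
    by (simp add: algebra_simps)
  also have "\<dots> \<in> fil 1" by (intro fil_mult_left fil_mult_right conj_gen_unipotent)
  finally show "case_letter3 (gen LC) (gen_inv LC * gen LB * gen LC)
      (gen_inv LC * (gen_inv LB * gen LA * gen LB) * gen LC) l - 1 \<in> fil 1"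
    using conj_gen_unipotent gen_unipotent by (cases l) simp_all
qed (simp_all add: mult.assoc twist_proj0)

text \<open>Pure braids send each generator to a conjugate; conjugation by a unipotent element
  changes a letter only in degree 2 and higher.\<close>

lemma twist_square_unipotent:
  "twist1 * twist1 - (1 :: 'k::field_char_0 bop) \<in> fil 1" "twist2 * twist2 - (1 :: 'k bop) \<in> fil 1"
proof -
  have conj: "u * prep l * v - prep l \<in> fil 2" if "u * v = 1" "u - 1 \<in> fil 1" for u v :: "'k bop" and l
  proof -
    have "u * prep l * v - prep l = ((u - 1) * prep l - prep l * (u - 1)) * v"
      using that(1) by (simp add: algebra_simps)
    moreover have "(u - 1) * prep l \<in> fil 2" "prep l * (u - 1) \<in> fil 2"
      using bop.fil_mult[OF that(2) prep_fil] bop.fil_mult[OF prep_fil that(2)] by (simp_all add: numeral_2_eq_2)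
    ultimately show ?thesis by (simp add: fil_diff fil_mult_right)
  qed
  have inv: "gen_inv l - (1 :: 'k bop) \<in> fil 1" for l
    unfolding gen_inv_def by (intro bop.alg_pow_fil gen_unipotent)
  have gg: "gen_inv l * (gen_inv m) * (gen m * gen l) = (1 :: 'k bop)" "gen_inv l * gen_inv m - (1 :: 'k bop) \<in> fil 1" for l m
    by (simp add: mult.assoc) (intro bop.unipotent_mult inv)
  have *: "twist1 * twist1 * (prep l :: 'k bop) = case_letter3 (gen_inv LB * prep LA * gen LB)
      ((gen_inv LB * gen_inv LA) * prep LB * (gen LA * gen LB)) (prep LC) l * (twist1 * twist1)" for l
    by (cases l) (simp_all add: mult.assoc twist_rules prep_conv_gen algebra_simps)
  moreover have **: "case_letter3 (gen_inv LB * prep LA * gen LB)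
      ((gen_inv LB * gen_inv LA) * prep LB * (gen LA * gen LB)) (prep LC) l - (prep l :: 'k bop) \<in> fil 2" for l
    using conj[OF gen_inverse(2)[of LB] inv, of LA] conj[OF gg[of LB LA], of LB]
    by (cases l) (simp_all only: letter3.case diff_self fil_zero)
  ultimately show "twist1 * twist1 - (1 :: 'k bop) \<in> fil 1"
    using intertwiner_unipotent[OF ** *] by (simp only: mult.assoc twist_proj0)
  have *: "twist2 * twist2 * (prep l :: 'k bop) = case_letter3 (prep LA) (gen_inv LC * prep LB * gen LC)
      ((gen_inv LC * gen_inv LB) * prep LC * (gen LB * gen LC)) l * (twist2 * twist2)" for l
    by (cases l) (simp_all add: mult.assoc twist_rules prep_conv_gen algebra_simps)
  moreover have **: "case_letter3 (prep LA) (gen_inv LC * prep LB * gen LC)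
      ((gen_inv LC * gen_inv LB) * prep LC * (gen LB * gen LC)) l - (prep l :: 'k bop) \<in> fil 2" for l
    using conj[OF gen_inverse(2)[of LC] inv, of LB] conj[OF gg[of LC LB], of LC]
    by (cases l) (simp_all only: letter3.case diff_self fil_zero)
  ultimately show "twist2 * twist2 - (1 :: 'k bop) \<in> fil 1"
    using intertwiner_unipotent[OF ** *] by (simp only: mult.assoc twist_proj0)
qed

section \<open>The induced action of the braid generators\<close>

lemma gen_unit: "gen l * unit p q = unit p q * gen l"
  by (simp add: gen_def algebra_simps unit_prep)

lemma gen_inv_unit: "gen_inv l * unit p q = unit p q * gen_inv l"
  by (rule intertwine_inverse[where a = "gen l" and b = "gen l", symmetric]) (simp_all add: gen_unit)

lemma twist_unit: "twist1 * unit p q = unit p q * twist1" "twist2 * unit p q = unit p q * twist2"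
proof -
  note comm = gen_unit gen_inv_unit unit_prep gen_unit[THEN assoc_rule] gen_inv_unit[THEN assoc_rule] unit_prep[THEN assoc_rule]
  show "twist1 * unit p q = unit p q * twist1"
    unfolding twist1_def by (rule unit_subst_op[OF twist_fil(1)]) (simp add: mult.assoc comm split: letter3.split)
  show "twist2 * unit p q = unit p q * twist2"
    unfolding twist2_def by (rule unit_subst_op[OF twist_fil(2)]) (simp add: mult.assoc comm split: letter3.split)
qed

lemma unit_mult_assoc: "unit p q * (unit r s * z) = (if q = r then unit p s * z else 0)"
  by (simp add: unit_mult flip: mult.assoc)

lemmas unit_rules = gen_unit gen_inv_unit twist_unit unit_mult
  gen_unit[THEN assoc_rule] gen_inv_unit[THEN assoc_rule] twist_unit[THEN assoc_rule] unit_mult_assoc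

text \<open>Coset coordinates: position i stands for sigma_(i-1) ... sigma_1. Stepping up costs
  nothing, stepping back costs a generator of the free group; a crossing of two other strings acts
  by the twist for their places among the remaining three.\<close>

definition bs1 :: "'k::field_char_0 bop" where
  "bs1 = unit P2 P1 + unit P1 P2 * gen LA + unit P3 P3 * twist1 + unit P4 P4 * twist1"
definition bs2 :: "'k::field_char_0 bop" where
  "bs2 = unit P1 P1 * twist1 + unit P3 P2 + unit P2 P3 * gen LB + unit P4 P4 * twist2"
definition bs3 :: "'k::field_char_0 bop" where
  "bs3 = unit P1 P1 * twist2 + unit P2 P2 * twist2 + unit P4 P3 + unit P3 P4 * gen LC"

lemma bs_braid: "bs1 * bs3 = bs3 * bs1"
  "bs1 * bs2 * bs1 = bs2 * bs1 * bs2" "bs2 * bs3 * bs2 = bs3 * bs2 * bs3"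
  by (simp_all add: bs1_def bs2_def bs3_def distrib_left distrib_right mult.assoc unit_rules twist_rules twist_braid add_ac)

lemma bs_square_unipotent:
  "bs1 * bs1 - (1 :: 'k::field_char_0 bop) \<in> fil 1" "bs2 * bs2 - (1 :: 'k bop) \<in> fil 1" "bs3 * bs3 - (1 :: 'k bop) \<in> fil 1"
proof -
  have "(bs1 * bs1 :: 'k bop) = unit P1 P1 * gen LA + unit P2 P2 * gen LA + unit P3 P3 * (twist1 * twist1) + unit P4 P4 * (twist1 * twist1)"
    by (simp add: bs1_def distrib_left distrib_right mult.assoc unit_rules add_ac)
  then have *: "(bs1 * bs1 :: 'k bop) - (unit P1 P1 + unit P2 P2 + unit P3 P3 + unit P4 P4) = unit P1 P1 * (gen LA - 1)
      + unit P2 P2 * (gen LA - 1)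
      + unit P3 P3 * ((twist1 * twist1) - 1)
      + unit P4 P4 * ((twist1 * twist1) - 1)"
    by (simp add: right_diff_distrib)
  have "(bs1 * bs1 :: 'k bop) - (unit P1 P1 + unit P2 P2 + unit P3 P3 + unit P4 P4) \<in> fil 1"
    unfolding * by (intro fil_add fil_mult_left gen_unipotent twist_square_unipotent)
  then show "bs1 * bs1 - (1 :: 'k bop) \<in> fil 1" unfolding sum_unit .
  have "(bs2 * bs2 :: 'k bop) = unit P1 P1 * (twist1 * twist1) + unit P2 P2 * gen LB + unit P3 P3 * gen LB + unit P4 P4 * (twist2 * twist2)"
    by (simp add: bs2_def distrib_left distrib_right mult.assoc unit_rules add_ac)
  then have *: "(bs2 * bs2 :: 'k bop) - (unit P1 P1 + unit P2 P2 + unit P3 P3 + unit P4 P4) = unit P1 P1 * ((twist1 * twist1) - 1)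
      + unit P2 P2 * (gen LB - 1)
      + unit P3 P3 * (gen LB - 1)
      + unit P4 P4 * ((twist2 * twist2) - 1)"
    by (simp add: right_diff_distrib)
  have "(bs2 * bs2 :: 'k bop) - (unit P1 P1 + unit P2 P2 + unit P3 P3 + unit P4 P4) \<in> fil 1"
    unfolding * by (intro fil_add fil_mult_left gen_unipotent twist_square_unipotent)
  then show "bs2 * bs2 - (1 :: 'k bop) \<in> fil 1" unfolding sum_unit .
  have "(bs3 * bs3 :: 'k bop) = unit P1 P1 * (twist2 * twist2) + unit P2 P2 * (twist2 * twist2) + unit P3 P3 * gen LC + unit P4 P4 * gen LC"
    by (simp add: bs3_def distrib_left distrib_right mult.assoc unit_rules add_ac)
  then have *: "(bs3 * bs3 :: 'k bop) - (unit P1 P1 + unit P2 P2 + unit P3 P3 + unit P4 P4) = unit P1 P1 * ((twist2 * twist2) - 1)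
      + unit P2 P2 * ((twist2 * twist2) - 1)
      + unit P3 P3 * (gen LC - 1)
      + unit P4 P4 * (gen LC - 1)"
    by (simp add: right_diff_distrib)
  have "(bs3 * bs3 :: 'k bop) - (unit P1 P1 + unit P2 P2 + unit P3 P3 + unit P4 P4) \<in> fil 1"
    unfolding * by (intro fil_add fil_mult_left gen_unipotent twist_square_unipotent)
  then show "bs3 * bs3 - (1 :: 'k bop) \<in> fil 1" unfolding sum_unit .
qed

definition e1 :: "'k::field_char_0 bvec" where
  "e1 = Abs_bvec (\<lambda>p w. if p = P1 \<and> w = [] then 1 else 0)"

text \<open>On polynomials in x12 - 1, x13 - 1, x14 - 1 this reads off coefficients, since at
  \<open>P1\<close> these act as left multiplication by letters.\<close>

definition coef :: "'k::field_char_0 bop \<Rightarrow> letter3 list \<Rightarrow> 'k" where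
  "coef T u = vcoeff (app T e1) P1 u"

lemma coef_simps:
  "coef 0 u = 0" "coef (S + T) u = coef S u + coef T u" "coef (S - T) u = coef S u - coef T u"
  "coef (bop_scalar c * T) u = c * coef T u"
  by (simp_all add: coef_def)

lemma coef_sum: "coef (sum T A) u = (\<Sum>i\<in>A. coef (T i) u)"
  by (induction A rule: infinite_finite_induct) (auto simp: coef_simps)

lemma coef_fil: "T \<in> fil n \<Longrightarrow> length u < n \<Longrightarrow> coef T u = 0"
  using fil_bopD[of T n e1 0] by (simp add: coef_def vfil_def)

lemma unit_e1: "app (unit P1 P1) e1 = e1"
  by (rule bvec_eqI) (simp add: app_unit e1_def)

lemma coef_unit: "coef (T * unit P1 P1) u = coef T u"
  by (simp add: coef_def unit_e1)

text \<open>At position \<open>P1\<close> each operator multiplies by the sum of the letters in its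
  set, so a product expands into all words formed by one choice per factor, each occurring
  once.\<close>

lemma word_eval_unit:
  fixes a b :: "'k::field_char_0 bop"
  assumes "a * unit P1 P1 = unit P1 P1 * sum prep A" "b * unit P1 P1 = unit P1 P1 * sum prep B"
  shows "coef (word_eval a b w) u
    = (if list_all2 (\<lambda>l m. m \<in> case_letter A B l) w u then 1 else 0)"
proof (induction w arbitrary: u)
  case Nil
  show ?case by (cases u) (simp_all add: coef_def e1_def)
next
  case (Cons l w)
  define c where "c = case_letter a b l"
  define C where "C = case_letter A B l"
  have c: "c * unit P1 P1 = unit P1 P1 * sum prep C" using assms by (cases l) (auto simp: c_def C_def)
  have "finite (UNIV :: letter3 set)" by (simp add: UNIV_letter3)
  then have fin: "finite C" using finite_subset[OF subset_UNIV] by blast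
  \<comment> \<open>The block at \<open>P1\<close> is stable, so the hypotheses can be applied again
    to the next factor.\<close>
  have inv: "word_eval a b w * unit P1 P1 = unit P1 P1 * word_eval a b w * unit P1 P1" for w
  proof (induction w)
    case (Cons l w)
    have *: "case_letter a b l * unit P1 P1 = unit P1 P1 * sum prep (case_letter A B l)" using assms by (cases l) auto
    have idem: "unit P1 P1 * (unit P1 P1 * z) = unit P1 P1 * (z :: 'k bop)" for z by (simp add: unit_mult flip: mult.assoc)
    have "word_eval a b (l # w) * unit P1 P1 = case_letter a b l * unit P1 P1 * (word_eval a b w * unit P1 P1)"
      using Cons by (simp add: word_eval_Cons mult.assoc)
    also have "\<dots> = unit P1 P1 * (case_letter a b l * unit P1 P1 * (word_eval a b w * unit P1 P1))"
      unfolding * by (simp add: mult.assoc idem)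
    also have "\<dots> = unit P1 P1 * word_eval a b (l # w) * unit P1 P1"
      using Cons by (simp add: word_eval_Cons mult.assoc)
    finally show ?case .
  qed (simp add: unit_mult)
  have "coef (word_eval a b (l # w)) u = coef (c * (word_eval a b w * unit P1 P1)) u"
    by (simp add: word_eval_Cons c_def coef_unit flip: mult.assoc)
  also have "\<dots> = coef (c * unit P1 P1 * (word_eval a b w * unit P1 P1)) u"
    by (subst inv) (simp only: mult.assoc)
  also have "\<dots> = coef (unit P1 P1 * sum prep C * word_eval a b w) u"
    unfolding c by (simp only: coef_unit mult.assoc[symmetric])
  also have "\<dots> = (\<Sum>m\<in>C. vcoeff (app (prep m) (app (word_eval a b w) e1)) P1 u)"
    by (simp add: coef_def app_unit sum_distrib_right sum_distrib_left app_sum)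
      (induction C rule: infinite_finite_induct; simp add: app_unit)
  also have "\<dots> = (if list_all2 (\<lambda>l m. m \<in> case_letter A B l) (l # w) u then 1 else 0)"
  proof (cases u)
    case (Cons m v)
    have "(\<Sum>m'\<in>C. vcoeff (app (prep m') (app (word_eval a b w) e1)) P1 u)
       = (\<Sum>m'\<in>C. if m = m' then coef (word_eval a b w) v else 0)"
      by (intro sum.cong HOL.refl) (simp add: app_prep Cons coef_def)
    then show ?thesis by (simp add: Cons.IH Cons C_def fin[unfolded C_def])
  qed (simp add: app_prep)
  finally show ?case .
qed

section \<open>Homomorphisms from the completed group algebra\<close>

lemma aug_power_times: "aug_power m a \<Longrightarrow> aug_power n b \<Longrightarrow> aug_power (m + n) (a * b)"
proof (induction rule: aug_power.induct)
  case (aug_power_0 u)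
  then show ?case by (simp add: aug_power_mult_left)
qed (auto simp: mult.assoc distrib_right intro: aug_power.intros)

lemma aug_power_le:
  assumes "m \<le> n" shows "aug_power n a \<Longrightarrow> aug_power m a"
  using assms
proof (induction n rule: dec_induct)
  case (step n)
  then show ?case using aug_power_Suc[of "Suc n" a n] by blast
qed

lemma compl_rel_diff:
  assumes "compl_rel u u" "m \<le> n" shows "aug_power m (u n - u m)"
  using assms(2)
proof (induction n rule: dec_induct)
  case (step n)
  have "aug_power m (u (Suc n) - u n)" using assms(1) step(1) aug_power_le[of m n] by (auto simp: compl_rel_def)
  from aug_power_add[OF this step.IH] show ?case by simp
qed (simp add: aug_power_zero)

lemma fil_compl_abs:
  "compl_rel u u \<Longrightarrow> abs_compl_alg u \<in> fil n \<longleftrightarrow> aug_power n (u n)"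
  by (simp add: fil_compl_alg_def in_fil_compl.abs_eq)

lemma compl_rel_closed:
  "compl_rel u u \<Longrightarrow> compl_rel v v \<Longrightarrow> compl_rel (\<lambda>n. u n * v n) (\<lambda>n. u n * v n)"
  "compl_rel u u \<Longrightarrow> compl_rel v v \<Longrightarrow> compl_rel (\<lambda>n. u n - v n) (\<lambda>n. u n - v n)"
  using times_compl_alg.rsp minus_compl_alg.rsp unfolding rel_fun_def by blast+

lemma group_algebra_const_comm:
  fixes u :: "'g::group_add \<Rightarrow>\<^sub>0 'k::field"
  shows "Poly_Mapping.single 0 c * u = u * Poly_Mapping.single 0 c"
  by (subst (1 2) group_algebra_expand[of u])
    (simp add: sum_distrib_left sum_distrib_right mult_single mult.commute)

interpretation compl: complete_filtered_algebra "compl_const :: 'k::field_char_0 \<Rightarrow> ('g::group_add, 'k) compl_alg"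
proof
  fix c d :: 'k and a b :: "('g, 'k) compl_alg" and m n
  note eqs = compl_const.abs_eq one_compl_alg.abs_eq plus_compl_alg.abs_eq times_compl_alg.abs_eq compl_rel_const
  show "compl_const (1::'k) = (1 :: ('g, 'k) compl_alg)"
    "compl_const (c + d) = (compl_const c + compl_const d :: ('g, 'k) compl_alg)"
    "compl_const (c * d) = (compl_const c * compl_const d :: ('g, 'k) compl_alg)"
    by (simp_all add: eqs single_add mult_single)
  obtain u where u: "compl_rel u u" "a = abs_compl_alg u" by (rule compl_alg_cases)
  obtain v where v: "compl_rel v v" "b = abs_compl_alg v" by (rule compl_alg_cases)
  show "compl_const c * a = a * compl_const c"
    by (simp add: eqs u group_algebra_const_comm)
  show "a \<in> fil 0" by (simp add: u fil_compl_abs aug_power_0)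
  assume a: "a \<in> fil m" and b: "b \<in> fil n"
  have "aug_power m (u (m + n))"
    using aug_power_add[OF compl_rel_diff[OF u(1), of m "m + n"], of "u m"] a u by (simp add: fil_compl_abs)
  moreover have "aug_power n (v (m + n))"
    using aug_power_add[OF compl_rel_diff[OF v(1), of n "m + n"], of "v n"] b v by (simp add: fil_compl_abs)
  ultimately show "a * b \<in> fil (m + n)"
    by (simp add: u v times_compl_alg.abs_eq fil_compl_abs compl_rel_closed aug_power_times)
next
  fix S :: "nat \<Rightarrow> ('g, 'k) compl_alg" assume S: "S (Suc n) - S n \<in> fil n" for n
  have "\<forall>n. \<exists>u. compl_rel u u \<and> S n = abs_compl_alg u" by (metis compl_alg_cases)
  then obtain u where u: "\<And>n. compl_rel (u n) (u n)" "\<And>n. S n = abs_compl_alg (u n)" by metis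
  \<comment> \<open>Diagonal sequence: modulo the n-th power of the augmentation ideal the limit is
    represented by the n-th entry of the n-th family.\<close>
  define v where "v n = u n n" for n
  have "aug_power n (u (Suc n) n - u n n)" for n
    using S[of n] by (simp add: u minus_compl_alg.abs_eq fil_compl_abs compl_rel_closed)
  then have "aug_power n (v (Suc n) - v n)" for n
    using aug_power_add[OF compl_rel_diff[OF u(1), of n "Suc n" "Suc n"]] by (fastforce simp: v_def)
  then have v: "compl_rel v v" by (simp add: compl_rel_def aug_power_zero)
  have "S n - abs_compl_alg v \<in> fil n" for n
    by (simp add: u v minus_compl_alg.abs_eq fil_compl_abs compl_rel_closed v_def[of n] aug_power_zero)
  then have "S \<longlonglongrightarrow> abs_compl_alg v"
    unfolding tendsto_iff_fil eventually_sequentially using fil_antimono by blast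
  then show "\<exists>L. S \<longlonglongrightarrow> L" ..
qed

locale unipotent_rep = complete_filtered_algebra \<iota>
  for \<iota> :: "'k::field_char_0 \<Rightarrow> 'a::filtered_ring" +
  fixes \<rho> :: "'g::group_add \<Rightarrow> 'a"
  assumes rep_add: "\<rho> (g + h) = \<rho> g * \<rho> h" and rep_zero: "\<rho> 0 = 1" and rep_fil: "\<rho> g - 1 \<in> fil 1"
begin

definition lin :: "('g \<Rightarrow>\<^sub>0 'k) \<Rightarrow> 'a" where
  "lin u = (\<Sum>g\<in>Poly_Mapping.keys u. \<iota> (Poly_Mapping.lookup u g) * \<rho> g)"

lemma lin_superset:
  "finite A \<Longrightarrow> Poly_Mapping.keys u \<subseteq> A \<Longrightarrow> lin u = (\<Sum>g\<in>A. \<iota> (Poly_Mapping.lookup u g) * \<rho> g)"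
  unfolding lin_def by (intro sum.mono_neutral_left) (auto simp: in_keys_iff)

lemma lin_add: "lin (u + v) = lin u + lin v"
proof -
  let ?A = "Poly_Mapping.keys u \<union> Poly_Mapping.keys v"
  have "lin (u + v) = (\<Sum>g\<in>?A. \<iota> (Poly_Mapping.lookup (u + v) g) * \<rho> g)"
    using keys_add[of u v] by (intro lin_superset) auto
  moreover have "lin u = (\<Sum>g\<in>?A. \<iota> (Poly_Mapping.lookup u g) * \<rho> g)"
    by (intro lin_superset) auto
  moreover have "lin v = (\<Sum>g\<in>?A. \<iota> (Poly_Mapping.lookup v g) * \<rho> g)"
    by (intro lin_superset) auto
  ultimately show ?thesis by (simp add: lookup_add scalar_add distrib_right sum.distrib)
qed

lemma lin_zero [simp]: "lin 0 = 0" and lin_single [simp]: "lin (Poly_Mapping.single g c) = \<iota> c * \<rho> g"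
  by (simp_all add: lin_def)

lemma lin_sum: "lin (\<Sum>i\<in>A. u i) = (\<Sum>i\<in>A. lin (u i))"
  by (induction A rule: infinite_finite_induct) (simp_all add: lin_add)

lemma lin_uminus: "lin (- u) = - lin u"
  using lin_add[of u "- u"] by (simp add: eq_neg_iff_add_eq_0 add.commute)

lemma lin_diff: "lin (u - v) = lin u - lin v"
  using lin_add[of u "- v"] by (simp add: lin_uminus)

lemma lin_mult: "lin (u * v) = lin u * lin v"
proof -
  have prod: "u * v = (\<Sum>g\<in>Poly_Mapping.keys u. \<Sum>h\<in>Poly_Mapping.keys v.
      Poly_Mapping.single (g + h) (Poly_Mapping.lookup u g * Poly_Mapping.lookup v h))"
    using arg_cong2[OF group_algebra_expand[of u] group_algebra_expand[of v], of "(*)"]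
    by (simp only: sum_product mult_single)
  have single_mult: "\<iota> (c * d) * \<rho> (g + h) = \<iota> c * \<rho> g * (\<iota> d * \<rho> h)" for c d g h
    by (simp only: scalar_mult rep_add mult.assoc scalar_lcomm[of "\<rho> g"])
  show ?thesis
    by (simp only: prod lin_sum lin_single single_mult) (simp only: lin_def sum_product)
qed

lemma lin_fil: "aug_power n u \<Longrightarrow> lin u \<in> fil n"
proof (induction rule: aug_power.induct)
  case (aug_power_mult a n b)
  \<comment> \<open>Augmentation zero allows subtracting 1 from every \<open>\<rho> g\<close>, which
    exposes an element of degree 1.\<close>
  have "lin a = (\<Sum>g\<in>Poly_Mapping.keys a. \<iota> (Poly_Mapping.lookup a g) * (\<rho> g - 1))"
    using aug_power_mult(1) by (simp add: lin_def right_diff_distrib sum_subtractf augmentation_def flip: scalar_sum)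
  also have "\<dots> \<in> fil 1" by (intro fil_sum fil_mult_left rep_fil)
  finally show ?case using fil_mult[of "lin a" 1 "lin b" n] aug_power_mult by (simp add: lin_mult)
qed (auto simp: lin_add fil_zero intro: fil_add)

definition extension :: "('g, 'k) compl_alg \<Rightarrow> 'a" where
  "extension a = (SOME r. \<forall>n. r - lin (rep_compl_alg a n) \<in> fil n)"

text \<open>Related families have images congruent modulo \<open>fil n\<close>, and separatedness
  leaves a single limit; hence neither the choice operator nor the chosen representatives
  matter.\<close>

lemma extension_eq:
  assumes u: "compl_rel u u" and r: "\<And>n. r - lin (u n) \<in> fil n"
  shows "extension (abs_compl_alg u) = r"
proof -
  define v where "v = rep_compl_alg (abs_compl_alg u)"
  have "compl_rel u v"
    using Quotient3_rel[OF Quotient3_compl_alg, of u v] u Quotient3_rep_reflp[OF Quotient3_compl_alg]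
    unfolding v_def by (metis Quotient3_abs_rep[OF Quotient3_compl_alg])
  then have uv: "lin (u n) - lin (v n) \<in> fil n" for n
    using lin_fil[of n "u n - v n"] by (simp add: compl_rel_def lin_diff)
  have r': "\<forall>n. r - lin (v n) \<in> fil n" using fil_trans[OF r uv] by blast
  then have "\<forall>n. extension (abs_compl_alg u) - lin (v n) \<in> fil n"
    unfolding extension_def v_def[symmetric] by (rule someI)
  then show ?thesis using r' by (intro fil_eqI) (metis fil_trans fil_sym)
qed

lemma extension_approx:
  assumes u: "compl_rel u u" shows "extension (abs_compl_alg u) - lin (u n) \<in> fil n"
proof -
  have "lin (u (Suc n)) - lin (u n) \<in> fil n" for n
    using lin_fil[of n "u (Suc n) - u n"] u by (simp add: compl_rel_def lin_diff)
  then obtain L where L: "(\<lambda>n. lin (u n)) \<longlonglongrightarrow> L" using complete[of "\<lambda>n. lin (u n)"] by blast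
  have "L - lin (u n) \<in> fil n" for n
  proof -
    obtain m where m: "lin (u m) - L \<in> fil n" "n \<le> m"
      using L unfolding tendsto_iff_fil eventually_sequentially by (meson nle_le)
    have "lin (u m) - lin (u n) \<in> fil n"
      using lin_fil[OF compl_rel_diff[OF u m(2)]] by (simp add: lin_diff)
    from fil_trans[OF fil_sym[OF m(1)] this] show ?thesis .
  qed
  then show ?thesis using extension_eq[OF u, of L] by simp
qed

lemma extension_hom: "continuous_hom compl_const \<iota> extension"
proof
  fix a b :: "('g, 'k) compl_alg" and c n
  obtain u where u: "compl_rel u u" "a = abs_compl_alg u" by (rule compl_alg_cases)
  obtain v where v: "compl_rel v v" "b = abs_compl_alg v" by (rule compl_alg_cases)
  have sum: "compl_rel (\<lambda>n. u n + v n) (\<lambda>n. u n + v n)"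
    using plus_compl_alg.rsp u(1) v(1) by (auto simp: rel_fun_def)
  show "extension (a + b) = extension a + extension b"
    unfolding u(2) v(2) plus_compl_alg.abs_eq[OF u(1) v(1)]
    by (rule extension_eq[OF sum]) (simp only: lin_add fil_cong_add extension_approx u v)
  show "extension (a * b) = extension a * extension b"
    unfolding u(2) v(2) times_compl_alg.abs_eq[OF u(1) v(1)]
    by (rule extension_eq[OF compl_rel_closed(1)[OF u(1) v(1)]])
      (simp only: lin_mult fil_cong_mult extension_approx u v)
  show "extension (compl_const c) = \<iota> c"
    unfolding compl_const.abs_eq
    by (rule extension_eq[OF compl_rel_const]) (simp add: rep_zero fil_zero)
  show "extension a \<in> fil n" if "a \<in> fil n"
    using that lin_fil[of n "u n"] extension_approx[OF u(1), of n] fil_cong_iff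
    unfolding u(2) fil_compl_abs[OF u(1)] by blast
qed

lemma extension_of_group: "extension (compl_of_group g) = \<rho> g"
  unfolding compl_of_group.abs_eq
  by (rule extension_eq[OF compl_rel_const]) (simp add: fil_zero)

end

section \<open>Unipotent representations of the pure braid group\<close>

fun gens_perm :: "artin_gen list \<Rightarrow> nat \<Rightarrow> nat" where
  "gens_perm [] = id"
| "gens_perm (g # w) = gen_perm g \<circ> gens_perm w"

lemma gens_perm_append: "gens_perm (u @ v) = gens_perm u \<circ> gens_perm v"
  by (induction u) (auto simp: o_assoc)

lemma word_perm_fst: "word_perm w = gens_perm (map fst w)"
  by (induction w) auto

locale braid_rep = complete_filtered_algebra \<iota>
  for \<iota> :: "'k::field_char_0 \<Rightarrow> 'a::filtered_ring" +
  fixes s :: "artin_gen \<Rightarrow> 'a"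
  assumes comm13: "s S1 * s S3 = s S3 * s S1"
    and braid12: "s S1 * s S2 * s S1 = s S2 * s S1 * s S2"
    and braid23: "s S2 * s S3 * s S2 = s S3 * s S2 * s S3"
    and square_unipotent: "s g * s g - 1 \<in> fil 1"
begin

text \<open>Only the square of a generator is unipotent, so \<open>alg_pow\<close> inverts the
  square and one factor is put back.\<close>

definition s' :: "artin_gen \<Rightarrow> 'a" where
  "s' g = s g * alg_pow \<iota> (s g * s g) (- 1)"

lemma inverse: "s g * s' g = 1" "s' g * s g = 1"
proof -
  have "s g * alg_pow \<iota> (s g * s g) (- 1) = alg_pow \<iota> (s g * s g) (- 1) * s g"
    by (intro intertwine_pow square_unipotent) (simp add: mult.assoc)
  then show "s g * s' g = 1" "s' g * s g = 1"
    using unipotent_inverse[OF square_unipotent[of g]] by (simp_all add: s'_def mult.assoc)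
qed

definition word_val :: "artin_word \<Rightarrow> 'a" where
  "word_val w = prod_list (map (\<lambda>(g, e). if e then s g else s' g) w)"

lemma word_val_simps [simp]:
  "word_val [] = 1" "word_val ((g, e) # w) = (if e then s g else s' g) * word_val w"
  "word_val (u @ v) = word_val u * word_val v"
  by (simp_all add: word_val_def)

lemma word_val_braid_rel: "braid_rel u v \<Longrightarrow> word_val u = word_val v"
  by (induction rule: braid_rel.induct)
    (auto simp: inverse comm13 braid12[unfolded mult.assoc] braid23[unfolded mult.assoc])

definition braid_val :: "braid4 \<Rightarrow> 'a" where
  "braid_val b = word_val (rep_braid4 b)"

lemma braid_val_abs: "braid_val (abs_braid4 w) = word_val w"
  unfolding braid_val_def
  using Quotient3_rep_abs[OF Quotient3_braid4 braid_rel.refl] by (rule word_val_braid_rel)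

lemma braid_val_add: "braid_val (a + b) = braid_val a * braid_val b"
  by (induction a rule: braid4.abs_induct, induction b rule: braid4.abs_induct)
    (simp add: plus_braid4.abs_eq braid_val_abs)

lemma braid_val_zero: "braid_val 0 = 1"
  by (simp add: zero_braid4.abs_eq braid_val_abs)

lemma braid_val_sigma: "braid_val (sigma g) = s g"
  by (simp add: sigma.abs_eq braid_val_abs)

lemma braid_val_uminus_sigma: "braid_val (- sigma g) = s' g"
  by (simp add: sigma.abs_eq uminus_braid4.abs_eq braid_val_abs word_inv_def)

text \<open>
  Pure braids act unipotently because modulo \<open>fil 1\<close> the \<open>s g\<close> satisfy the Coxeter relations, which
  present the symmetric group.
\<close>

definition coxeter_eq :: "artin_gen list \<Rightarrow> artin_gen list \<Rightarrow> bool" where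
  "coxeter_eq u v \<longleftrightarrow> prod_list (map s u) - prod_list (map s v) \<in> fil 1
     \<and> gens_perm u = gens_perm v"

lemma coxeter_refl: "coxeter_eq u u"
  by (simp add: coxeter_eq_def fil_zero)

lemma coxeter_sym: "coxeter_eq u v \<Longrightarrow> coxeter_eq v u"
  by (simp add: coxeter_eq_def fil_sym)

lemma coxeter_trans: "coxeter_eq u v \<Longrightarrow> coxeter_eq v w \<Longrightarrow> coxeter_eq u w"
  unfolding coxeter_eq_def using fil_trans by (metis (no_types, lifting))

lemma coxeter_append:
  assumes "coxeter_eq u u'" "coxeter_eq v v'" shows "coxeter_eq (u @ v) (u' @ v')"
  using assms unfolding coxeter_eq_def by (auto simp: gens_perm_append intro: fil_cong_mult)

lemma coxeter_relations:
  "coxeter_eq [g, g] []" "coxeter_eq [S1, S3] [S3, S1]"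
  "coxeter_eq [S1, S2, S1] [S2, S1, S2]" "coxeter_eq [S2, S3, S2] [S3, S2, S3]"
  using square_unipotent comm13 braid12 braid23 gen_perm_relations
  by (simp_all del: gen_perm.simps add: coxeter_eq_def fil_zero mult.assoc)

lemma coxeter_replace:
  "coxeter_eq u v \<Longrightarrow> coxeter_eq (a @ v @ b) w \<Longrightarrow> coxeter_eq (a @ u @ b) w"
  using coxeter_trans coxeter_append coxeter_refl by blast

text \<open>Here \<open>r\<close> runs through coset representatives of S_3 in S_4; a representative
  times a generator is again one, up to a left factor of at most one letter \<open>S1\<close> or
  \<open>S2\<close>. With the analogous step from S_3 to S_2 this is the normal form behind the
  Coxeter presentation.\<close>

lemma coxeter_reduce4:
  "\<exists>u r. set u \<subseteq> {S1, S2} \<and> r \<in> {[], [S3], [S3, S2], [S3, S2, S1]} \<and> coxeter_eq w (u @ r)"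
proof (induction w rule: rev_induct)
  case Nil
  show ?case by (intro exI[of _ "[]"]) (simp add: coxeter_refl)
next
  case (snoc g w)
  then obtain u r where u: "set u \<subseteq> {S1, S2}" and r: "r \<in> {[], [S3], [S3, S2], [S3, S2, S1]}"
    and w: "coxeter_eq w (u @ r)" by blast
  have "\<exists>u' r'. set u' \<subseteq> {S1, S2} \<and> r' \<in> {[], [S3], [S3, S2], [S3, S2, S1]} \<and> coxeter_eq (r @ [g]) (u' @ r')"
  proof -
    note rel = coxeter_relations coxeter_relations(2-4)[THEN coxeter_sym]
    have a: "coxeter_eq [S3, S1] ([S1] @ [S3])" "coxeter_eq [S3, S3] ([] @ [])"
      using rel by simp_all
    have b: "coxeter_eq [S3, S2, S2] ([] @ [S3])" "coxeter_eq [S3, S2, S3] ([S2] @ [S3, S2])"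
      using coxeter_replace[OF rel(1)[of S2], of "[S3]" "[]"] rel coxeter_refl[of "[S3]"] by simp_all
    have c: "coxeter_eq [S3, S2, S1, S1] ([] @ [S3, S2])"
      using coxeter_replace[OF rel(1)[of S1], of "[S3, S2]" "[]"] coxeter_refl[of "[S3, S2]"] by simp
    have d: "coxeter_eq [S3, S2, S1, S2] ([S1] @ [S3, S2, S1])"
      using coxeter_replace[OF rel(6), of "[S3]" "[]"] coxeter_replace[OF rel(5), of "[]" "[S2, S1]"]
        coxeter_refl[of "[S1, S3, S2, S1]"] by simp
    have e: "coxeter_eq [S3, S2, S1, S3] ([S2] @ [S3, S2, S1])"
      using coxeter_replace[OF rel(2), of "[S3, S2]" "[]"] coxeter_replace[OF rel(7), of "[]" "[S1]"]
        coxeter_refl[of "[S2, S3, S2, S1]"] by simp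
    have f: "coxeter_eq [g] [g]" "coxeter_eq [S3, S2] [S3, S2]" "coxeter_eq [S3, S2, S1] [S3, S2, S1]" for g
      by (rule coxeter_refl)+
    have "\<exists>u'\<in>{[], [S1], [S2]}. \<exists>r'\<in>{[], [S3], [S3, S2], [S3, S2, S1]}. coxeter_eq (r @ [g]) (u' @ r')"
      using r a b c d e f by (cases g) auto
    then obtain u' r' where u': "u' \<in> {[], [S1], [S2]}"
      and r': "r' \<in> {[], [S3], [S3, S2], [S3, S2, S1]}" "coxeter_eq (r @ [g]) (u' @ r')" by blast
    have "set u' \<subseteq> {S1, S2}" using u' by auto
    then show ?thesis using r' by blast
  qed
  then obtain u' r' where "set u' \<subseteq> {S1, S2}" "r' \<in> {[], [S3], [S3, S2], [S3, S2, S1]}"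
    and *: "coxeter_eq (r @ [g]) (u' @ r')" by blast
  moreover have "coxeter_eq (w @ [g]) ((u @ u') @ r')"
    using coxeter_trans[OF coxeter_append[OF w coxeter_refl[of "[g]"]]] coxeter_append[OF coxeter_refl[of u] *] by simp
  ultimately show ?case using u by (intro exI[of _ "u @ u'"] exI[of _ r']) auto
qed

lemma coxeter_reduce3:
  "set w \<subseteq> {S1, S2} \<Longrightarrow>
    \<exists>u r. u \<in> {[], [S1]} \<and> r \<in> {[], [S2], [S2, S1]} \<and> coxeter_eq w (u @ r)"
proof (induction w rule: rev_induct)
  case Nil
  show ?case by (intro exI[of _ "[]"]) (simp add: coxeter_refl)
next
  case (snoc g w)
  then obtain u r where u: "u \<in> {[], [S1]}" and r: "r \<in> {[], [S2], [S2, S1]}"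
    and w: "coxeter_eq w (u @ r)" by auto
  have u1: "\<exists>u'\<in>{[], [S1]}. coxeter_eq (u @ [S1]) u'"
    using u coxeter_relations(1)[of S1] coxeter_refl by auto
  note rel = coxeter_relations coxeter_relations(2-4)[THEN coxeter_sym]
  have "\<exists>u' r'. u' \<in> {[], [S1]} \<and> r' \<in> {[], [S2], [S2, S1]} \<and> coxeter_eq (r @ [g]) (u' @ r')"
  proof -
    have b: "coxeter_eq [S2, S1, S1] [S2]"
      using coxeter_replace[OF rel(1)[of S1], of "[S2]" "[]"] coxeter_refl[of "[S2]"] by simp
    have "coxeter_eq [l] [l]" "coxeter_eq [S2, S1] [S2, S1]" for l by (rule coxeter_refl)+
    moreover have "g = S1 \<or> g = S2" using snoc.prems by auto
    ultimately have "\<exists>u'\<in>{[], [S1]}. \<exists>r'\<in>{[], [S2], [S2, S1]}. coxeter_eq (r @ [g]) (u' @ r')"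
      using r b rel(6) rel(1)[of S2] by auto
    then show ?thesis by blast
  qed
  then obtain u' r' where u': "u' \<in> {[], [S1]}" and r': "r' \<in> {[], [S2], [S2, S1]}"
    and *: "coxeter_eq (r @ [g]) (u' @ r')" by blast
  have "coxeter_eq (w @ [g]) ((u @ u') @ r')"
    using coxeter_trans[OF coxeter_append[OF w coxeter_refl[of "[g]"]]] coxeter_append[OF coxeter_refl[of u] *] by simp
  moreover obtain u'' where "u'' \<in> {[], [S1]}" "coxeter_eq (u @ u') u''"
  proof (cases "u' = []")
    case True then show ?thesis using that[OF u] by (simp add: coxeter_refl)
  next
    case False then show ?thesis using that u' u1 by auto
  qed
  ultimately have "coxeter_eq (w @ [g]) (u'' @ r')"
    using coxeter_trans[OF _ coxeter_append[OF _ coxeter_refl]] by blast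
  then show ?case using r' \<open>u'' \<in> {[], [S1]}\<close> by blast
qed

text \<open>The images of 4, 3 and 1 detect in turn whether \<open>r\<close>, \<open>t\<close> and
  \<open>v\<close> are empty, so only the empty normal form has trivial permutation.\<close>

lemma coxeter_id:
  assumes "gens_perm w = id" shows "coxeter_eq w []"
proof -
  obtain u r where u: "set u \<subseteq> {S1, S2}" and r: "r \<in> {[], [S3], [S3, S2], [S3, S2, S1]}"
    and w: "coxeter_eq w (u @ r)" using coxeter_reduce4 by blast
  obtain v t where v: "v \<in> {[], [S1]}" and t: "t \<in> {[], [S2], [S2, S1]}" and u': "coxeter_eq u (v @ t)"
    using coxeter_reduce3[OF u] by blast
  have eq: "coxeter_eq w ((v @ t) @ r)" using coxeter_trans[OF w coxeter_append[OF u' coxeter_refl]] .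
  then have id: "gens_perm ((v @ t) @ r) i = i" for i
    using assms by (simp add: coxeter_eq_def)
  have "r = []"
    using id[of 4] v t r by (auto simp: transpose_def)
  moreover have "t = []"
    using id[of 3] v t \<open>r = []\<close> by (auto simp: transpose_def)
  moreover have "v = []"
    using id[of 1] v \<open>t = []\<close> \<open>r = []\<close> by (auto simp: transpose_def)
  ultimately show ?thesis using eq by simp
qed

lemma word_val_coxeter: "word_val w - prod_list (map s (map fst w)) \<in> fil 1"
proof (induction w)
  case (Cons c w)
  obtain g e where c: "c = (g, e)" by (cases c)
  have "s' g - s g = - (s' g * (s g * s g - 1))"
    by (simp add: right_diff_distrib inverse flip: mult.assoc)
  then have "s' g - s g \<in> fil 1" using square_unipotent[of g] by (simp only: fil_uminus fil_mult_left)
  then have "(if e then s g else s' g) - s g \<in> fil 1" by (simp add: fil_zero)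
  from fil_cong_mult[OF this Cons] show ?case by (simp add: c)
qed (simp add: fil_zero)

lemma braid_val_unipotent:
  assumes "braid_perm b = id" shows "braid_val b - 1 \<in> fil 1"
  using assms
proof (induction b rule: braid4.abs_induct)
  case (1 w)
  then have "word_perm w = id" by (simp add: braid_perm.abs_eq id_def)
  then have "coxeter_eq (map fst w) []" by (intro coxeter_id) (simp add: word_perm_fst)
  then show ?case
    using fil_trans[OF word_val_coxeter[of w]] by (simp add: coxeter_eq_def braid_val_abs)
qed

definition pure_val :: "pure_braid4 \<Rightarrow> 'a" where
  "pure_val b = braid_val (Rep_pure_braid4 b)"

lemma unipotent_rep_pure_val: "unipotent_rep \<iota> pure_val"
proof
  fix g h :: pure_braid4
  show "pure_val (g + h) = pure_val g * pure_val h"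
    by (simp add: pure_val_def plus_pure_braid4.rep_eq braid_val_add)
  show "pure_val 0 = 1" by (simp add: pure_val_def zero_pure_braid4.rep_eq braid_val_zero)
  show "pure_val g - 1 \<in> fil 1"
    using Rep_pure_braid4[of g] by (simp add: pure_val_def braid_val_unipotent del: One_nat_def)
qed

lemma inverse_assoc: "s g * (s' g * z) = z" "s' g * (s g * z) = z"
  by (simp_all add: inverse flip: mult.assoc)

lemma braid_assoc:
  "s S1 * (s S3 * z) = s S3 * (s S1 * z)"
  "s S1 * (s S2 * (s S1 * z)) = s S2 * (s S1 * (s S2 * z))"
  "s S2 * (s S3 * (s S2 * z)) = s S3 * (s S2 * (s S3 * z))"
  by (simp_all only: mult.assoc[symmetric] comm13 braid12 braid23)

text \<open>The composite arguments of the pentagon are full twists of one string around a bundle of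
  two; as such they are palindromic words without inverses.\<close>

lemma pure_val_gens:
  "pure_val x12 = s S1 * s S1" "pure_val x23 = s S2 * s S2" "pure_val x34 = s S3 * s S3"
  "pure_val (x12 + x13) = s S1 * s S2 * s S2 * s S1"
  "pure_val (x13 + x23) = s S2 * s S1 * s S1 * s S2"
  "pure_val (x23 + x24) = s S2 * s S3 * s S3 * s S2"
  "pure_val (x24 + x34) = s S3 * s S2 * s S2 * s S3"
proof -
  note simps = pure_val_def x12.rep_eq x23.rep_eq x34.rep_eq x13.rep_eq x24.rep_eq plus_pure_braid4.rep_eq
    braid_val_add braid_val_sigma braid_val_uminus_sigma diff_conv_add_uminus mult.assoc inverse inverse_assoc
  have move: "s S1 * (s S2 * s' S1) = s' S2 * (s S1 * s S2)" "s S2 * (s S1 * s' S2) = s' S1 * (s S2 * s S1)"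
    "s S2 * (s S3 * s' S2) = s' S3 * (s S2 * s S3)" "s S3 * (s S2 * s' S3) = s' S2 * (s S3 * s S2)"
    using intertwine_inverse[of "s S1 * s S2" "s S1" "s S2" "s' S1" "s' S2"]
      intertwine_inverse[of "s S2 * s S1" "s S2" "s S1" "s' S2" "s' S1"]
      intertwine_inverse[of "s S2 * s S3" "s S2" "s S3" "s' S2" "s' S3"]
      intertwine_inverse[of "s S3 * s S2" "s S3" "s S2" "s' S3" "s' S2"]
      braid12 braid23 by (simp_all add: mult.assoc inverse)
  show "pure_val x12 = s S1 * s S1" "pure_val x23 = s S2 * s S2" "pure_val x34 = s S3 * s S3"
    "pure_val (x13 + x23) = s S2 * s S1 * s S1 * s S2"
    "pure_val (x24 + x34) = s S3 * s S2 * s S2 * s S3"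
    by (simp_all add: simps del: add_uminus_conv_diff)
  have "s S1 * (s S1 * (s S2 * (s S1 * (s S1 * s' S2)))) = s S1 * (s S2 * (s S1 * (s S2 * (s S1 * s' S2))))"
    by (simp only: braid_assoc)
  also have "\<dots> = s S1 * (s S2 * (s S2 * s S1))" by (simp only: move inverse_assoc)
  finally show "pure_val (x12 + x13) = s S1 * s S2 * s S2 * s S1"
    by (simp add: simps del: add_uminus_conv_diff)
  have "s S2 * (s S2 * (s S3 * (s S2 * (s S2 * s' S3)))) = s S2 * (s S3 * (s S2 * (s S3 * (s S2 * s' S3))))"
    by (simp only: braid_assoc)
  also have "\<dots> = s S2 * (s S3 * (s S3 * s S2))" by (simp only: move inverse_assoc)
  finally show "pure_val (x23 + x24) = s S2 * s S3 * s S3 * s S2"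
    by (simp add: simps del: add_uminus_conv_diff)
qed

lemma pure_val_unipotent: "pure_val g - 1 \<in> fil 1"
  using unipotent_rep_pure_val unfolding unipotent_rep_def unipotent_rep_axioms_def by blast

end

section \<open>Base change to the algebraic closure\<close>

lemma alg_log_to_ac: "alg_log (\<iota> \<circ> to_ac) a = alg_log \<iota> a"
  unfolding alg_log_def comp_def by (simp only: to_ac_divide to_ac_power to_ac_minus to_ac_1 to_ac_of_nat)

lemma nc_eval_to_ac: "nc_eval (\<iota> \<circ> to_ac) F a b = nc_eval \<iota> (map_ncfps to_ac F) a b"
  unfolding nc_eval_def alg_log_to_ac by (simp add: map_ncfps.rep_eq)

lemma F2_map_to_ac:
  fixes F :: "'k::field_char_0 ncfps"
  assumes "F \<in> F2" shows "map_ncfps to_ac F \<in> F2"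
proof -
  have "nc_coproduct (map_ncfps to_ac F) u v = to_ac (nc_coproduct F u v)" for u v
    by (simp add: nc_coproduct_def map_ncfps.rep_eq to_ac_sum)
  then show ?thesis using assms by (simp add: F2_def map_ncfps.rep_eq)
qed

lemma complete_filtered_algebra_to_ac:
  assumes "complete_filtered_algebra (\<iota> :: 'k::field_char_0 alg_closure \<Rightarrow> 'a::filtered_ring)"
  shows "complete_filtered_algebra (\<iota> \<circ> to_ac)"
proof -
  interpret complete_filtered_algebra \<iota> by (rule assms)
  show ?thesis
  proof
    show "(\<iota> \<circ> to_ac) c * a = a * (\<iota> \<circ> to_ac) c" for c a by (simp only: comp_apply scalar_comm)
    show "\<exists>L. S \<longlonglongrightarrow> L" if "\<And>n. S (Suc n) - S n \<in> fil n" for S :: "nat \<Rightarrow> 'a"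
      using that by (rule complete)
  qed (simp_all add: scalar_add scalar_mult fil_mult)
qed

lemma compl_of_group_unipotent:
  "compl_of_group g - (1 :: ('g::group_add, 'k::field_char_0) compl_alg) \<in> fil 1"
proof -
  have "aug_power (Suc 0) ((Poly_Mapping.single g 1 - 1) * (1 :: 'g \<Rightarrow>\<^sub>0 'k))"
    using augmentation_add[of "Poly_Mapping.single g (1::'k) - 1" 1]
    by (intro aug_power_mult aug_power_0) simp
  then show ?thesis
    by (simp add: compl_of_group.abs_eq one_compl_alg.abs_eq minus_compl_alg.abs_eq compl_rel_const fil_compl_abs)
qed

lemma compl_of_group_add: "compl_of_group (g + h) = (compl_of_group g * compl_of_group h :: ('g::group_add, 'k::field) compl_alg)"
  by (simp add: compl_of_group.abs_eq times_compl_alg.abs_eq compl_rel_const mult_single)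

lemma pentagon_rep:
  fixes f :: "'k::field_char_0 ncfps" and \<iota> :: "'k alg_closure \<Rightarrow> 'a::filtered_ring"
  assumes "braid_rep \<iota> s" and f: "f \<in> F2" and pentagon: "pentagon f"
  defines "F \<equiv> nc_eval \<iota> (map_ncfps to_ac f)"
  shows "F (s S1 * s S1) (s S2 * s S3 * s S3 * s S2) * F (s S2 * s S1 * s S1 * s S2) (s S3 * s S3)
    = F (s S2 * s S2) (s S3 * s S3) * F (s S1 * s S2 * s S2 * s S1) (s S3 * s S2 * s S2 * s S3)
      * F (s S1 * s S1) (s S2 * s S2)"
proof -
  interpret braid_rep \<iota> s by (rule assms)
  interpret rep: unipotent_rep \<iota> pure_val by (rule unipotent_rep_pure_val)
  interpret c: complete_filtered_algebra "\<iota> \<circ> to_ac"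
    by (rule complete_filtered_algebra_to_ac) (rule complete_filtered_algebra_axioms)
  interpret e: unipotent_rep "\<iota> \<circ> to_ac" pure_val
    by standard (simp_all only: rep.rep_add rep.rep_zero rep.rep_fil)
  interpret h: continuous_hom compl_const "\<iota> \<circ> to_ac" e.extension by (rule e.extension_hom)
  have eval: "e.extension (nc_eval compl_const f (compl_of_group g) (compl_of_group h)) = F (pure_val g) (pure_val h)" for g h
    by (simp only: h.hom_nc_eval[OF compl_of_group_unipotent compl_of_group_unipotent] e.extension_of_group nc_eval_to_ac F_def)
  note pent = pentagon[unfolded pentagon_def Let_def, folded compl_of_group_add, THEN arg_cong[of _ _ e.extension], unfolded h.hom_mult eval pure_val_gens]
  show ?thesis by (rule pent)
qed

section \<open>The hexagon and its defect\<close>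

context complete_filtered_algebra
begin

lemma alg_log_approx:
  assumes "a - 1 \<in> fil 1" shows "alg_log \<iota> a - (a - 1) \<in> fil 2"
proof -
  have "fps_eval (fps_ln 1 - fps_X) (a - 1) \<in> fil 2"
    by (rule fps_eval_in_fil[OF assms]) (auto simp: fps_ln_nth fps_X_def less_2_cases_iff)
  then show ?thesis by (simp add: fps_eval_diff assms alg_log_eq del: One_nat_def)
qed

lemma word_eval_cong:
  assumes "a - a' \<in> fil 2" "b - b' \<in> fil 2" "(a :: 'a) \<in> fil 1" "b \<in> fil 1" "a' \<in> fil 1" "b' \<in> fil 1"
  shows "word_eval a b w - word_eval a' b' w \<in> fil (Suc (length w))"
proof (induction w)
  case (Cons l w)
  have l: "case_letter a b l - case_letter a' b' l \<in> fil 2" "case_letter a' b' l \<in> fil 1"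
    using assms by (cases l; simp)+
  have "word_eval a b (l # w) - word_eval a' b' (l # w)
      = (case_letter a b l - case_letter a' b' l) * word_eval a b w
        + case_letter a' b' l * (word_eval a b w - word_eval a' b' w)"
    by (simp add: word_eval_Cons algebra_simps)
  moreover have "(case_letter a b l - case_letter a' b' l) * word_eval a b w \<in> fil (Suc (length (l # w)))"
    using fil_mult[OF l(1) word_eval_fil[OF assms(3,4), of w]] by (simp add: numeral_2_eq_2)
  moreover have "case_letter a' b' l * (word_eval a b w - word_eval a' b' w) \<in> fil (Suc (length (l # w)))"
    using fil_mult[OF l(2) Cons] by simp
  ultimately show ?case by (simp only: fil_add)
qed (simp add: fil_zero)

text \<open>Modulo degree n + 1 only the degree n part of the series and the linear parts of its
  arguments count. For a product of generators \<open>a'\<close> can be the sum of their linear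
  parts.\<close>

lemma nc_eval_approx:
  assumes F: "F \<in> fil n" and a: "a - 1 \<in> fil 1" and b: "b - 1 \<in> fil 1"
    and a': "a - 1 - a' \<in> fil 2" "a' \<in> fil 1" and b': "b - 1 - b' \<in> fil 2" "b' \<in> fil 1"
  shows "nc_eval \<iota> F a b - nc_term F a' b' n \<in> fil (Suc n)"
proof -
  have log: "alg_log \<iota> a - a' \<in> fil 2" "alg_log \<iota> b - b' \<in> fil 2"
    using fil_trans[OF alg_log_approx[OF a] a'(1)] fil_trans[OF alg_log_approx[OF b] b'(1)] .
  have "nc_term F (alg_log \<iota> a) (alg_log \<iota> b) k = 0" if "k < n" for k
    using F that by (auto simp: nc_term_def fil_ncfps_iff intro!: sum.neutral)
  then have "nc_eval \<iota> F a b - nc_term F (alg_log \<iota> a) (alg_log \<iota> b) n \<in> fil (Suc n)"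
    using nc_subst_approx[OF alg_log_fil[OF a] alg_log_fil[OF b], of F "Suc n"] by (simp add: nc_eval_eq)
  moreover have "nc_term F (alg_log \<iota> a) (alg_log \<iota> b) n - nc_term F a' b' n \<in> fil (Suc n)"
    unfolding nc_term_def sum_subtractf[symmetric] right_diff_distrib[symmetric]
    using word_eval_cong[OF log alg_log_fil[OF a] alg_log_fil[OF b] a'(2) b'(2)]
    by (intro fil_sum fil_mult_left) auto
  ultimately show ?thesis by (rule fil_trans)
qed

lemma nc_eval_diff_one:
  assumes "a - 1 \<in> fil 1" "b - 1 \<in> fil 1"
  shows "nc_eval \<iota> (F - 1) a b = nc_eval \<iota> F a b - 1"
proof -
  interpret h: continuous_hom nc_const \<iota> "\<lambda>F. nc_eval \<iota> F a b" by (rule nc_eval_hom[OF assms])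
  show ?thesis by (simp add: h.hom_diff)
qed

definition hex :: "'k ncfps \<Rightarrow> 'k \<Rightarrow> 'a \<Rightarrow> 'a \<Rightarrow> 'a" where
  "hex F m a b = (let z = alg_pow \<iota> (a * b) (- 1) in
     nc_eval \<iota> F z a * alg_pow \<iota> z m * nc_eval \<iota> F b z * alg_pow \<iota> b m * nc_eval \<iota> F a b * alg_pow \<iota> a m)"

lemma intertwine_mult: "g * a = a' * g \<Longrightarrow> g * b = b' * g \<Longrightarrow> g * (a * b) = a' * b' * (g :: 'a)"
  by (metis mult.assoc)

lemma intertwine_hex:
  assumes "a - 1 \<in> fil 1" "a' - 1 \<in> fil 1" "b - 1 \<in> fil 1" "b' - 1 \<in> fil 1"
    and "g * a = a' * g" "g * b = b' * g"
  shows "g * hex F m a b = hex F m a' b' * g"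
  unfolding hex_def Let_def
  by (intro intertwine_mult intertwine_nc_eval intertwine_pow alg_pow_fil unipotent_mult assms)

end

lemma (in continuous_hom) hom_hex:
  assumes "a - 1 \<in> fil 1" "b - 1 \<in> fil 1"
  shows "h (A.hex F m a b) = B.hex F m (h a) (h b)"
  using assms
  by (simp add: A.hex_def B.hex_def Let_def hom_mult hom_nc_eval hom_pow A.alg_pow_fil A.unipotent_mult del: One_nat_def)

lemma (in complete_filtered_algebra) hex_eq_nc_eval:
  assumes "a - 1 \<in> fil 1" "b - 1 \<in> fil 1"
  shows "nc_eval \<iota> (ncfps.hex F m nc_x nc_y) a b = hex F m a b"
proof -
  interpret h: continuous_hom nc_const \<iota> "\<lambda>F. nc_eval \<iota> F a b" by (rule nc_eval_hom[OF assms])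
  show ?thesis
    using h.hom_hex[OF nc_x_unipotent nc_y_unipotent] by (simp only: nc_eval_gens[OF assms])
qed

text \<open>Antisymmetry is one of the two equations to be proved, but also a tool: it inverts an
  associator by exchanging its arguments.\<close>

definition dual_series :: "'k::field_char_0 ncfps set" where
  "dual_series = {F \<in> F2'. nc_eval nc_const F nc_x nc_y * nc_eval nc_const F nc_y nc_x = 1}"

context complete_filtered_algebra
begin

lemma nc_eval_dual:
  assumes F: "F \<in> dual_series" and ab: "a - 1 \<in> fil 1" "b - 1 \<in> fil 1"
  shows "nc_eval \<iota> F a b * nc_eval \<iota> F b a = 1"
proof -
  interpret h: continuous_hom nc_const \<iota> "\<lambda>F. nc_eval \<iota> F a b" by (rule nc_eval_hom[OF ab])
  have "nc_eval \<iota> (nc_eval nc_const F nc_x nc_y * nc_eval nc_const F nc_y nc_x) a b = 1"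
    using F by (simp add: dual_series_def)
  then show ?thesis
    by (simp only: h.hom_mult h.hom_nc_eval nc_x_unipotent nc_y_unipotent nc_eval_gens[OF ab])
qed

lemma nc_eval_dual_assoc:
  assumes "F \<in> dual_series" "a - 1 \<in> fil 1" "b - 1 \<in> fil 1"
  shows "nc_eval \<iota> F a b * (nc_eval \<iota> F b a * c) = c"
  using nc_eval_dual[OF assms] by (simp flip: mult.assoc)

text \<open>
  The hexagon for three parallel bundles of strings: \<open>x, y, v\<close> are the pure braids of the pairs of
  bundles, so that \<open>x y v\<close> is central; the defect of the equation is \<open>hex F m x y\<close>.
\<close>

lemma hex_central:
  assumes F: "F \<in> dual_series" and x: "x - 1 \<in> fil 1" and y: "y - 1 \<in> fil 1" and v: "v - 1 \<in> fil 1"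
    and cx: "x * y * v * x = x * (x * y * v)" and cy: "x * y * v * y = y * (x * y * v)"
  shows "nc_eval \<iota> F v y * alg_pow \<iota> (x * y) m * nc_eval \<iota> F x v * hex F m x y
    = alg_pow \<iota> y m * nc_eval \<iota> F x y * alg_pow \<iota> x m"
proof -
  define c where "c = x * y * v"
  define z where "z = alg_pow \<iota> (x * y) (- 1)"
  have F': "F \<in> F2'" using F by (simp add: dual_series_def)
  have xy: "x * y - 1 \<in> fil 1" by (intro unipotent_mult x y)
  have c: "c - 1 \<in> fil 1" unfolding c_def by (intro unipotent_mult x y v)
  have z: "z - 1 \<in> fil 1" unfolding z_def by (intro alg_pow_fil xy)
  have "c * (x * y) = x * y * c" using cx cy unfolding c_def by (intro intertwine_mult)
  then have cz: "c * z = z * c" unfolding z_def by (intro intertwine_pow xy)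
  have "z * c = (z * (x * y)) * v" by (simp add: c_def mult.assoc)
  \<comment> \<open>Thus \<open>v\<close> may be replaced by \<open>z\<close> inside every
    associator, since the factor \<open>c\<close> commutes with \<open>x\<close>, \<open>y\<close>
    and \<open>z\<close>.\<close>
  then have v_eq: "v = z * c" unfolding z_def using unipotent_inverse[OF xy] by simp
  have "nc_eval \<iota> F v y = nc_eval \<iota> F z y" "nc_eval \<iota> F x v = nc_eval \<iota> F x z"
    unfolding v_eq using cx cy cz x y z c
    by (auto intro!: nc_eval_central_left nc_eval_central_right F' simp: c_def[symmetric] simp del: One_nat_def)
  moreover have "alg_pow \<iota> (x * y) m = alg_pow \<iota> z (- m)"
    unfolding z_def by (simp add: alg_pow_pow xy del: One_nat_def)
  moreover have "alg_pow \<iota> z (- m) * (alg_pow \<iota> z m * w) = w" for w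
    using alg_pow_neg(2)[OF z] by (simp flip: mult.assoc)
  ultimately show ?thesis
    unfolding hex_def Let_def z_def[symmetric]
    by (simp add: mult.assoc nc_eval_dual_assoc[OF F] x y z del: One_nat_def)
qed

text \<open>Pushing the braid Q * P through \<open>hex_central\<close> turns a relation of pure
  braids into a hexagon of braidings P x^m. For P = sigma_i and x = sigma_i^2 the braiding is
  formally sigma_i^lambda, the reason for m = (lambda - 1)/2.\<close>

lemma hex_move:
  assumes F: "F \<in> dual_series"
    and uni: "x - 1 \<in> fil 1" "y - 1 \<in> fil 1" "v - 1 \<in> fil 1" "x1 - 1 \<in> fil 1" "y1 - 1 \<in> fil 1" "v2 - 1 \<in> fil 1" "y2 - 1 \<in> fil 1"
    and cx: "x * y * v * x = x * (x * y * v)" and cy: "x * y * v * y = y * (x * y * v)"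
    and P: "P * x = x1 * P" "P * y = y1 * P" and Q: "Q * P * v = v2 * (Q * P)" "Q * P * y = y2 * (Q * P)"
  shows "nc_eval \<iota> F v2 y2 * (Q * P * alg_pow \<iota> (x * y) m) * nc_eval \<iota> F x v * hex F m x y
    = Q * alg_pow \<iota> y1 m * nc_eval \<iota> F x1 y1 * (P * alg_pow \<iota> x m)"
proof -
  have "nc_eval \<iota> F v2 y2 * (Q * P * alg_pow \<iota> (x * y) m) * nc_eval \<iota> F x v * hex F m x y
    = Q * P * nc_eval \<iota> F v y * alg_pow \<iota> (x * y) m * nc_eval \<iota> F x v * hex F m x y"
    using intertwine_nc_eval[OF uni(3,6) uni(2,7) Q, of F] by (simp add: mult.assoc)
  also have "\<dots> = Q * P * (nc_eval \<iota> F v y * alg_pow \<iota> (x * y) m * nc_eval \<iota> F x v * hex F m x y)"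
    by (simp add: mult.assoc)
  also have "\<dots> = Q * P * (alg_pow \<iota> y m * nc_eval \<iota> F x y * alg_pow \<iota> x m)"
    by (simp only: hex_central[OF F uni(1-3) cx cy])
  also have "\<dots> = Q * (P * (alg_pow \<iota> y m * nc_eval \<iota> F x y)) * alg_pow \<iota> x m"
    by (simp add: mult.assoc)
  also have "P * (alg_pow \<iota> y m * nc_eval \<iota> F x y) = alg_pow \<iota> y1 m * nc_eval \<iota> F x1 y1 * P"
    by (intro intertwine_mult intertwine_pow intertwine_nc_eval uni P)
  finally show ?thesis by (simp add: mult.assoc)
qed

lemma unipotent_mult_fil:
  assumes "u - 1 \<in> fil 1" "(e :: 'a) \<in> fil n"
  shows "u * e - e \<in> fil (Suc n)" "e * u - e \<in> fil (Suc n)"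
  using fil_mult[OF assms] fil_mult[OF assms(2,1)] by (simp_all add: algebra_simps)

text \<open>
  The coherence polytope of one string moving past three others in all possible bracketings. Its
  faces are four hexagons, with defects \<open>H1, \<dots>, H4\<close>, and pentagons and naturality squares, which
  commute.
\<close>

lemma hexagon_syzygy:
  fixes a :: 'a
  assumes h1: "a * C * a * H1 = T2 * a * T1" and h2: "b * C' * b * H2 = T3 * b * T2"
    and h3: "q * E * r * H3 = T3 * q * C" and h4: "r * E * p * H4 = C' * p * T1"
    and nat: "E * b = a * E" "T2 * r = r * T2" "T3 * p = p * T3" "T1 * q = q * T1"
    and pent: "p * q = b * r * a"
    and inv: "a * a' = 1" "a' * a = 1" "b * b' = 1" "b' * b = 1" "p * p' = 1" "p' * p = 1" "q * q' = 1" "q' * q = 1" "r * r' = 1" "r' * r = 1"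
      "E' * E = 1" "T1 * T1' = 1" "T1' * T1 = 1"
    and uni: "a - 1 \<in> fil 1" "a' - 1 \<in> fil 1" "b - 1 \<in> fil 1" "b' - 1 \<in> fil 1" "p - 1 \<in> fil 1" "p' - 1 \<in> fil 1" "q - 1 \<in> fil 1" "q' - 1 \<in> fil 1"
    and n: "0 < n" and H: "H1 - 1 \<in> fil n" "H2 - 1 \<in> fil n" "H3 - 1 \<in> fil n" "H4 - 1 \<in> fil n"
  shows "(H1 - 1) + (H3 - 1) - ((H4 - 1) + T1' * (H2 - 1) * T1) \<in> fil (Suc n)"
proof -
  note invs = inv[THEN assoc_rule, simplified]
  define K where "K = T1' * p' * b * H2 * b' * p * T1"
  have ba: "b * r = p * q * a'" and ra: "r * a = b' * p * q"
    using arg_cong[OF pent, of "\<lambda>z. z * a'"] arg_cong[OF pent, of "\<lambda>z. b' * z"]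
    by (simp_all add: mult.assoc inv invs)
  \<comment> \<open>One way around the polytope: faces 3 and 1, then the pentagon and the naturality
    squares, up to face 2.\<close>
  have "p * q * E * r * H3 * a * H1 = p * T3 * q * C * a * H1"
    using arg_cong[OF h3, of "\<lambda>z. p * z * a * H1"] by (simp add: mult.assoc)
  also have "\<dots> = p * T3 * q * a' * T2 * a * T1"
    using arg_cong[OF h1, of "\<lambda>z. p * T3 * q * a' * z"] by (simp add: mult.assoc inv invs)
  also have "\<dots> = T3 * (p * q * a') * T2 * a * T1"
    using nat(3) by (simp flip: mult.assoc)
  also have "\<dots> = T3 * b * (r * T2) * a * T1" by (simp only: ba[symmetric]) (simp only: mult.assoc)
  also have "\<dots> = (T3 * b * T2) * (r * a) * T1" by (simp only: nat(2)[symmetric]) (simp only: mult.assoc)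
  also have "\<dots> = b * C' * b * H2 * b' * p * (q * T1)" by (simp only: h2[symmetric] ra) (simp only: mult.assoc)
  also have "\<dots> = b * C' * b * H2 * b' * p * T1 * q" by (simp only: nat(4)[symmetric]) (simp only: mult.assoc)
  finally have A: "p * q * E * r * H3 * a * H1 = b * C' * b * H2 * b' * p * T1 * q" .
  have "a' * E = E * b'"
    using arg_cong[OF nat(1), of "\<lambda>z. a' * z * b'"] by (simp add: mult.assoc inv invs)
  then have "b * C' * p * T1 = p * q * E * b' * p * H4"
    using arg_cong[OF h4, of "\<lambda>z. b * z"] ba by (metis mult.assoc)
  also have "b' * p = r * a * q'" using ra by (simp add: mult.assoc inv)
  then have "p * q * E * b' * p * H4 = p * q * E * r * a * q' * H4" by (simp add: mult.assoc)
  finally have B: "b * C' * p * T1 = p * q * E * r * a * q' * H4" .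
  \<comment> \<open>Face 4, solved for \<open>b * C'\<close> and inserted into \<open>A\<close>,
    leaves the same left-invertible prefix \<open>p * q * E * r\<close> on both sides.\<close>
  have "b * C' = p * q * E * r * a * q' * H4 * T1' * p'"
    using arg_cong[OF B, of "\<lambda>z. z * T1' * p'"] by (simp add: mult.assoc inv invs)
  then have "p * q * E * r * (H3 * a * H1) = p * q * E * r * (a * q' * H4 * K * q)"
    using A by (simp add: K_def mult.assoc)
  then have "r' * E' * q' * p' * (p * q * E * r * (H3 * a * H1)) = r' * E' * q' * p' * (p * q * E * r * (a * q' * H4 * K * q))"
    by simp
  then have main: "H3 * a * H1 = a * q' * H4 * K * q" by (simp add: mult.assoc inv invs)
  define e1 e2 e3 e4 k where "e1 = H1 - 1" and "e2 = H2 - 1" and "e3 = H3 - 1" and "e4 = H4 - 1" and "k = K - 1"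
  have e: "e1 \<in> fil n" "e2 \<in> fil n" "e3 \<in> fil n" "e4 \<in> fil n" using H by (simp_all add: e1_def e2_def e3_def e4_def)
  have k: "k = T1' * (p' * b * e2 * b' * p) * T1"
    by (simp add: k_def K_def e2_def algebra_simps inv invs)
  have "p' * b * e2 * b' * p - e2 \<in> fil (Suc n)"
  proof -
    have "p' * b - 1 \<in> fil 1" "b' * p - 1 \<in> fil 1" by (intro unipotent_mult uni)+
    from fil_trans[OF unipotent_mult_fil(2)[OF this(2) fil_mult_left[OF e(2), of "p' * b"]] unipotent_mult_fil(1)[OF this(1) e(2)]]
    show ?thesis by (simp only: mult.assoc)
  qed
  then have "T1' * (p' * b * e2 * b' * p - e2) * T1 \<in> fil (Suc n)" by (intro fil_mult_left fil_mult_right)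
  then have k': "k - T1' * e2 * T1 \<in> fil (Suc n)" by (simp add: k algebra_simps)
  have kn: "k \<in> fil n" unfolding k by (intro fil_mult_left fil_mult_right e)
  have "e3 * a + (a * e1 + e3 * (a * e1)) = a * q' * (e4 + k + e4 * k) * q"
  proof -
    have "H3 * a * H1 - a = e3 * a + (a * e1 + e3 * (a * e1))" by (simp add: e1_def e3_def algebra_simps)
    moreover have "H4 = 1 + e4" "K = 1 + k" by (simp_all add: e4_def k_def)
    then have "a * q' * H4 * K * q - a * (q' * q) = a * q' * (e4 + k + e4 * k) * q"
      by (simp add: algebra_simps)
    ultimately show ?thesis using main inv by simp
  qed
  define w where "w = e4 + k + e4 * k"
  \<comment> \<open>Here n > 0 enters: a product of two defects has degree 2n, at least n + 1.
    Unipotent factors around a defect also matter only from degree n + 1 on; \<open>T1\<close> is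
    kept in the result because no unipotency is assumed of it.\<close>
  have small: "x * y \<in> fil (Suc n)" if "x \<in> fil n" "y \<in> fil n" for x y :: 'a
    using fil_mult[OF that] fil_antimono[of "Suc n" "n + n"] n by auto
  have w: "w \<in> fil n" unfolding w_def by (intro fil_add e kn fil_mult_left)
  have "w - (e4 + T1' * e2 * T1) \<in> fil (Suc n)"
    using fil_add[OF k' small[OF e(4) kn]] by (simp add: w_def algebra_simps)
  moreover have "a * q' * w * q - w \<in> fil (Suc n)"
    using unipotent_mult_fil(2)[OF uni(7) fil_mult_left[OF w, of "a * q'"]] unipotent_mult_fil(1)[OF unipotent_mult[OF uni(1,8)] w]
    by (rule fil_trans)
  moreover have "(e3 + e1) - (e3 * a + (a * e1 + e3 * (a * e1))) \<in> fil (Suc n)"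
  proof -
    have "(e3 * a - e3) + (a * e1 - e1) + e3 * (a * e1) \<in> fil (Suc n)"
      by (intro fil_add unipotent_mult_fil uni e small fil_mult_left)
    from fil_uminus[OF this] show ?thesis by (simp add: algebra_simps)
  qed
  ultimately have "(e3 + e1) - (e4 + T1' * e2 * T1) \<in> fil (Suc n)"
    using \<open>e3 * a + (a * e1 + e3 * (a * e1)) = a * q' * (e4 + k + e4 * k) * q\<close>
    unfolding w_def by (metis fil_trans)
  then show ?thesis unfolding e1_def e2_def e3_def e4_def by (simp add: algebra_simps)
qed

end

section \<open>Hexagons in representations of the braid group\<close>

context braid_rep
begin

abbreviation (input) "t1 \<equiv> s S1"
abbreviation (input) "t2 \<equiv> s S2"
abbreviation (input) "t3 \<equiv> s S3"

text \<open>
  \<open>y\<^sub>i\<^sub>j\<close> is \<open>x\<^sub>i\<^sub>j\<close> in another form: \<open>\<sigma>\<^sub>2 \<sigma>\<^sub>1\<^sup>2 \<sigma>\<^sub>2\<^sup>-\<^sup>1 = \<sigma>\<^sub>1\<^sup>-\<^sup>1 \<sigma>\<^sub>2\<^sup>2 \<sigma>\<^sub>1\<close>, and \<open>y134\<close> is \<open>x\<^sub>1\<^sub>3 x\<^sub>1\<^sub>4\<close>.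
\<close>

definition y13 :: 'a where "y13 = s' S1 * (t2 * t2) * t1"
definition y24 :: 'a where "y24 = s' S2 * (t3 * t3) * t2"
definition y14 :: 'a where "y14 = s' S1 * y24 * t1"
definition y134 :: 'a where "y134 = s' S1 * (t2 * t3 * t3 * t2) * t1"

text \<open>The full twist of string 1 around the bundle of strings 2, 3, 4.\<close>

definition x1_234 :: 'a where "x1_234 = t1 * t2 * t3 * t3 * t2 * t1"

section \<open>Word identities in the braid group on four strings\<close>

lemma braid_words:
  "t1 * t3 = t3 * t1" "t1 * (t2 * t1) = t2 * (t1 * t2)" "t2 * (t3 * t2) = t3 * (t2 * t3)"
  using comm13 braid12 braid23 by (simp_all only: mult.assoc)

lemma braid_words2:
  "t1 * (t2 * (t3 * t1)) = t2 * (t1 * (t2 * t3))"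
  "t1 * (t2 * (t2 * (t1 * t2))) = t2 * (t1 * (t2 * (t2 * t1)))"
  "t2 * (t3 * (t3 * (t2 * t3))) = t3 * (t2 * (t3 * (t3 * t2)))"
proof -
  show "t1 * (t2 * (t3 * t1)) = t2 * (t1 * (t2 * t3))"
    by (simp only: braid_words(1)[symmetric] braid_assoc(2))
  have "t1 * (t2 * (t2 * (t1 * t2))) = t1 * (t2 * (t1 * (t2 * t1)))" by (simp only: braid_words(2)[symmetric])
  then show "t1 * (t2 * (t2 * (t1 * t2))) = t2 * (t1 * (t2 * (t2 * t1)))" by (simp only: braid_assoc(2))
  have "t2 * (t3 * (t3 * (t2 * t3))) = t2 * (t3 * (t2 * (t3 * t2)))" by (simp only: braid_words(3)[symmetric])
  then show "t2 * (t3 * (t3 * (t2 * t3))) = t3 * (t2 * (t3 * (t3 * t2)))" by (simp only: braid_assoc(3))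
qed

lemma braid_words3:
  "t1 * (t2 * (t2 * (t2 * (t1 * t2)))) = t2 * (t1 * (t2 * (t2 * (t1 * t1))))"
  "t2 * (t3 * (t3 * (t3 * (t2 * t3)))) = t3 * (t2 * (t3 * (t3 * (t2 * t2))))"
  "t1 * (t2 * (t3 * (t3 * (t2 * (t1 * t2))))) = t2 * (t1 * (t2 * (t3 * (t3 * (t2 * t1)))))"
proof -
  have "t1 * (t2 * (t2 * (t2 * (t1 * t2)))) = t1 * (t2 * (t2 * (t1 * (t2 * t1))))" by (simp only: braid_words(2)[symmetric])
  also have "\<dots> = t2 * (t1 * (t2 * (t2 * (t1 * t1))))" by (simp only: braid_words2(2)[THEN assoc_rule, unfolded mult.assoc])
  finally show "t1 * (t2 * (t2 * (t2 * (t1 * t2)))) = t2 * (t1 * (t2 * (t2 * (t1 * t1))))" .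
  have "t2 * (t3 * (t3 * (t3 * (t2 * t3)))) = t2 * (t3 * (t3 * (t2 * (t3 * t2))))" by (simp only: braid_words(3)[symmetric])
  also have "\<dots> = t3 * (t2 * (t3 * (t3 * (t2 * t2))))" by (simp only: braid_words2(3)[THEN assoc_rule, unfolded mult.assoc])
  finally show "t2 * (t3 * (t3 * (t3 * (t2 * t3)))) = t3 * (t2 * (t3 * (t3 * (t2 * t2))))" .
  have "t1 * (t2 * (t3 * (t3 * (t2 * (t1 * t2))))) = t1 * (t2 * (t3 * (t3 * (t1 * (t2 * t1)))))"
    by (simp only: braid_words(2)[symmetric])
  also have "\<dots> = t1 * (t2 * (t1 * (t3 * (t3 * (t2 * t1)))))" by (simp only: braid_assoc(1))
  also have "\<dots> = t2 * (t1 * (t2 * (t3 * (t3 * (t2 * t1)))))" by (simp only: braid_assoc(2))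
  finally show "t1 * (t2 * (t3 * (t3 * (t2 * (t1 * t2))))) = t2 * (t1 * (t2 * (t3 * (t3 * (t2 * t1)))))" .
qed

lemmas braid_rules = braid_words3 braid_words3[THEN assoc_rule, unfolded mult.assoc] braid_words braid_assoc braid_words2 braid_words2[THEN assoc_rule, unfolded mult.assoc]

text \<open>Naturality of the braiding: carrying one string past a bundle shifts the crossings
  inside the bundle by one place.\<close>

lemma delta_words:
  "t2 * t1 * t2 = t1 * (t2 * t1)" "t3 * t2 * t3 = t2 * (t3 * t2)"
  "t3 * t2 * t1 * t2 = t1 * (t3 * t2 * t1)" "t3 * t2 * t1 * t3 = t2 * (t3 * t2 * t1)"
  by (simp_all add: mult.assoc braid_rules)

text \<open>A full twist of one string around a bundle commutes with crossings inside the bundle.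
  The last identity expresses the full twist on strings 2, 3, 4 in two ways.\<close>

lemma commuting_words:
  "t2 * (t1 * t2 * t2 * t1) = t1 * t2 * t2 * t1 * t2" "t1 * (t2 * t1 * t1 * t2) = t2 * t1 * t1 * t2 * t1"
  "t2 * (t3 * t2 * t2 * t3) = t3 * t2 * t2 * t3 * t2" "t3 * (t2 * t3 * t3 * t2) = t2 * t3 * t3 * t2 * t3"
  "t2 * x1_234 = x1_234 * t2" "t3 * x1_234 = x1_234 * t3"
  "t2 * t2 * (t3 * t2 * t2 * t3) = t2 * t3 * t3 * t2 * (t3 * t3)"
  unfolding x1_234_def
  by (simp_all add: mult.assoc braid_rules)

lemma y_words:
  "t1 * y13 = t2 * t2 * t1" "t2 * y24 = t3 * t3 * t2" "t1 * y14 = y24 * t1" "t1 * y134 = t2 * t3 * t3 * t2 * t1"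
  "t2 * t1 * y14 = t3 * t3 * (t2 * t1)"
  "t1 * t1 * y13 = t1 * t2 * t2 * t1" "t2 * t2 * y24 = t2 * t3 * t3 * t2"
  "t1 * t1 * y134 = x1_234" "t1 * t2 * t2 * t1 * y14 = x1_234" "y13 * y14 = y134"
  by (simp_all add: y13_def y24_def y14_def y134_def x1_234_def mult.assoc inverse_assoc)

lemma commute_inverse: "s g * c = c * s g \<Longrightarrow> s' g * c = c * s' g"
  using intertwine_inverse[of c "s g" "s g" "s' g" "s' g"] inverse by simp

lemma commute_mult: "a * c = c * a \<Longrightarrow> b * c = c * b \<Longrightarrow> a * b * c = c * (a * (b :: 'a))"
  using intertwine_mult[of c a a b b] by simp

lemma s_cancel_left: "s g * a = s g * b \<Longrightarrow> a = b"
  using inverse_assoc(2)[of g a] inverse_assoc(2)[of g b] by metis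

text \<open>Here \<open>c\<close> is the full twist on strings 1, 2, 3, so it commutes with both
  crossings of these strings; the inverse inside \<open>y13\<close> is handled by
  \<open>commute_inverse\<close>.\<close>

lemma central3:
  defines "c \<equiv> t1 * t1 * y13 * (t2 * t2)"
  shows "c * (t1 * t1) = t1 * t1 * c" "c * y13 = y13 * c"
proof -
  have c: "c = t1 * t2 * t2 * t1 * (t2 * t2)" unfolding c_def by (simp only: y_words)
  have "t1 * c = c * t1" "t2 * c = c * t2" unfolding c by (simp_all add: mult.assoc braid_rules)
  then show "c * (t1 * t1) = t1 * t1 * c" "c * y13 = y13 * c"
    unfolding y13_def by (simp_all only: commute_mult commute_inverse)
qed

lemma central3':
  defines "c \<equiv> t2 * t2 * y24 * (t3 * t3)"
  shows "c * (t2 * t2) = t2 * t2 * c" "c * y24 = y24 * c"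
proof -
  have c: "c = t2 * t3 * t3 * t2 * (t3 * t3)" unfolding c_def by (simp only: y_words)
  have "t2 * c = c * t2" "t3 * c = c * t3" unfolding c by (simp_all add: mult.assoc braid_rules)
  then show "c * (t2 * t2) = t2 * t2 * c" "c * y24 = y24 * c"
    unfolding y24_def by (simp_all only: commute_mult commute_inverse)
qed

lemma t1_commute: "t1 * (x1_234 * (t2 * t3 * t3 * t2)) = x1_234 * (t2 * t3 * t3 * t2) * t1"
proof -
  define u where "u = t2 * t3 * t3 * t2"
  have x: "x1_234 = t1 * u * t1" by (simp add: x1_234_def u_def mult.assoc)
  have "u * x1_234 = x1_234 * u"
    unfolding u_def by (intro commute_mult commuting_words)
  then have "t1 * (x1_234 * u) = t1 * (u * x1_234)" by simp
  also have "\<dots> = x1_234 * u * t1" by (simp only: x mult.assoc)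
  finally show ?thesis unfolding u_def .
qed

text \<open>The bundles are 1, 2 and 34; here \<open>c\<close> consists of the twist of 1 around 234
  and that of 2 around 34.\<close>

lemma central_iii:
  defines "c \<equiv> t1 * t1 * y134 * (t2 * t3 * t3 * t2)"
  shows "c * (t1 * t1) = t1 * t1 * c" "c * y134 = y134 * c"
proof -
  define u where "u = t2 * t3 * t3 * t2"
  have c: "c = x1_234 * u" unfolding c_def u_def by (simp only: y_words)
  have "u * x1_234 = x1_234 * u"
    unfolding u_def by (intro commute_mult commuting_words)
  then have "u * c = c * u" unfolding c by (intro intertwine_mult HOL.refl)
  moreover have "t1 * c = c * t1" using t1_commute by (simp only: c u_def)
  ultimately show "c * (t1 * t1) = t1 * t1 * c" "c * y134 = y134 * c"
    unfolding y134_def u_def[symmetric] by (simp_all only: commute_mult commute_inverse)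
qed

text \<open>The bundles are 1, 23 and 4. The element \<open>c\<close> lacks the twist inside the
  bundle 23; multiplied by \<open>t2 * t2\<close> it becomes the full twist on all four strings,
  whose commutation can be checked on generators.\<close>

lemma central_ii:
  defines "x \<equiv> t1 * t2 * t2 * t1"
  defines "c \<equiv> x * y14 * (t3 * t2 * t2 * t3)"
  shows "c * x = x * c" "c * y14 = y14 * c"
proof -
  define v where "v = t3 * t2 * t2 * t3"
  define w where "w = t2 * t2 * c"
  have c: "c = x1_234 * v" unfolding c_def x_def v_def by (simp only: y_words)
  have tt: "t2 * x1_234 = x1_234 * t2" "t3 * x1_234 = x1_234 * t3" by (rule commuting_words)+
  have w: "w = x1_234 * (t2 * t3 * t3 * t2) * (t3 * t3)"
  proof -
    have "t2 * t2 * x1_234 = x1_234 * (t2 * t2)" by (intro commute_mult tt)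
    then have "t2 * t2 * x1_234 * v = x1_234 * (t2 * t2) * v" by simp
    then have "w = x1_234 * (t2 * t2 * v)" unfolding w_def c by (simp only: mult.assoc)
    then show ?thesis unfolding v_def commuting_words by (simp only: mult.assoc)
  qed
  have "t1 * w = w * t1" unfolding w by (intro intertwine_mult[of t1] t1_commute comm13)
  moreover have "t2 * w = w * t2"
  proof -
    have "t2 * (t2 * t3 * t3 * t2 * (t3 * t3)) = t2 * t3 * t3 * t2 * (t3 * t3) * t2"
      by (simp add: mult.assoc braid_rules)
    then have "t2 * (x1_234 * (t2 * t3 * t3 * t2 * (t3 * t3))) = x1_234 * (t2 * t3 * t3 * t2 * (t3 * t3)) * t2"
      by (rule intertwine_mult[OF tt(1)])
    then show ?thesis unfolding w by (simp only: mult.assoc)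
  qed
  ultimately have "x * w = w * x" unfolding x_def by (simp only: commute_mult)
  then have "t2 * (t2 * (c * x)) = x * (t2 * t2) * c" unfolding w_def by (simp only: mult.assoc)
  also have "x * (t2 * t2) = t2 * t2 * x"
    using commuting_words(1) unfolding x_def by (intro intertwine_mult) (simp_all only:)
  finally have "t2 * (t2 * (c * x)) = t2 * (t2 * (x * c))" by (simp only: mult.assoc)
  then show cx: "c * x = x * c" using s_cancel_left by blast
  have vt: "v * x1_234 = x1_234 * v" unfolding v_def by (intro commute_mult tt)
  have xy: "x * y14 = x1_234" unfolding x_def by (rule y_words)
  \<comment> \<open>Commutation with \<open>y14\<close> is deduced from that with \<open>x\<close>
    and with the product \<open>x * y14\<close>, which is \<open>x1_234\<close>; then
    \<open>x\<close> is cancelled.\<close>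
  have "x * (c * y14) = c * x * y14" by (simp only: cx mult.assoc)
  also have "\<dots> = x1_234 * (v * x1_234)" by (simp only: mult.assoc xy) (simp only: c mult.assoc)
  also have "\<dots> = x * (y14 * c)" by (simp only: vt mult.assoc[symmetric] xy) (simp only: c mult.assoc)
  finally have "x * (c * y14) = x * (y14 * c)" .
  then have "t1 * (t2 * (t2 * (t1 * (c * y14)))) = t1 * (t2 * (t2 * (t1 * (y14 * c))))"
    unfolding x_def by (simp only: mult.assoc)
  then show "c * y14 = y14 * c" using s_cancel_left by blast
qed

lemma conj_unipotent: "c - 1 \<in> fil 1 \<Longrightarrow> s' g * c * s g - 1 \<in> fil 1"
proof -
  assume c: "c - 1 \<in> fil 1"
  have "s' g * c * s g - 1 = s' g * (c - 1) * s g" by (simp add: algebra_simps inverse)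
  then show ?thesis using c by (simp only: fil_mult_left fil_mult_right)
qed

lemma words_unipotent:
  "t1 * t1 - 1 \<in> fil 1" "t2 * t2 - 1 \<in> fil 1" "t3 * t3 - 1 \<in> fil 1"
  "t1 * t2 * t2 * t1 - 1 \<in> fil 1" "t2 * t1 * t1 * t2 - 1 \<in> fil 1"
  "t2 * t3 * t3 * t2 - 1 \<in> fil 1" "t3 * t2 * t2 * t3 - 1 \<in> fil 1"
  "y13 - 1 \<in> fil 1" "y24 - 1 \<in> fil 1" "y14 - 1 \<in> fil 1" "y134 - 1 \<in> fil 1" "x1_234 - 1 \<in> fil 1"
proof -
  show sq: "t1 * t1 - 1 \<in> fil 1" "t2 * t2 - 1 \<in> fil 1" "t3 * t3 - 1 \<in> fil 1" by (rule square_unipotent)+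
  show words: "t1 * t2 * t2 * t1 - 1 \<in> fil 1" "t2 * t1 * t1 * t2 - 1 \<in> fil 1"
    "t2 * t3 * t3 * t2 - 1 \<in> fil 1" "t3 * t2 * t2 * t3 - 1 \<in> fil 1"
    using pure_val_unipotent[of "x12 + x13"] pure_val_unipotent[of "x13 + x23"]
      pure_val_unipotent[of "x23 + x24"] pure_val_unipotent[of "x24 + x34"] by (simp_all only: pure_val_gens)
  show y: "y13 - 1 \<in> fil 1" "y24 - 1 \<in> fil 1" "y134 - 1 \<in> fil 1"
    unfolding y13_def y24_def y134_def by (intro conj_unipotent sq words)+
  then show "y14 - 1 \<in> fil 1" unfolding y14_def by (intro conj_unipotent)
  have "t1 * t1 * y134 - 1 \<in> fil 1" by (intro unipotent_mult sq y)
  then show "x1_234 - 1 \<in> fil 1" by (simp only: y_words)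
qed

definition braid_pentagon :: "'k ncfps \<Rightarrow> bool" where
  "braid_pentagon F \<longleftrightarrow>
    nc_eval \<iota> F (t1 * t1) (t2 * t3 * t3 * t2) * nc_eval \<iota> F (t2 * t1 * t1 * t2) (t3 * t3)
    = nc_eval \<iota> F (t2 * t2) (t3 * t3) * nc_eval \<iota> F (t1 * t2 * t2 * t1) (t3 * t2 * t2 * t3)
      * nc_eval \<iota> F (t1 * t1) (t2 * t2)"

text \<open>The four hexagons carry string 1 past 2 and 3, past 23 and 4, past 2 and 34, and, once
  it has passed 2, past 3 and 4. The last one occurs in the polytope one place further to the right
  and has to be conjugated back.\<close>

theorem hexagon_cocycle:
  assumes F: "F \<in> dual_series" and pent: "braid_pentagon F"
    and n: "0 < n" and H: "ncfps.hex F m nc_x nc_y - 1 \<in> fil n"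
  shows "(hex F m (t1 * t1) y13 - 1) + (hex F m (t1 * t2 * t2 * t1) y14 - 1)
    - ((hex F m (t1 * t1) y134 - 1) + (hex F m y13 y14 - 1)) \<in> fil (Suc n)"
proof -
  note W = words_unipotent
  define a b p q r where "a = nc_eval \<iota> F (t1 * t1) (t2 * t2)" and "b = nc_eval \<iota> F (t2 * t2) (t3 * t3)"
    and "p = nc_eval \<iota> F (t1 * t1) (t2 * t3 * t3 * t2)" and "q = nc_eval \<iota> F (t2 * t1 * t1 * t2) (t3 * t3)"
    and "r = nc_eval \<iota> F (t1 * t2 * t2 * t1) (t3 * t2 * t2 * t3)"
  define a' b' p' q' r' where "a' = nc_eval \<iota> F (t2 * t2) (t1 * t1)" and "b' = nc_eval \<iota> F (t3 * t3) (t2 * t2)"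
    and "p' = nc_eval \<iota> F (t2 * t3 * t3 * t2) (t1 * t1)" and "q' = nc_eval \<iota> F (t3 * t3) (t2 * t1 * t1 * t2)"
    and "r' = nc_eval \<iota> F (t3 * t2 * t2 * t3) (t1 * t2 * t2 * t1)"
  note defs = a_def b_def p_def q_def r_def a'_def b'_def p'_def q'_def r'_def
  define u where "u \<alpha> = alg_pow \<iota> \<alpha> m" for \<alpha>
  \<comment> \<open>Braidings of two single strings, of one string past two, and of one string past
    three; each is a half-braiding times the m-th power of the corresponding full twist.\<close>
  define T1 T2 T3 C C' E where "T1 = t1 * u (t1 * t1)" and "T2 = t2 * u (t2 * t2)" and "T3 = t3 * u (t3 * t3)"
    and "C = t2 * t1 * u (t1 * t2 * t2 * t1)" and "C' = t3 * t2 * u (t2 * t3 * t3 * t2)"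
    and "E = t3 * t2 * t1 * u x1_234"
  define T1' E' where "T1' = alg_pow \<iota> (t1 * t1) (- m) * s' S1"
    and "E' = alg_pow \<iota> x1_234 (- m) * (s' S1 * (s' S2 * s' S3))"
  have F0: "nc_coeff F [] = 1" using F by (simp add: dual_series_def F2'_def F2_def)
  have inv: "a * a' = 1" "a' * a = 1" "b * b' = 1" "b' * b = 1" "p * p' = 1" "p' * p = 1" "q * q' = 1" "q' * q = 1" "r * r' = 1" "r' * r = 1"
    unfolding defs by (intro nc_eval_dual[OF F] W)+
  have inv_pow: "u \<alpha> * (alg_pow \<iota> \<alpha> (- m) * z) = z" "alg_pow \<iota> \<alpha> (- m) * (u \<alpha> * z) = z"
    "u \<alpha> * alg_pow \<iota> \<alpha> (- m) = 1" "alg_pow \<iota> \<alpha> (- m) * u \<alpha> = 1" if "\<alpha> - 1 \<in> fil 1" for \<alpha> z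
    using alg_pow_neg[OF that, of m] by (simp_all add: u_def flip: mult.assoc)
  have inv': "E' * E = 1" "T1 * T1' = 1" "T1' * T1 = 1"
    by (simp_all add: E_def E'_def T1_def T1'_def mult.assoc inverse inverse_assoc inv_pow W del: One_nat_def)
  have uni: "a - 1 \<in> fil 1" "a' - 1 \<in> fil 1" "b - 1 \<in> fil 1" "b' - 1 \<in> fil 1" "p - 1 \<in> fil 1" "p' - 1 \<in> fil 1" "q - 1 \<in> fil 1" "q' - 1 \<in> fil 1"
    unfolding defs by (intro nc_eval_unipotent F0 W)+
  have hex: "hex F m \<alpha> \<beta> - 1 \<in> fil n" if "\<alpha> - 1 \<in> fil 1" "\<beta> - 1 \<in> fil 1" for \<alpha> \<beta>
  proof -
    interpret h: continuous_hom nc_const \<iota> "\<lambda>F. nc_eval \<iota> F \<alpha> \<beta>" by (rule nc_eval_hom[OF that])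
    show ?thesis using h.hom_fil[OF H] by (simp add: nc_eval_diff_one[OF that] hex_eq_nc_eval[OF that])
  qed
  have d2: "t2 * t1 * t2 = t1 * (t2 * t1)" "t3 * t2 * t3 = t2 * (t3 * t2)" by (rule delta_words)+
  have d3: "t3 * t2 * t1 * t2 = t1 * (t3 * t2 * t1)" "t3 * t2 * t1 * t3 = t2 * (t3 * t2 * t1)" by (rule delta_words)+
  have y13: "t2 * t1 * y13 = t2 * t2 * (t2 * t1)" and y24: "t3 * t2 * y24 = t3 * t3 * (t3 * t2)"
    and y14: "t3 * (t2 * t1) * y14 = t3 * t3 * (t3 * (t2 * t1))"
    and y134: "t3 * t2 * t1 * y134 = t3 * t2 * t2 * t3 * (t3 * t2 * t1)"
    using arg_cong[OF y_words(1), of "\<lambda>z. t2 * z"] arg_cong[OF y_words(2), of "\<lambda>z. t3 * z"]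
      arg_cong[OF y_words(5), of "\<lambda>z. t3 * z"] arg_cong[OF y_words(4), of "\<lambda>z. t3 * t2 * z"]
    by (simp_all only: mult.assoc)
  have assoc: "g * (g * g) = g * g * g" "t2 * t1 * (t1 * t2 * t2 * t1) = t2 * t1 * t1 * t2 * (t2 * t1)" for g :: 'a
    by (simp_all only: mult.assoc)
  have "t3 * (t2 * t1) * (t3 * t2 * t2 * t3) = t2 * t1 * t1 * t2 * (t3 * (t2 * t1))"
    using intertwine_mult[OF intertwine_mult[OF intertwine_mult[OF d3(2,1)] d3(1)] d3(2)] by (simp only: mult.assoc)
  note move3 = this
  have h1: "a * C * a * hex F m (t1 * t1) y13 = T2 * a * T1"
    unfolding a_def C_def T1_def T2_def u_def
    by (rule hex_move[OF F W(1) W(8) W(2) W(1) W(2) W(1) W(2) central3 assoc(1) y_words(1)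
        intertwine_mult[OF d2(1) d2(1)] y13, of m, unfolded y_words(6)])
  have h2: "b * C' * b * hex F m (t2 * t2) y24 = T3 * b * T2"
    unfolding b_def C'_def T2_def T3_def u_def
    by (rule hex_move[OF F W(2) W(9) W(3) W(2) W(3) W(2) W(3) central3' assoc(1) y_words(2)
        intertwine_mult[OF d2(2) d2(2)] y24, of m, unfolded y_words(7)])
  have h3: "q * E * r * hex F m (t1 * t2 * t2 * t1) y14 = T3 * q * C"
    unfolding q_def r_def E_def T3_def C_def u_def
    using hex_move[OF F W(4) W(10) W(7) W(5) W(3) W(5) W(3) central_ii assoc(2) y_words(5)
        move3 y14, of m, unfolded y_words(9)]
    by (simp only: mult.assoc)
  have h4: "r * E * p * hex F m (t1 * t1) y134 = C' * p * T1"
    unfolding r_def E_def p_def C'_def T1_def u_def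
    by (rule hex_move[OF F W(1) W(11) W(6) W(1) W(6) W(4) W(7) central_iii assoc(1) y_words(4)
        intertwine_mult[OF intertwine_mult[OF intertwine_mult[OF d3] d3(2)] d3(1)] y134, of m, unfolded y_words(8)])
  have nat: "E * b = a * E" "T2 * r = r * T2" "T3 * p = p * T3" "T1 * q = q * T1"
  proof -
    have pow: "u \<alpha> * e = e * u \<alpha>" if "\<alpha> - 1 \<in> fil 1" "e * \<alpha> = \<alpha> * e" for \<alpha> e
      using intertwine_pow[OF that(1) that(1) that(2)] by (simp add: u_def)
    have comp: "g * h * c = c2 * (g * h)" if "h * c = c1 * h" "g * c1 = c2 * g" for g h c c1 c2 :: 'a
      using that by (metis mult.assoc)
    have "x1_234 * b = b * x1_234"
      unfolding b_def by (intro intertwine_nc_eval W commute_mult[symmetric] commuting_words)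
    then have "u x1_234 * b = b * u x1_234" by (intro pow W) simp
    moreover have "t3 * t2 * t1 * b = a * (t3 * t2 * t1)"
      unfolding a_def b_def by (intro intertwine_nc_eval W intertwine_mult d3)
    ultimately show "E * b = a * E" unfolding E_def by (rule comp)
    have r: "t2 * r = r * t2"
      unfolding r_def by (intro intertwine_nc_eval W) (simp_all only: commuting_words)
    moreover have "u (t2 * t2) * r = r * u (t2 * t2)"
      using r by (intro pow W) (simp only: commute_mult)
    ultimately show "T2 * r = r * T2" unfolding T2_def by (intro comp)
    have p: "t3 * p = p * t3"
      unfolding p_def by (intro intertwine_nc_eval W) (simp_all only: commuting_words intertwine_mult comm13[symmetric])
    moreover have "u (t3 * t3) * p = p * u (t3 * t3)"
      using p by (intro pow W) (simp only: commute_mult)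
    ultimately show "T3 * p = p * T3" unfolding T3_def by (intro comp)
    have q: "t1 * q = q * t1"
      unfolding q_def by (intro intertwine_nc_eval W) (simp_all only: commuting_words intertwine_mult comm13)
    moreover have "u (t1 * t1) * q = q * u (t1 * t1)"
      using q by (intro pow W) (simp only: commute_mult)
    ultimately show "T1 * q = q * T1" unfolding T1_def by (intro comp)
  qed
  have "(hex F m (t1 * t1) y13 - 1) + (hex F m (t1 * t2 * t2 * t1) y14 - 1)
    - ((hex F m (t1 * t1) y134 - 1) + T1' * (hex F m (t2 * t2) y24 - 1) * T1) \<in> fil (Suc n)"
    using pent unfolding braid_pentagon_def
    by (intro hexagon_syzygy[OF h1 h2 h3 h4 nat _ inv inv' uni n] hex W) (simp add: defs)
  \<comment> \<open>The factor sigma_1 of \<open>T1\<close> carries the shifted hexagon back to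
    (\<open>y13\<close>, \<open>y14\<close>); its unipotent factor is invisible modulo degree n +
    1.\<close>
  moreover have "T1' * (hex F m (t2 * t2) y24 - 1) * T1 - (hex F m y13 y14 - 1) \<in> fil (Suc n)"
  proof -
    have "t1 * hex F m y13 y14 = hex F m (t2 * t2) y24 * t1"
      by (intro intertwine_hex W y_words)
    then have eq: "(hex F m (t2 * t2) y24 - 1) * t1 = t1 * (hex F m y13 y14 - 1)" by (simp add: algebra_simps)
    have "T1' * (hex F m (t2 * t2) y24 - 1) * T1
        = alg_pow \<iota> (t1 * t1) (- m) * (s' S1 * ((hex F m (t2 * t2) y24 - 1) * t1)) * u (t1 * t1)"
      unfolding T1_def T1'_def by (simp only: mult.assoc)
    then have "T1' * (hex F m (t2 * t2) y24 - 1) * T1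
        = alg_pow \<iota> (t1 * t1) (- m) * (hex F m y13 y14 - 1) * u (t1 * t1)"
      by (simp only: eq inverse_assoc)
    moreover have "alg_pow \<iota> (t1 * t1) (- m) * (hex F m y13 y14 - 1) * u (t1 * t1) - (hex F m y13 y14 - 1) \<in> fil (Suc n)"
      using unipotent_mult_fil(2)[OF alg_pow_fil[OF W(1), of m] fil_mult_left[OF hex[OF W(8,10)], of "alg_pow \<iota> (t1 * t1) (- m)"]]
        unipotent_mult_fil(1)[OF alg_pow_fil[OF W(1), of "- m"] hex[OF W(8,10)]]
      unfolding u_def by (rule fil_trans)
    ultimately show ?thesis by simp
  qed
  ultimately have "((hex F m (t1 * t1) y13 - 1) + (hex F m (t1 * t2 * t2 * t1) y14 - 1)
      - ((hex F m (t1 * t1) y134 - 1) + T1' * (hex F m (t2 * t2) y24 - 1) * T1))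
    + (T1' * (hex F m (t2 * t2) y24 - 1) * T1 - (hex F m y13 y14 - 1)) \<in> fil (Suc n)"
    by (rule fil_add)
  moreover have "\<alpha> - (\<beta> + \<gamma>) + (\<gamma> - \<delta>) = \<alpha> - (\<beta> + \<delta>)" for \<alpha> \<beta> \<gamma> \<delta> :: 'a by simp
  ultimately show ?thesis by (simp only:)
qed

end

text \<open>After the collapse three of the five associators have commuting arguments and are equal
  to 1.\<close>

lemma dual_in_rep:
  fixes F :: "'k::field_char_0 ncfps"
  assumes "braid_rep \<iota> s" and F: "F \<in> F2'" and pent: "braid_rep.braid_pentagon \<iota> s F" and "s S3 = s S1"
  shows "nc_eval \<iota> F (s S2 * s S2) (s S1 * s S1) * nc_eval \<iota> F (s S1 * s S1) (s S2 * s S2) = 1"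
proof -
  interpret braid_rep \<iota> s by (rule assms)
  note W = words_unipotent
  have comm: "s S1 * s S1 * (s S2 * s S1 * s S1 * s S2) = s S2 * s S1 * s S1 * s S2 * (s S1 * s S1)"
    by (intro commute_mult commuting_words)
  have "nc_eval \<iota> F (s S1 * s S1) (s S2 * s S1 * s S1 * s S2) = 1"
    "nc_eval \<iota> F (s S2 * s S1 * s S1 * s S2) (s S1 * s S1) = 1"
    "nc_eval \<iota> F (s S1 * s S2 * s S2 * s S1) (s S1 * s S2 * s S2 * s S1) = 1"
    by (intro nc_eval_commuting F W comm comm[symmetric] HOL.refl)+
  then show ?thesis using pent unfolding braid_pentagon_def assms(4) by simp
qed

context braid_rep
begin

text \<open>The square of sigma_2 is not one of the free generators, but up to the full twist
  \<open>c\<close>, which commutes with x12 and x13, it is the inverse of their product; f does not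
  see the factor \<open>c\<close>.\<close>

lemma dual_conj:
  assumes F: "F \<in> F2'"
    and dual: "nc_eval \<iota> F (t2 * t2) (t1 * t1) * nc_eval \<iota> F (t1 * t1) (t2 * t2) = 1"
  defines "z \<equiv> alg_pow \<iota> (t1 * t1 * y13) (- 1)"
  shows "nc_eval \<iota> F z (t1 * t1) * nc_eval \<iota> F (t1 * t1) z = 1"
proof -
  note W = words_unipotent
  define c where "c = t1 * t1 * y13 * (t2 * t2)"
  have xy: "t1 * t1 * y13 - 1 \<in> fil 1" by (intro unipotent_mult W)
  have z: "z - 1 \<in> fil 1" unfolding z_def by (intro alg_pow_fil xy)
  have c: "c - 1 \<in> fil 1" unfolding c_def by (intro unipotent_mult W)
  have cc: "c * (t1 * t1) = t1 * t1 * c" "c * y13 = y13 * c"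
    unfolding c_def by (rule central3)+
  have "c * (t1 * t1 * y13) = t1 * t1 * y13 * c" by (intro intertwine_mult[of c "t1 * t1"] cc)
  then have cz: "c * z = z * c" unfolding z_def by (intro intertwine_pow xy)
  have eq: "t2 * t2 = z * c"
    using unipotent_inverse(2)[OF xy] by (simp add: c_def z_def flip: mult.assoc)
  have "nc_eval \<iota> F (t2 * t2) (t1 * t1) = nc_eval \<iota> F z (t1 * t1)"
    "nc_eval \<iota> F (t1 * t1) (t2 * t2) = nc_eval \<iota> F (t1 * t1) z"
    unfolding eq by (intro nc_eval_central_left nc_eval_central_right F W z c cz[symmetric] cc(1)[symmetric])+
  then show ?thesis using dual by simp
qed

end

text \<open>
  The representation \<open>bt\<close> factors through the homomorphism from the braid group on four strings to
  that on three which sends \<open>\<sigma>\<^sub>3\<close> to \<open>\<sigma>\<^sub>1\<close>; by \<open>dual_in_rep\<close> the pentagon collapses under it.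
\<close>

definition bs :: "artin_gen \<Rightarrow> 'k::field_char_0 bop" where "bs = case_artin_gen bs1 bs2 bs3"
definition bt :: "artin_gen \<Rightarrow> 'k::field_char_0 bop" where "bt = case_artin_gen bs1 bs2 bs1"

interpretation bs: braid_rep bop_scalar "bs :: artin_gen \<Rightarrow> 'k::field_char_0 bop"
proof
  show "bs g * bs g - (1 :: 'k bop) \<in> fil 1" for g
    unfolding bs_def using bs_square_unipotent by (cases g) (simp_all del: One_nat_def)
  show "bs S1 * bs S3 = (bs S3 * bs S1 :: 'k bop)" "bs S1 * bs S2 * bs S1 = (bs S2 * bs S1 * bs S2 :: 'k bop)"
    "bs S2 * bs S3 * bs S2 = (bs S3 * bs S2 * bs S3 :: 'k bop)"
    unfolding bs_def by (simp_all only: artin_gen.case bs_braid)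
qed

interpretation bt: braid_rep bop_scalar "bt :: artin_gen \<Rightarrow> 'k::field_char_0 bop"
proof
  show "bt g * bt g - (1 :: 'k bop) \<in> fil 1" for g
    unfolding bt_def using bs_square_unipotent by (cases g) (simp_all del: One_nat_def)
  show "bt S1 * bt S3 = (bt S3 * bt S1 :: 'k bop)" "bt S1 * bt S2 * bt S1 = (bt S2 * bt S1 * bt S2 :: 'k bop)"
    "bt S2 * bt S3 * bt S2 = (bt S3 * bt S2 * bt S3 :: 'k bop)"
    unfolding bt_def by (simp_all only: artin_gen.case bs_braid)
qed

definition bx12 :: "'k::field_char_0 bop" where "bx12 = bs S1 * bs S1"
definition bx13 :: "'k::field_char_0 bop" where "bx13 = bs.y13"
definition bx14 :: "'k::field_char_0 bop" where "bx14 = bs.y14"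

lemmas bs_words = bx12_def[symmetric] bx13_def[symmetric] bx14_def[symmetric]

text \<open>The inverses inside \<open>bx13\<close> and \<open>bx14\<close> are cleared by
  multiplying with sigma_1 and sigma_2; the rest is computed in coset coordinates. This is where the
  free group becomes visible as left multiplication.\<close>

lemma bx_unit:
  "bx12 * unit P1 P1 = unit P1 P1 * gen LA"
  "bx13 * unit P1 P1 = unit P1 P1 * gen LB"
  "bx14 * unit P1 P1 = unit P1 P1 * gen LC"
proof -
  note simps = bs_def bs1_def bs2_def bs3_def distrib_left distrib_right mult.assoc unit_rules
  show "bx12 * unit P1 P1 = unit P1 P1 * gen LA"
    by (simp add: bx12_def simps)
  have "bs S1 * (bx13 * unit P1 P1) = bs S1 * (unit P1 P1 * gen LB)"
    using arg_cong[OF bs.y_words(1), of "\<lambda>T. T * unit P1 P1"] unfolding bx13_def by (simp add: mult.assoc) (simp add: simps)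
  then show "bx13 * unit P1 P1 = unit P1 P1 * gen LB" by (rule bs.s_cancel_left)
  have "bs S2 * (bs S1 * (bx14 * unit P1 P1)) = bs S2 * (bs S1 * (unit P1 P1 * gen LC))"
    using arg_cong[OF bs.y_words(5), of "\<lambda>T. T * unit P1 P1"] unfolding bx14_def by (simp add: mult.assoc) (simp add: simps)
  then show "bx14 * unit P1 P1 = unit P1 P1 * gen LC" by (rule bs.s_cancel_left[OF bs.s_cancel_left])
qed

lemma bx_unipotent: "bx12 - 1 \<in> fil 1" "bx13 - 1 \<in> fil 1" "bx14 - 1 \<in> fil 1"
  unfolding bs_words[symmetric] by (rule bs.words_unipotent)+

section \<open>Leading coefficients\<close>

text \<open>Additive on products of unipotent operators, hence a substitute for abelianisation; on
  the words of \<open>lin_coef_words\<close> it counts factors x12.\<close>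

definition lin_coef :: "'k::field_char_0 bop \<Rightarrow> 'k" where
  "lin_coef T = coef T [LA]"

lemma coef_one: "coef 1 u = (if u = [] then 1 else 0)"
  by (simp add: coef_def e1_def)

lemma lin_coef_unit: "lin_coef T = coef (T * unit P1 P1) [LA]"
  by (simp add: lin_coef_def coef_unit)

lemma lin_coef_mult:
  assumes "P - 1 \<in> fil 1" "Q - 1 \<in> fil 1" shows "lin_coef (P * Q) = lin_coef P + lin_coef Q"
proof -
  have "P * Q = (P + Q - 1) + (P - 1) * (Q - 1)" by (simp add: algebra_simps)
  moreover have "coef ((P - 1) * (Q - 1)) [LA] = 0"
    using coef_fil[OF bop.fil_mult[OF assms]] by simp
  ultimately show ?thesis by (simp add: lin_coef_def coef_simps coef_one)
qed

lemma lin_coef_eval: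
  assumes F: "nc_coeff F [] = 1" and ab: "a - 1 \<in> fil 1" "b - 1 \<in> fil 1"
  shows "lin_coef (nc_eval bop_scalar F a b) = nc_coeff F [LX] * lin_coef a + nc_coeff F [LY] * lin_coef b"
proof -
  have F1: "F - 1 \<in> fil 1" using F by (simp add: fil_ncfps_iff)
  have "nc_eval bop_scalar (F - 1) a b - bop.nc_term (F - 1) (a - 1) (b - 1) 1 \<in> fil (Suc 1)"
    using ab by (intro bop.nc_eval_approx F1) (simp_all add: fil_zero)
  then have "nc_eval bop_scalar F a b - 1 - bop.nc_term (F - 1) (a - 1) (b - 1) 1 \<in> fil (Suc 1)"
    by (simp add: bop.nc_eval_diff_one ab del: One_nat_def)
  then have "coef (nc_eval bop_scalar F a b - 1 - bop.nc_term (F - 1) (a - 1) (b - 1) 1) [LA] = 0"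
    by (rule coef_fil) simp
  then show ?thesis
    by (simp add: bop.nc_term_def words_length_1 word_eval_Cons coef_simps coef_one lin_coef_def)
qed

lemma vcoeff_e1: "vcoeff e1 p w = (if p = P1 \<and> w = [] then 1 else 0)"
  by (simp add: e1_def)

lemma app_e1: "T * proj0 = proj0 \<Longrightarrow> app T e1 = e1"
proof -
  assume T: "T * proj0 = proj0"
  have e1: "app proj0 e1 = e1" by (rule bvec_eqI) (simp add: app_proj0 e1_def)
  have "app T e1 = app (T * proj0) e1" by (simp add: e1)
  then show ?thesis by (simp add: T e1)
qed

lemmas twist_e1 = twist_proj0[THEN app_e1]

lemma lin_coef_words:
  "lin_coef (bs1 * bs1) = 1" "lin_coef (bs2 * bs2) = 0" "lin_coef (bs3 * bs3) = 0"
  "lin_coef (bs2 * bs3 * bs3 * bs2) = 0" "lin_coef (bs2 * bs1 * bs1 * bs2) = 0"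
  "lin_coef (bs1 * bs2 * bs2 * bs1) = 1" "lin_coef (bs3 * bs2 * bs2 * bs3) = 0"
  unfolding lin_coef_unit
  by (simp_all add: bs1_def bs2_def bs3_def distrib_left distrib_right mult.assoc unit_rules twist_rules)
    (simp_all add: coef_def app_unit twist_e1 gen_def app_prep vcoeff_e1 app_add)

text \<open>Under \<open>lin_coef\<close> all second arguments vanish for \<open>bs\<close>, so its
  pentagon controls only the coefficient of X. The collapsed representation \<open>bt\<close>, where
  x34 becomes x12, supplies the coefficient of Y.\<close>

lemma linear_terms_vanish:
  assumes F: "F \<in> F2" and pent: "bs.braid_pentagon F" "bt.braid_pentagon F"
  shows "F \<in> F2'"
proof -
  have F0: "nc_coeff F [] = 1" using F by (simp add: F2_def)
  define \<alpha> \<beta> where "\<alpha> = nc_coeff F [LX]" and "\<beta> = nc_coeff F [LY]"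
  note W = bs.words_unipotent bt.words_unipotent
  note simps = lin_coef_mult lin_coef_eval bop.nc_eval_unipotent bop.unipotent_mult F0 W
  have "\<alpha> = 2 * \<alpha>"
    using arg_cong[OF pent(1)[unfolded bs.braid_pentagon_def], of lin_coef]
    by (simp add: simps del: One_nat_def) (simp add: bs_def lin_coef_words \<alpha>_def)
  moreover have "\<alpha> + \<beta> = 2 * (\<alpha> + \<beta>)"
    using arg_cong[OF pent(2)[unfolded bt.braid_pentagon_def], of lin_coef]
    by (simp add: simps del: One_nat_def) (simp add: bt_def lin_coef_words \<alpha>_def \<beta>_def add.commute)
  ultimately show ?thesis using F by (simp add: F2'_def \<alpha>_def \<beta>_def)
qed

section \<open>Leading terms as matrix coefficients\<close>

lemma list_all2_disjoint:
  assumes "A \<inter> B = {}"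
  shows "list_all2 (\<lambda>l m. m \<in> case_letter A B l) w u
    \<longleftrightarrow> set u \<subseteq> A \<union> B \<and> w = map (\<lambda>m. if m \<in> A then LX else LY) u"
proof (induction w arbitrary: u)
  case (Cons l w)
  show ?case
  proof (cases u)
    case (Cons m v)
    show ?thesis unfolding Cons list_all2_Cons Cons.IH using assms by (cases l) auto
  qed simp
qed auto

text \<open>For disjoint \<open>A\<close> and \<open>B\<close> this is the coefficient of u after X
  is replaced by the sum of the letters in \<open>A\<close> and Y by the sum of those in
  \<open>B\<close>.\<close>

definition split_coeff :: "'k ncfps \<Rightarrow> letter3 set \<Rightarrow> letter3 set \<Rightarrow> letter3 list \<Rightarrow> 'k::zero" where
  "split_coeff G A B u = (if set u \<subseteq> A \<union> B then nc_coeff G (map (\<lambda>m. if m \<in> A then LX else LY) u) else 0)"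

lemma coef_nc_term:
  assumes "a * unit P1 P1 = unit P1 P1 * sum prep A" "b * unit P1 P1 = unit P1 P1 * sum prep B"
  shows "coef (bop.nc_term G a b n) u
    = (\<Sum>w | length w = n. nc_coeff G w * (if list_all2 (\<lambda>l m. m \<in> case_letter A B l) w u then 1 else 0))"
  unfolding bop.nc_term_def coef_sum coef_simps(4) word_eval_unit[OF assms] ..

lemma coef_nc_term_disjoint:
  assumes "a * unit P1 P1 = unit P1 P1 * sum prep A" "b * unit P1 P1 = unit P1 P1 * sum prep B"
    and "A \<inter> B = {}" and u: "length u = n"
  shows "coef (bop.nc_term G a b n) u = split_coeff G A B u"
proof -
  have "coef (bop.nc_term G a b n) u
    = (\<Sum>w | length w = n. if w = map (\<lambda>m. if m \<in> A then LX else LY) u then split_coeff G A B u else 0)"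
    unfolding coef_nc_term[OF assms(1,2)] list_all2_disjoint[OF assms(3)]
    by (intro sum.cong HOL.refl) (auto simp: split_coeff_def)
  then show ?thesis using u by (simp add: sum.delta)
qed

lemma bx_diff_unit:
  "(bx12 - 1) * unit P1 P1 = unit P1 P1 * sum prep {LA}" "(bx13 - 1) * unit P1 P1 = unit P1 P1 * sum prep {LB}"
  "(bx14 - 1) * unit P1 P1 = unit P1 P1 * sum prep {LC}"
  by (simp_all add: left_diff_distrib bx_unit gen_def distrib_left)

lemma bx_diff_unit':
  "(bx12 - 1 + (bx13 - 1)) * unit P1 P1 = unit P1 P1 * sum prep {LA, LB}"
  "(bx13 - 1 + (bx14 - 1)) * unit P1 P1 = unit P1 P1 * sum prep {LB, LC}"
  unfolding distrib_right bx_diff_unit by (simp_all add: distrib_left)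

text \<open>The first form allows \<open>A\<close> and \<open>B\<close> to overlap; it is needed for
  equal arguments, where both sets are \<open>{LA}\<close>.\<close>

lemma coef_nc_eval:
  assumes G: "G \<in> fil n" and ab: "a - 1 \<in> fil 1" "b - 1 \<in> fil 1"
    and a': "a - 1 - a' \<in> fil 2" "a' \<in> fil 1" and b': "b - 1 - b' \<in> fil 2" "b' \<in> fil 1"
    and unit: "a' * unit P1 P1 = unit P1 P1 * sum prep A" "b' * unit P1 P1 = unit P1 P1 * sum prep B"
    and u: "length u = n"
  shows "coef (nc_eval bop_scalar G a b) u
    = (\<Sum>w | length w = n. nc_coeff G w * (if list_all2 (\<lambda>l m. m \<in> case_letter A B l) w u then 1 else 0))"
    and "A \<inter> B = {} \<Longrightarrow> coef (nc_eval bop_scalar G a b) u = split_coeff G A B u"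
proof -
  have "coef (nc_eval bop_scalar G a b - bop.nc_term G a' b' n) u = 0"
    using coef_fil[OF bop.nc_eval_approx[OF G ab a' b']] u by simp
  then have eq: "coef (nc_eval bop_scalar G a b) u = coef (bop.nc_term G a' b' n) u" by (simp add: coef_simps)
  show "coef (nc_eval bop_scalar G a b) u
    = (\<Sum>w | length w = n. nc_coeff G w * (if list_all2 (\<lambda>l m. m \<in> case_letter A B l) w u then 1 else 0))"
    unfolding eq by (rule coef_nc_term[OF unit])
  show "A \<inter> B = {} \<Longrightarrow> coef (nc_eval bop_scalar G a b) u = split_coeff G A B u"
    unfolding eq by (rule coef_nc_term_disjoint[OF unit _ u])
qed

text \<open>Freeness of x12 and x13, degree by degree: the lowest coefficients of \<open>G\<close>
  occur among the matrix coefficients of its value.\<close>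

lemma bop_faithful:
  fixes G :: "'k::field_char_0 ncfps"
  assumes "nc_eval bop_scalar G bx12 bx13 = 0" shows "G = 0"
proof -
  have "G \<in> fil n" for n
  proof (induction n)
    case (Suc n)
    have "nc_coeff G w = 0" if w: "length w = n" for w
    proof -
      define u where "u = map (case_letter LA LB) w"
      have "map (\<lambda>m. if m \<in> {LA} then LX else LY) u = w"
        unfolding u_def by (induction w) (auto split: letter.splits)
      moreover have "set u \<subseteq> {LA} \<union> {LB}" unfolding u_def by (auto split: letter.splits)
      ultimately have "split_coeff G {LA} {LB} u = nc_coeff G w" by (simp add: split_coeff_def)
      moreover have "coef (nc_eval bop_scalar G bx12 bx13) u = split_coeff G {LA} {LB} u"
        by (rule coef_nc_eval(2)[OF Suc bx_unipotent(1,2) _ bx_unipotent(1) _ bx_unipotent(2) bx_diff_unit(1,2)])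
          (simp_all add: fil_zero u_def w)
      ultimately show ?thesis using assms by (simp add: coef_simps)
    qed
    then show ?case using Suc by (auto simp: fil_ncfps_iff less_Suc_eq)
  qed simp
  then show ?thesis using fil_separated by blast
qed

text \<open>By freeness the identity for x12 and the inverse of x12 x13 holds between series in x
  and y; the substitution y -> x^-1 y^-1 turns the inverse of x y into y.\<close>

lemma dual_series_pentagon:
  assumes F: "F \<in> F2'" and pent: "bt.braid_pentagon F"
  shows "F \<in> dual_series"
proof -
  define z where "z = alg_pow nc_const (nc_x * nc_y) (- 1 :: 'a)"
  have xy: "nc_x * nc_y - (1 :: 'a ncfps) \<in> fil 1" by (intro ncfps.unipotent_mult nc_x_unipotent nc_y_unipotent)
  have z: "z - 1 \<in> fil 1" unfolding z_def by (intro ncfps.alg_pow_fil xy)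
  define G where "G = nc_eval nc_const F z nc_x * nc_eval nc_const F nc_x z - 1"
  have "nc_eval bop_scalar F (bt S2 * bt S2) (bt S1 * bt S1) * nc_eval bop_scalar F (bt S1 * bt S1) (bt S2 * bt S2) = 1"
    by (rule dual_in_rep[OF bt.braid_rep_axioms F pent]) (simp add: bt_def)
  then have "nc_eval bop_scalar F (bs S2 * bs S2) (bs S1 * bs S1) * nc_eval bop_scalar F (bs S1 * bs S1) (bs S2 * bs S2) = 1"
    by (simp add: bt_def bs_def)
  from bs.dual_conj[OF F this]
  have dual: "nc_eval bop_scalar F (alg_pow bop_scalar (bx12 * bx13) (- 1)) bx12 * nc_eval bop_scalar F bx12 (alg_pow bop_scalar (bx12 * bx13) (- 1)) = 1"
    by (simp only: bs_words)
  interpret h: continuous_hom nc_const bop_scalar "\<lambda>F. nc_eval bop_scalar F bx12 bx13"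
    by (rule bop.nc_eval_hom[OF bx_unipotent(1,2)])
  have "nc_eval bop_scalar G bx12 bx13 = 0"
    unfolding G_def h.hom_diff h.hom_mult h.hom_one h.hom_nc_eval[OF z nc_x_unipotent] h.hom_nc_eval[OF nc_x_unipotent z]
    by (simp only: z_def h.hom_pow[OF xy] h.hom_mult bop.nc_eval_gens[OF bx_unipotent(1,2)] dual diff_self)
  then have "G = 0" by (rule bop_faithful)
  then have G: "nc_eval nc_const F z nc_x * nc_eval nc_const F nc_x z = 1" by (simp add: G_def)
  define x' y' where "x' = alg_pow nc_const nc_x (- 1 :: 'a)" and "y' = alg_pow nc_const nc_y (- 1 :: 'a)"
  have y': "y' - 1 \<in> fil 1" unfolding y'_def by (intro ncfps.alg_pow_fil nc_y_unipotent)
  have xy': "x' * y' - 1 \<in> fil 1" unfolding x'_def y'_def by (intro ncfps.unipotent_mult ncfps.alg_pow_fil nc_x_unipotent nc_y_unipotent)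
  interpret h': continuous_hom nc_const nc_const "\<lambda>F. nc_eval nc_const F nc_x (x' * y')"
    by (rule ncfps.nc_eval_hom[OF nc_x_unipotent xy'])
  have "nc_x * (x' * y') = y'"
    by (simp add: x'_def ncfps.unipotent_inverse(1)[OF nc_x_unipotent] flip: mult.assoc)
  then have "nc_eval nc_const z nc_x (x' * y') = nc_y"
    by (simp only: z_def h'.hom_pow[OF xy] h'.hom_mult ncfps.nc_eval_gens[OF nc_x_unipotent xy'])
      (simp add: y'_def ncfps.alg_pow_pow nc_y_unipotent del: One_nat_def)
  then have "nc_eval nc_const F nc_y nc_x * nc_eval nc_const F nc_x nc_y = 1"
    using arg_cong[OF G, of "\<lambda>F. nc_eval nc_const F nc_x (x' * y')"]
    by (simp only: h'.hom_mult h'.hom_one h'.hom_nc_eval z nc_x_unipotent ncfps.nc_eval_gens[OF nc_x_unipotent xy'])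
  \<comment> \<open>The two factors still stand in the opposite order; exchanging the variables
    corrects this.\<close>
  note dual = this
  interpret h'': continuous_hom nc_const nc_const "\<lambda>F. nc_eval nc_const F nc_y nc_x"
    by (rule ncfps.nc_eval_hom[OF nc_y_unipotent nc_x_unipotent])
  have "nc_eval nc_const F nc_x nc_y * nc_eval nc_const F nc_y nc_x = 1"
    using arg_cong[OF dual, of "\<lambda>F. nc_eval nc_const F nc_y nc_x"]
    by (simp only: h''.hom_mult h''.hom_one h''.hom_nc_eval nc_x_unipotent nc_y_unipotent ncfps.nc_eval_gens[OF nc_y_unipotent nc_x_unipotent])
  then show ?thesis using F by (simp add: dual_series_def)
qed

text \<open>All associators have commuting arguments, and the powers cancel because \<open>z\<close>
  is the inverse square of \<open>x\<close>.\<close>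

lemma hex_commuting:
  assumes F: "F \<in> F2'" and x: "x - 1 \<in> fil 1"
  shows "bop.hex F m x x = 1"
proof -
  define z where "z = alg_pow bop_scalar (x * x) (- 1)"
  have xx: "x * x - 1 \<in> fil 1" by (intro bop.unipotent_mult x)
  have z: "z - 1 \<in> fil 1" unfolding z_def by (intro bop.alg_pow_fil xx)
  have xz: "x * z = z * x" unfolding z_def by (intro bop.intertwine_pow xx) (simp add: mult.assoc)
  have "alg_pow bop_scalar z m = alg_pow bop_scalar x (- m) * alg_pow bop_scalar x (- m)"
    using bop.alg_pow_mult[OF x x HOL.refl, of "- m"] unfolding z_def bop.alg_pow_pow[OF xx] by simp
  then have "alg_pow bop_scalar z m * (alg_pow bop_scalar x m * alg_pow bop_scalar x m) = 1"
    using bop.alg_pow_neg(2)[OF x, of m] bop.alg_pow_neg(2)[OF x, of m, THEN assoc_rule]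
    by (simp only: mult.assoc mult_1_left)
  moreover have "nc_eval bop_scalar F z x = 1" "nc_eval bop_scalar F x z = 1" "nc_eval bop_scalar F x x = 1"
    by (intro bop.nc_eval_commuting F x z xz xz[symmetric] HOL.refl)+
  ultimately show ?thesis by (simp add: bop.hex_def Let_def z_def[symmetric] mult.assoc)
qed

definition hex_defect :: "'k::field_char_0 ncfps \<Rightarrow> 'k \<Rightarrow> 'k ncfps" where
  "hex_defect F m = ncfps.hex F m nc_x nc_y - 1"

context
  fixes F :: "'k::field_char_0 ncfps" and m :: 'k and n :: nat
  assumes F: "F \<in> dual_series" and pent: "bs.braid_pentagon F"
    and H: "ncfps.hex F m nc_x nc_y - 1 \<in> fil n"
begin

lemma hex_eq_defect:
  "a - 1 \<in> fil 1 \<Longrightarrow> b - 1 \<in> fil 1 \<Longrightarrow> bop.hex F m a b - 1 = nc_eval bop_scalar (hex_defect F m) a b"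
  by (simp add: hex_defect_def bop.nc_eval_diff_one bop.hex_eq_nc_eval del: One_nat_def)

lemma hex_defect_cocycle:
  assumes u: "length u = n" and n: "0 < n"
  shows "split_coeff (hex_defect F m) {LA} {LB} u + split_coeff (hex_defect F m) {LA, LB} {LC} u
    = split_coeff (hex_defect F m) {LA} {LB, LC} u + split_coeff (hex_defect F m) {LB} {LC} u"
proof -
  note B = bx_unipotent
  have G: "(hex_defect F m) \<in> fil n" using H by (simp add: hex_defect_def)
  have words: "bs S1 * bs S2 * bs S2 * bs S1 = bx12 * bx13" "bs.y134 = bx13 * bx14"
    using bs.y_words(6)[symmetric] bs.y_words(10)[symmetric] by (simp_all only: bs_words)
  have prod: "a * b - 1 - (a - 1 + (b - 1)) \<in> fil 2" if "a - 1 \<in> fil 1" "b - 1 \<in> fil 1" for a b :: "'k bop"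
  proof -
    have "a * b - 1 - (a - 1 + (b - 1)) = (a - 1) * (b - 1)" by (simp add: left_diff_distrib right_diff_distrib)
    then show ?thesis using bop.fil_mult[OF that] by (simp only: one_add_one)
  qed
  have BB: "bx12 * bx13 - (1 :: 'k bop) \<in> fil 1" "bx13 * bx14 - (1 :: 'k bop) \<in> fil 1"
    by (intro bop.unipotent_mult B)+
  have z: "a - a \<in> fil 2" for a :: "'k bop" by (simp add: fil_zero)
  have "(nc_eval bop_scalar (hex_defect F m) bx12 bx13 + nc_eval bop_scalar (hex_defect F m) (bx12 * bx13) bx14)
      - (nc_eval bop_scalar (hex_defect F m) bx12 (bx13 * bx14) + nc_eval bop_scalar (hex_defect F m) bx13 bx14) \<in> fil (Suc n)"
    using bs.hexagon_cocycle[OF F pent n H] unfolding bs_words words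
    by (simp only: hex_eq_defect B BB)
  then have "coef ((nc_eval bop_scalar (hex_defect F m) bx12 bx13 + nc_eval bop_scalar (hex_defect F m) (bx12 * bx13) bx14)
      - (nc_eval bop_scalar (hex_defect F m) bx12 (bx13 * bx14) + nc_eval bop_scalar (hex_defect F m) bx13 bx14)) u = 0"
    by (rule coef_fil) (simp add: u)
  moreover have "coef (nc_eval bop_scalar (hex_defect F m) bx12 bx13) u = split_coeff (hex_defect F m) {LA} {LB} u"
    by (rule coef_nc_eval(2)[OF G B(1,2) z B(1) z B(2) bx_diff_unit(1,2) u]) simp
  moreover have "coef (nc_eval bop_scalar (hex_defect F m) (bx12 * bx13) bx14) u = split_coeff (hex_defect F m) {LA, LB} {LC} u"
    by (rule coef_nc_eval(2)[OF G BB(1) B(3) prod[OF B(1,2)] fil_add[OF B(1,2)] z B(3) bx_diff_unit'(1) bx_diff_unit(3) u]) simp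
  moreover have "coef (nc_eval bop_scalar (hex_defect F m) bx12 (bx13 * bx14)) u = split_coeff (hex_defect F m) {LA} {LB, LC} u"
    by (rule coef_nc_eval(2)[OF G B(1) BB(2) z B(1) prod[OF B(2,3)] fil_add[OF B(2,3)] bx_diff_unit(1) bx_diff_unit'(2) u]) simp
  moreover have "coef (nc_eval bop_scalar (hex_defect F m) bx13 bx14) u = split_coeff (hex_defect F m) {LB} {LC} u"
    by (rule coef_nc_eval(2)[OF G B(2,3) z B(2) z B(3) bx_diff_unit(2,3) u]) simp
  ultimately show ?thesis by (simp add: coef_simps)
qed

text \<open>The cocycle identity is read at the word u with C where w has Y, B where only w' has Y,
  and A elsewhere. The terms psi(A + B, C) and psi(A, B + C) then see w and w'; the other two terms
  vanish because u contains all three letters.\<close>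

lemma hex_defect_step:
  assumes w: "length w = n" "length w' = n" and le: "\<And>i. i < n \<Longrightarrow> w ! i = LY \<Longrightarrow> w' ! i = LY"
    and ex: "\<exists>i<n. w ! i = LY" "\<exists>i<n. w' ! i = LX" "\<exists>i<n. w ! i = LX \<and> w' ! i = LY"
  shows "nc_coeff (hex_defect F m) w = nc_coeff (hex_defect F m) w'"
proof -
  define c where "c l l' = (if l = LY then LC else if l' = LY then LB else LA)" for l l'
  define u where "u = map2 c w w'"
  have nth: "u ! i = c (w ! i) (w' ! i)" if "i < n" for i using that w by (simp add: u_def)
  have len: "length u = n" using w by (simp add: u_def)
  have in_set: "c (w ! i) (w' ! i) \<in> set u" if "i < n" for i using nth[OF that] nth_mem[of i u] that len by simp
  obtain i j k where "i < n" "w ! i = LY" "j < n" "w' ! j = LX" "k < n" "w ! k = LX" "w' ! k = LY"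
    using ex by blast
  moreover have "w ! j = LX" using le[of j] \<open>j < n\<close> \<open>w' ! j = LX\<close> by (cases "w ! j") auto
  ultimately have abc: "LC \<in> set u" "LA \<in> set u" "LB \<in> set u"
    using in_set[of i] in_set[of j] in_set[of k] by (simp_all add: c_def)
  have LY: "l \<noteq> LY \<longleftrightarrow> l = LX" for l by (cases l) simp_all
  have "map (\<lambda>m. if m \<in> {LA, LB} then LX else LY) u = w"
    by (rule nth_equalityI) (use w len nth in \<open>auto simp: c_def LY\<close>)
  moreover have "map (\<lambda>m. if m \<in> {LA} then LX else LY) u = w'"
    by (rule nth_equalityI) (use w len nth le in \<open>auto simp: c_def LY\<close>)
  moreover have "set u \<subseteq> {LA} \<union> {LB, LC}" "set u \<subseteq> {LA, LB} \<union> {LC}" using UNIV_letter3 by auto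
  moreover have "\<not> set u \<subseteq> {LA} \<union> {LB}" "\<not> set u \<subseteq> {LB} \<union> {LC}" using abc by blast+
  moreover have "0 < n" using \<open>i < n\<close> by simp
  ultimately show ?thesis
    using hex_defect_cocycle[OF len] by (simp only: split_coeff_def if_True if_False add_0_left add_0_right)
qed

lemma hexagon_step:
  assumes n: "3 \<le> n" shows "ncfps.hex F m nc_x nc_y - 1 \<in> fil (Suc n)"
proof -
  define single where "single j = (replicate n LX)[j := LY]" for j
  define M where "M = {w. length w = n \<and> LX \<in> set w \<and> LY \<in> set w}"
  have single_nth: "single j ! i = (if i = j then LY else LX)" if "i < n" for i j
    using that by (simp add: single_def nth_list_update)
  \<comment> \<open>Letters X may be turned into Y as long as both kinds remain, so a mixed word can
    be compared with each word having a single Y at one of its Y-places.\<close>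
  have mixed: "nc_coeff (hex_defect F m) w = nc_coeff (hex_defect F m) (single j)" if w: "w \<in> M" "j < n" "w ! j = LY" for w j
  proof (cases "w = single j")
    case False
    then obtain k where k: "k < n" "w ! k \<noteq> single j ! k"
      using w(1) by (auto simp: M_def single_def list_eq_iff_nth_eq)
    have "k \<noteq> j" using k w single_nth by auto
    then have "w ! k = LY" using k single_nth by (cases "w ! k") auto
    then have kk: "\<exists>i<n. single j ! i = LX \<and> w ! i = LY" using k single_nth \<open>k \<noteq> j\<close> by auto
    have "\<exists>i<n. w ! i = LX" using w(1) by (auto simp: M_def in_set_conv_nth)
    moreover have "\<exists>i<n. single j ! i = LY" using w(2) single_nth by auto
    moreover have "w ! i = LY" if "i < n" "single j ! i = LY" for i
      using that single_nth w(3) by (auto split: if_splits)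
    moreover have "length (single j) = n" "length w = n" using w(1) by (simp_all add: single_def M_def)
    ultimately show ?thesis using kk hex_defect_step[of "single j" w] by simp
  qed simp
  have const: "nc_coeff (hex_defect F m) (single i) = nc_coeff (hex_defect F m) (single j)" if ij: "i < n" "j < n" for i j
  proof (cases "i = j")
    case False
    define w where "w = (replicate n LX)[i := LY, j := LY]"
    have nth: "w ! k = (if k = i \<or> k = j then LY else LX)" if "k < n" for k
      using that ij by (simp add: w_def nth_list_update)
    \<comment> \<open>For n at least 3 a word with two letters Y still contains an X and links the
      two words with a single Y.\<close>
    have "\<exists>k<n. k \<noteq> i \<and> k \<noteq> j"
    proof (rule ccontr)
      assume "\<not> ?thesis"
      then have "{..<n} \<subseteq> {i, j}" by auto
      from card_mono[OF _ this] show False using n by (simp add: card_insert_if split: if_splits)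
    qed
    then obtain k where "k < n" "w ! k = LX" using nth by auto
    moreover have "w ! i = LY" using nth[OF ij(1)] by simp
    moreover have "length w = n" by (simp add: w_def)
    ultimately have "LX \<in> set w" "LY \<in> set w" using nth_mem[of k w] nth_mem[of i w] ij by simp_all
    then have "w \<in> M" by (simp add: M_def w_def)
    then show ?thesis using mixed[of w i] mixed[of w j] nth ij by simp
  qed simp
  define c where "c = nc_coeff (hex_defect F m) (single 0)"
  have M: "nc_coeff (hex_defect F m) w = c" if w: "w \<in> M" for w
  proof -
    obtain j where j: "j < n" "w ! j = LY" using w by (auto simp: M_def in_set_conv_nth)
    then show ?thesis using mixed[OF w j] const[of j 0] n by (simp add: c_def)
  qed
  have rep: "set (replicate n LA) = {LA}" "set (replicate n LC) = {LC}" using n by auto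
  \<comment> \<open>At A^n the identity reads c + c = c for the coefficient c of X^n, and at C^n it
    reads c = c + c for that of Y^n.\<close>
  have X: "nc_coeff (hex_defect F m) (replicate n LX) = 0" and Y: "nc_coeff (hex_defect F m) (replicate n LY) = 0"
    using hex_defect_cocycle[of "replicate n LA"] hex_defect_cocycle[of "replicate n LC"] n
    by (simp_all add: split_coeff_def rep map_replicate)
  \<comment> \<open>Equal arguments add up all coefficients of degree n, and the defect vanishes
    there.\<close>
  have sum_words: "(\<Sum>w | length w = n. nc_coeff (hex_defect F m) w) = 0"
  proof -
    have "nc_eval bop_scalar (hex_defect F m) bx12 bx12 = 0"
      using hex_eq_defect[OF bx_unipotent(1,1)] hex_commuting[OF _ bx_unipotent(1), of F m] F by (simp add: dual_series_def)
    moreover have "coef (nc_eval bop_scalar (hex_defect F m) bx12 bx12) (replicate n LA)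
      = (\<Sum>w | length w = n. nc_coeff (hex_defect F m) w * (if list_all2 (\<lambda>l m. m \<in> case_letter {LA} {LA} l) w (replicate n LA) then 1 else 0))"
      using H by (intro coef_nc_eval(1)[OF _ bx_unipotent(1,1) _ bx_unipotent(1) _ bx_unipotent(1) bx_diff_unit(1,1)])
        (simp_all add: fil_zero hex_defect_def)
    moreover have "\<dots> = (\<Sum>w | length w = n. nc_coeff (hex_defect F m) w)"
    proof (intro sum.cong HOL.refl)
      have "m \<in> case_letter {LA} {LA} l \<longleftrightarrow> m = LA" for m l by (cases l) simp_all
      then show "nc_coeff (hex_defect F m) w * (if list_all2 (\<lambda>l m. m \<in> case_letter {LA} {LA} l) w (replicate n LA) then 1 else 0)
        = nc_coeff (hex_defect F m) w" if "w \<in> {w. length w = n}" for w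
        using that by (simp add: list_all2_conv_all_nth)
    qed
    ultimately show ?thesis by (simp add: coef_simps)
  qed
  have pure: "w = replicate n LX \<or> w = replicate n LY" if "length w = n" "w \<notin> M" for w
  proof -
    have "w = replicate n l" if "set w \<subseteq> {l}" for l using that \<open>length w = n\<close> by (intro replicate_eqI) auto
    moreover have "set w \<subseteq> {LX} \<or> set w \<subseteq> {LY}"
    proof -
      have "l = LX \<or> l = LY" for l by (cases l) simp_all
      then have "set w \<subseteq> {LX}" if "LY \<notin> set w" using that by (metis insertI1 subsetI)
      moreover have "set w \<subseteq> {LY}" if "LX \<notin> set w"
        using that \<open>\<And>l. l = LX \<or> l = LY\<close> by (metis insertI1 subsetI)
      ultimately show ?thesis using \<open>w \<notin> M\<close> \<open>length w = n\<close> by (auto simp: M_def)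
    qed
    ultimately show ?thesis by blast
  qed
  have "(\<Sum>w | length w = n. nc_coeff (hex_defect F m) w) = (\<Sum>w\<in>M. nc_coeff (hex_defect F m) w)"
  proof (rule sum.mono_neutral_right)
    show "\<forall>w\<in>{w. length w = n} - M. nc_coeff (hex_defect F m) w = 0" using pure X Y by (metis DiffE mem_Collect_eq)
  qed (auto simp: M_def)
  also have "\<dots> = of_nat (card M) * c" using M by simp
  finally have "of_nat (card M) * c = 0" using sum_words by simp
  moreover have "single 0 \<in> M"
  proof -
    have "length (single 0) = n" by (simp add: single_def)
    then show ?thesis
      using n single_nth[of 0 0] single_nth[of 1 0] nth_mem[of 0 "single 0"] nth_mem[of 1 "single 0"] by (simp add: M_def)
  qed
  then have "card M \<noteq> 0" using finite_subset[of M "{w. length w = n}"] by (auto simp: M_def)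
  ultimately have "c = 0" by simp
  then have "nc_coeff (hex_defect F m) w = 0" if "length w = n" for w
    using pure[OF that] X Y M[of w] by (cases "w \<in> M") auto
  then show ?thesis using H by (auto simp: fil_ncfps_iff hex_defect_def less_Suc_eq)
qed

end

section \<open>Low degrees\<close>

lemma nc_coeff_mult_low:
  "nc_coeff (f * g) [] = nc_coeff f [] * nc_coeff g []"
  "nc_coeff (f * g) [a] = nc_coeff f [] * nc_coeff g [a] + nc_coeff f [a] * nc_coeff g []"
  "nc_coeff (f * g) [a, b] = nc_coeff f [] * nc_coeff g [a, b] + nc_coeff f [a] * nc_coeff g [b] + nc_coeff f [a, b] * nc_coeff g []"
  by (simp_all add: nc_coeff_mult)

lemma nc_coeff_cong: "f - g \<in> fil n \<Longrightarrow> length w < n \<Longrightarrow> nc_coeff f w = nc_coeff g w"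
  by (auto simp: fil_ncfps_iff)

lemma unipotent_coeff: "f - 1 \<in> fil 1 \<longleftrightarrow> nc_coeff f [] = 1"
  by (auto simp: fil_ncfps_iff)

lemma nc_coeff_alg_exp:
  fixes f :: "'k::field_char_0 ncfps"
  assumes "nc_coeff f [] = 0"
  shows "nc_coeff (alg_exp nc_const f) [] = 1" "nc_coeff (alg_exp nc_const f) [a] = nc_coeff f [a]"
    "nc_coeff (alg_exp nc_const f) [a, b] = nc_coeff f [a, b] + nc_coeff f [a] * nc_coeff f [b] / 2"
proof -
  have f: "f \<in> fil 1" using assms by (simp add: fil_ncfps_iff)
  have "alg_exp nc_const f - (\<Sum>n<3. nc_const (1 / fact n) * f ^ n) \<in> fil 3"
    unfolding alg_exp_def by (rule ncfps.suminf_fil) (rule ncfps.exp_term_fil[OF f])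
  then have "alg_exp nc_const f - (1 + f + nc_const (1 / 2) * (f * f)) \<in> fil 3"
    by (simp add: numeral_3_eq_3 power2_eq_square eval_nat_numeral)
  from nc_coeff_cong[OF this] show "nc_coeff (alg_exp nc_const f) [] = 1"
    "nc_coeff (alg_exp nc_const f) [a] = nc_coeff f [a]"
    "nc_coeff (alg_exp nc_const f) [a, b] = nc_coeff f [a, b] + nc_coeff f [a] * nc_coeff f [b] / 2"
    by (simp_all add: nc_coeff_mult_low assms)
qed

text \<open>Solved from exp(log f) = f, so that the logarithm series need not be expanded.\<close>

lemma nc_coeff_alg_log:
  fixes f :: "'k::field_char_0 ncfps"
  assumes "nc_coeff f [] = 1"
  shows "nc_coeff (alg_log nc_const f) [] = 0" "nc_coeff (alg_log nc_const f) [a] = nc_coeff f [a]"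
    "nc_coeff (alg_log nc_const f) [a, b] = nc_coeff f [a, b] - nc_coeff f [a] * nc_coeff f [b] / 2"
proof -
  define g where "g = alg_log nc_const f"
  have f: "f - 1 \<in> fil 1" using assms by (simp add: unipotent_coeff del: One_nat_def)
  have "g \<in> fil 1" unfolding g_def by (rule ncfps.alg_log_fil[OF f])
  then have g: "nc_coeff g [] = 0" by (simp add: fil_ncfps_iff)
  have "alg_exp nc_const g = f" unfolding g_def by (rule ncfps.alg_exp_log[OF f])
  then show "nc_coeff g [] = 0" "nc_coeff g [a] = nc_coeff f [a]"
    "nc_coeff g [a, b] = nc_coeff f [a, b] - nc_coeff f [a] * nc_coeff f [b] / 2"
    using nc_coeff_alg_exp[OF g] g by auto
qed

lemma nc_coeff_alg_pow:
  fixes f :: "'k::field_char_0 ncfps"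
  assumes "nc_coeff f [] = 1"
  shows "nc_coeff (alg_pow nc_const f m) [] = 1" "nc_coeff (alg_pow nc_const f m) [a] = m * nc_coeff f [a]"
    "nc_coeff (alg_pow nc_const f m) [a, b] = m * nc_coeff f [a, b] + m * (m - 1) / 2 * nc_coeff f [a] * nc_coeff f [b]"
  by (simp_all add: alg_pow_def nc_coeff_alg_exp nc_coeff_alg_log[OF assms] field_simps)

lemma words_length_2: "{w :: letter list. length w = 2} = {[LX, LX], [LX, LY], [LY, LX], [LY, LY]}"
proof -
  have "l = LX \<or> l = LY" for l by (cases l) simp_all
  then show ?thesis by (auto simp: numeral_2_eq_2 length_Suc_conv)
qed

lemma F2'_coeff:
  fixes F :: "'k::field_char_0 ncfps"
  assumes F: "F \<in> F2'"
  shows "nc_coeff F [] = 1" "nc_coeff F [l] = 0" "nc_coeff F [l, l] = 0" "nc_coeff F [LY, LX] = - nc_coeff F [LX, LY]"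
proof -
  have lin: "nc_coeff F [l] = 0" for l using F by (cases l) (auto simp: F2'_def)
  then show "nc_coeff F [l] = 0" .
  show "nc_coeff F [] = 1" using F by (simp add: F2'_def F2_def)
  show "nc_coeff F [l, l] = 0"
    using F2_coeff_replicate[of F l 1] F lin[of l] by (simp add: F2'_def)
  have "nc_coproduct F [LX] [LY] = nc_coeff F [LX, LY] + nc_coeff F [LY, LX]"
    using words_length_2 by (simp add: nc_coproduct_def numeral_2_eq_2[symmetric])
  then show "nc_coeff F [LY, LX] = - nc_coeff F [LX, LY]"
    using F lin by (simp add: F2'_def F2_def eq_neg_iff_add_eq_0 add.commute)
qed

text \<open>Through degree 2 the series is 1 + c_2 [X, Y], so only the commutator of the linear
  parts of the arguments enters.\<close>

lemma nc_coeff_nc_eval: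
  fixes F :: "'k::field_char_0 ncfps"
  assumes F: "F \<in> F2'" and f: "nc_coeff f [] = 1" and g: "nc_coeff g [] = 1"
  shows "nc_coeff (nc_eval nc_const F f g) [] = 1" "nc_coeff (nc_eval nc_const F f g) [a] = 0"
    "nc_coeff (nc_eval nc_const F f g) [a, b]
      = c2 F * (nc_coeff f [a] * nc_coeff g [b] - nc_coeff g [a] * nc_coeff f [b])"
proof -
  have fg: "f - 1 \<in> fil 1" "g - 1 \<in> fil 1" using f g by (simp_all add: unipotent_coeff del: One_nat_def)
  have "F - 1 \<in> fil 2"
    using F2'_coeff[OF F] by (auto simp: fil_ncfps_iff less_2_cases_iff length_Suc_conv)
  from ncfps.nc_eval_approx[OF this fg, of "f - 1" "g - 1"]
  have "nc_eval nc_const (F - 1) f g - ncfps.nc_term (F - 1) (f - 1) (g - 1) 2 \<in> fil 3"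
    using fg by (simp add: fil_zero del: One_nat_def)
  then have "nc_eval nc_const F f g - (1 + ncfps.nc_term (F - 1) (f - 1) (g - 1) 2) \<in> fil 3"
    using fg by (simp add: ncfps.nc_eval_diff_one diff_diff_eq del: One_nat_def)
  moreover have "ncfps.nc_term (F - 1) (f - 1) (g - 1) 2
      = nc_const (c2 F) * ((f - 1) * (g - 1)) + nc_const (- c2 F) * ((g - 1) * (f - 1))"
    using F2'_coeff[OF F] by (simp add: ncfps.nc_term_def words_length_2 word_eval_Cons c2_def)
  ultimately have "nc_eval nc_const F f g
      - (1 + (nc_const (c2 F) * ((f - 1) * (g - 1)) + nc_const (- c2 F) * ((g - 1) * (f - 1)))) \<in> fil 3"
    by simp
  note eq = nc_coeff_cong[OF this]
  show "nc_coeff (nc_eval nc_const F f g) [] = 1" "nc_coeff (nc_eval nc_const F f g) [a] = 0"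
    "nc_coeff (nc_eval nc_const F f g) [a, b]
      = c2 F * (nc_coeff f [a] * nc_coeff g [b] - nc_coeff g [a] * nc_coeff f [b])"
    by (simp_all add: eq nc_coeff_mult_low f g algebra_simps)
qed

text \<open>With z = -X - Y to first order, each of the three associators contributes c_2 [X, Y]. By
  Campbell-Hausdorff the product z^m y^m x^m contributes -m(m + 1)/2 times the same
  commutator.\<close>

lemma nc_coeff_hex:
  fixes F :: "'k::field_char_0 ncfps"
  assumes F: "F \<in> F2'"
  shows "nc_coeff (ncfps.hex F m nc_x nc_y) [] = 1" "nc_coeff (ncfps.hex F m nc_x nc_y) [a] = 0"
    "nc_coeff (ncfps.hex F m nc_x nc_y) [a, a] = 0"
    "nc_coeff (ncfps.hex F m nc_x nc_y) [LX, LY] = 3 * c2 F - m * (m + 1) / 2"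
    "nc_coeff (ncfps.hex F m nc_x nc_y) [LY, LX] = - (3 * c2 F - m * (m + 1) / 2)"
proof -
  define z where "z = alg_pow nc_const (nc_x * nc_y) (- 1 :: 'k)"
  have gens: "nc_coeff nc_x [] = (1 :: 'k)" "nc_coeff nc_y [] = (1 :: 'k)"
    "nc_coeff nc_x [a] = (if a = LX then 1 else 0 :: 'k)" "nc_coeff nc_y [a] = (if a = LY then 1 else 0 :: 'k)"
    "nc_coeff nc_x [a, b] = (if a = LX \<and> b = LX then 1 / 2 else 0 :: 'k)"
    "nc_coeff nc_y [a, b] = (if a = LY \<and> b = LY then 1 / 2 else 0 :: 'k)" for a b
    by (simp_all add: nc_coeff_alg_exp)
  have xy: "nc_coeff (nc_x * nc_y) [] = (1 :: 'k)" "nc_coeff (nc_x * nc_y) [a] = (1 :: 'k)"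
    "nc_coeff (nc_x * nc_y) [LX, LX] = (1 / 2 :: 'k)" "nc_coeff (nc_x * nc_y) [LX, LY] = (1 :: 'k)"
    "nc_coeff (nc_x * nc_y) [LY, LX] = (0 :: 'k)" "nc_coeff (nc_x * nc_y) [LY, LY] = (1 / 2 :: 'k)" for a
    by (cases a; simp add: nc_coeff_mult_low gens; fail)+
  have z: "nc_coeff z [] = (1 :: 'k)" "nc_coeff z [a] = (- 1 :: 'k)"
    "nc_coeff z [LX, LX] = (1 / 2 :: 'k)" "nc_coeff z [LX, LY] = (0 :: 'k)"
    "nc_coeff z [LY, LX] = (1 :: 'k)" "nc_coeff z [LY, LY] = (1 / 2 :: 'k)" for a
    unfolding z_def by (simp_all add: nc_coeff_alg_pow xy)
  note coeffs = nc_coeff_mult_low nc_coeff_nc_eval[OF F] nc_coeff_alg_pow gens z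
  show "nc_coeff (ncfps.hex F m nc_x nc_y) [] = 1" "nc_coeff (ncfps.hex F m nc_x nc_y) [a] = 0"
    "nc_coeff (ncfps.hex F m nc_x nc_y) [a, a] = 0"
    "nc_coeff (ncfps.hex F m nc_x nc_y) [LX, LY] = 3 * c2 F - m * (m + 1) / 2"
    "nc_coeff (ncfps.hex F m nc_x nc_y) [LY, LX] = - (3 * c2 F - m * (m + 1) / 2)"
    unfolding ncfps.hex_def Let_def z_def[symmetric]
    by (cases a; simp add: coeffs; simp add: field_simps; fail)+
qed

lemma hexagons_iff:
  "hexagons l F \<longleftrightarrow> ncfps.hex F ((l - 1) / 2) nc_x nc_y = 1
     \<and> nc_eval nc_const F nc_x nc_y * nc_eval nc_const F nc_y nc_x = 1"
proof -
  have xy: "nc_x * nc_y - (1 :: 'a ncfps) \<in> fil 1" by (intro ncfps.unipotent_mult nc_x_unipotent nc_y_unipotent)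
  have "nc_x * nc_y * z = 1 \<longleftrightarrow> z = alg_pow nc_const (nc_x * nc_y) (- 1 :: 'a)" for z
  proof
    assume "nc_x * nc_y * z = 1"
    then have "alg_pow nc_const (nc_x * nc_y) (- 1) * (nc_x * nc_y * z) = alg_pow nc_const (nc_x * nc_y) (- 1)" by simp
    then show "z = alg_pow nc_const (nc_x * nc_y) (- 1 :: 'a)"
      using ncfps.unipotent_inverse(2)[OF xy, THEN assoc_rule, of z] by simp
  qed (simp add: ncfps.unipotent_inverse(1)[OF xy])
  then show ?thesis unfolding hexagons_def ncfps.hex_def Let_def by simp
qed

lemma hexagons_iff_square:
  fixes F :: "'k::field_char_0 ncfps"
  assumes F: "F \<in> dual_series" and pent: "bs.braid_pentagon F"
  shows "hexagons l F \<longleftrightarrow> l\<^sup>2 = 24 * c2 F + 1"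
proof -
  define m where "m = (l - 1) / 2"
  have F': "F \<in> F2'" and dual: "nc_eval nc_const F nc_x nc_y * nc_eval nc_const F nc_y nc_x = 1"
    using F by (simp_all add: dual_series_def)
  have "2 * m = l - 1" unfolding m_def by simp
  then have "l = 2 * m + 1" by (simp add: algebra_simps)
  \<comment> \<open>Since (2m + 1)^2 = 4m(m + 1) + 1, this is the degree 2 obstruction multiplied by
    -8.\<close>
  then have eq: "l\<^sup>2 - (24 * c2 F + 1) = - 8 * (3 * c2 F - m * (m + 1) / 2)"
    by (simp add: power2_eq_square field_simps)
  have square: "l\<^sup>2 = 24 * c2 F + 1 \<longleftrightarrow> 3 * c2 F - m * (m + 1) / 2 = 0"
    unfolding right_minus_eq[of "l\<^sup>2", symmetric] eq mult_eq_0_iff by simp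
  have "ncfps.hex F m nc_x nc_y = 1 \<longleftrightarrow> 3 * c2 F - m * (m + 1) / 2 = 0"
  proof
    assume "ncfps.hex F m nc_x nc_y = 1"
    then show "3 * c2 F - m * (m + 1) / 2 = 0" using nc_coeff_hex(4)[OF F', of m] by simp
  next
    assume zero: "3 * c2 F - m * (m + 1) / 2 = 0"
    have XY: "nc_coeff (ncfps.hex F m nc_x nc_y) [LX, LY] = 0" "nc_coeff (ncfps.hex F m nc_x nc_y) [LY, LX] = 0"
      by (simp_all only: nc_coeff_hex(4,5)[OF F'] zero minus_zero)
    have base: "ncfps.hex F m nc_x nc_y - 1 \<in> fil 3"
      unfolding fil_ncfps_iff
    proof (intro allI impI)
      fix w :: "letter list" assume "length w < 3"
      then consider "w = []" | a where "w = [a]" | "w \<in> {w. length w = 2}"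
        by (auto simp: less_Suc_eq numeral_3_eq_3 numeral_2_eq_2 length_Suc_conv)
      then show "nc_coeff (ncfps.hex F m nc_x nc_y - 1) w = 0"
        unfolding words_length_2 by cases (auto simp: nc_coeff_hex(1-3)[OF F'] XY)
    qed
    have "ncfps.hex F m nc_x nc_y - 1 \<in> fil n" if "3 \<le> n" for n
      using that
    proof (induction n rule: dec_induct)
      case (step n)
      then show ?case by (intro hexagon_step[OF F pent]) simp_all
    qed (rule base)
    then have "ncfps.hex F m nc_x nc_y - 1 \<in> fil n" for n
      using fil_antimono[of n "max n 3"] by auto
    then show "ncfps.hex F m nc_x nc_y = 1" by (rule fil_eqI)
  qed
  then show ?thesis by (simp add: hexagons_iff dual square m_def)
qed

theorem theorem2:
  fixes f :: "'k::field_char_0 ncfps"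
  assumes "f \<in> F2" and "pentagon f"
  shows "\<exists>l :: 'k alg_closure.
           hexagons l (map_ncfps to_ac f) \<and>
           (\<forall>l'. hexagons l' (map_ncfps to_ac f) \<longleftrightarrow> l' = l \<or> l' = - l) \<and>
           l\<^sup>2 = to_ac (24 * c2 f + 1)"
proof -
  define F where "F = map_ncfps to_ac f"
  have F: "F \<in> F2" unfolding F_def by (rule F2_map_to_ac) (rule assms)
  \<comment> \<open>The first serves the cocycle identity, the second the antisymmetry; both
    together kill the linear terms.\<close>
  have pent: "bs.braid_pentagon F" "bt.braid_pentagon F"
    unfolding bs.braid_pentagon_def bt.braid_pentagon_def F_def
    by (rule pentagon_rep[OF bs.braid_rep_axioms assms], rule pentagon_rep[OF bt.braid_rep_axioms assms])
  have F': "F \<in> F2'" by (rule linear_terms_vanish[OF F pent])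
  have dual: "F \<in> dual_series" by (rule dual_series_pentagon[OF F' pent(2)])
  have c2: "24 * c2 F + 1 = to_ac (24 * c2 f + 1)" by (simp add: F_def c2_def map_ncfps.rep_eq)
  obtain l :: "'k alg_closure" where l: "l\<^sup>2 = to_ac (24 * c2 f + 1)"
    using nth_root_exists[of 2 "to_ac (24 * c2 f + 1)"] by auto
  have "hexagons l' F \<longleftrightarrow> l' = l \<or> l' = - l" for l'
    unfolding hexagons_iff_square[OF dual pent(1)] c2 l[symmetric] by (simp add: power2_eq_iff)
  then show ?thesis using l unfolding F_def by blast
qed

end
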